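(* There exists a sequence of real numbers $\{\lambda_n\}_{n\in\mathbb Z}$ such that the system of exponentials $\{e^{i\lambda_n t}\}_{n\in\mathbb Z}$ is complete and minimal in $L^2(-\pi,\pi)$, its biorthogonal system is complete, but the system is not hereditarily complete; i.e., there is a partition $\mathbb Z=N_1\cup N_2$ such that $\{e^{i\lambda_nt}\}_{n\in N_1}\cup\{\tilde e_n\}_{n\in N_2}$ is not complete in $L^2(-\pi,\pi)$, where $\{\tilde e_n\}$ is the biorthogonal system.
   Context: A system $\{x_n\}_{n\in N}$ in a Hilbert space $H$ is exact if it is complete and minimal; it then has a unique biorthogonal system $\{x_n'\}$, $(x_m,x_n')=\delta_{mn}$. An exact system is hereditarily complete if for every partition $N=N_1\cup N_2$, $N_1\cap N_2=\emptyset$, the system $\{x_n\}_{n\in N_1}\cup\{x'_n\}_{n\in N_2}$ is complete in $H$ (equivalently, every $x\in H$ lies in the closed span of $\{(x,x_n')x_n\}$). *)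

theory Defs
  imports "HOL-Analysis.Analysis"
begin

text \<open>The Hilbert space L^2(-pi,pi) of complex-valued functions, modelled concretely
  (elements identified up to a.e. equality only implicitly: all notions below are
  invariant under a.e. modification).\<close>

abbreviation L2meas :: "real measure" where
  "L2meas \<equiv> lebesgue_on {-pi<..<pi}"

definition L2 :: "(real \<Rightarrow> complex) set" where
  "L2 = {f. f \<in> borel_measurable L2meas \<and> integrable L2meas (\<lambda>t. (cmod (f t))\<^sup>2)}"

definition l2_inner :: "(real \<Rightarrow> complex) \<Rightarrow> (real \<Rightarrow> complex) \<Rightarrow> complex" where
  "l2_inner f g = (LINT t|L2meas. f t * cnj (g t))"

definition l2_dist :: "(real \<Rightarrow> complex) \<Rightarrow> (real \<Rightarrow> complex) \<Rightarrow> real" where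
  "l2_dist f g = sqrt (LINT t|L2meas. (cmod (f t - g t))\<^sup>2)"

definition in_closed_span :: "('i \<Rightarrow> real \<Rightarrow> complex) \<Rightarrow> 'i set \<Rightarrow> (real \<Rightarrow> complex) \<Rightarrow> bool" where
  "in_closed_span F I f \<longleftrightarrow>
     (\<forall>\<epsilon>>0. \<exists>J c. finite J \<and> J \<subseteq> I \<and> l2_dist f (\<lambda>t. \<Sum>n\<in>J. c n * F n t) < \<epsilon>)"

definition l2_complete :: "('i \<Rightarrow> real \<Rightarrow> complex) \<Rightarrow> 'i set \<Rightarrow> bool" where
  "l2_complete F I \<longleftrightarrow> (\<forall>n\<in>I. F n \<in> L2) \<and> (\<forall>f\<in>L2. in_closed_span F I f)"

definition l2_minimal :: "('i \<Rightarrow> real \<Rightarrow> complex) \<Rightarrow> 'i set \<Rightarrow> bool" where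
  "l2_minimal F I \<longleftrightarrow> (\<forall>n\<in>I. F n \<in> L2) \<and> (\<forall>m\<in>I. \<not> in_closed_span F (I - {m}) (F m))"

definition l2_exact :: "('i \<Rightarrow> real \<Rightarrow> complex) \<Rightarrow> bool" where
  "l2_exact F \<longleftrightarrow> l2_complete F UNIV \<and> l2_minimal F UNIV"

definition biorthogonal :: "('i \<Rightarrow> real \<Rightarrow> complex) \<Rightarrow> ('i \<Rightarrow> real \<Rightarrow> complex) \<Rightarrow> bool" where
  "biorthogonal F G \<longleftrightarrow> (\<forall>n. G n \<in> L2) \<and>
     (\<forall>m n. l2_inner (F m) (G n) = (if m = n then 1 else 0))"

definition hereditarily_complete :: "('i \<Rightarrow> real \<Rightarrow> complex) \<Rightarrow> ('i \<Rightarrow> real \<Rightarrow> complex) \<Rightarrow> bool" where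
  "hereditarily_complete F G \<longleftrightarrow>
     (\<forall>N1. l2_complete (\<lambda>n. if n \<in> N1 then F n else G n) UNIV)"

end

theory Submission
  imports Defs
begin

text \<open>
  Start from the orthonormal basis of integer frequencies and replace a lacunary set of integers
  \<open>b\<^sub>0 = 0, b\<^sub>1, b\<^sub>2, \<dots>\<close> by real frequencies \<open>a\<^sub>0, a\<^sub>1, \<dots>\<close>. With
  \<open>\<Phi>(x) = x\<^sup>-\<^sup>1 \<Prod> (1 - x/a\<^sub>n) / (1 - x/b\<^sub>n\<^sub>+\<^sub>1) = \<Sum> r\<^sub>j / (x - b\<^sub>j)\<close> the generating
  function of the new system is \<open>sin(\<pi>x) \<Phi>(x)\<close>, so that up to signs the new exponentials have the
  coefficients \<open>1 / (a\<^sub>n - b\<^sub>j)\<close> at the removed frequencies and the biorthogonal functions have the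
  coefficients \<open>r\<^sub>j / (a\<^sub>n - b\<^sub>j)\<close>. Rational functions with poles at the \<open>a\<^sub>n\<close> and zeros at all
  but two of the first \<open>b\<^sub>j\<close> give both completeness statements: the sequence \<open>r\<close>, formally
  orthogonal to the exponentials, and the constant sequence, formally orthogonal to the
  biorthogonal functions, are not square summable.

  The frequencies are chosen so that \<open>\<Phi>(x) = A(x) U(x)\<close>, where \<open>A\<close> has zeros \<open>p\<^sub>k\<close> and poles
  \<open>q\<^sub>k\<close>, while \<open>U\<close> has zeros \<open>\<lambda>\<^sub>k\<close> and poles \<open>0\<close> and \<open>t\<^sub>k = q\<^sub>k + 1\<close>. The coefficients of
  \<open>A(x)/x\<close> form a vector \<open>g\<close> orthogonal to the exponentials with frequencies \<open>p\<^sub>k\<close>. As the poles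
  \<open>q\<^sub>k\<close> and \<open>t\<^sub>k\<close> are adjacent, \<open>A(t\<^sub>k)\<close> grows exponentially, so \<open>f\<^sub>t = 1/A(t)\<close> defines a vector
  \<open>f\<close>, and it is orthogonal to the biorthogonal functions of the frequencies \<open>\<lambda>\<^sub>k\<close> because
  \<open>U(\<lambda>\<^sub>k) = 0\<close>. Since \<open>f\<close> and \<open>g\<close> are not orthogonal to each other, \<open>g\<close> is not in the closed
  span of the corresponding mixed system.
\<close>

subsection \<open>Partial fractions and the sequences of poles and nodes\<close>

text \<open>The numbers balance three growth rates. In a residue of \<Phi> each earlier block
  contributes two factors of at most 3 and the own block a factor of order 5^k, so the residues are
  at most of order 45^k; this has to be summable against the poles, which have size 100^k. On the
  other hand their growth 5^k has to beat the crude bound 3^k for the residues of U, because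
  \<open>f\<close> at t_k is the quotient of the two. Finally the gap q_k - p_k = 5^(k+1)/2 has to
  be small against 100^k, which makes \<open>g\<close> summable. The halves keep all new frequencies
  off the integers, so that sin(pi a_n) never vanishes.

  The pole 0 is neither a q_k nor a t_k: it is the only common point of the supports of
  \<open>f\<close> and \<open>g\<close>, so their inner product is a single term.

  All infinite series of exponentials have absolutely summable coefficients and are estimated
  pointwise. Neither \<Phi> at the untouched integers nor its derivative at the a_n is estimated:
  completeness of the exponentials comes first and forces the nonvanishing that the biorthogonal
  functions depend on.\<close>

text \<open>Residue at \<open>y l\<close> of
  \<open>(\<Prod>k<K. (1 - x / z k) / (1 - x / y k)) / x\<close>; the leading factor comes from the
  pair with index \<open>l\<close> together with \<open>1 / x\<close>.\<close>

definition pf_res :: "(nat \<Rightarrow> real) \<Rightarrow> (nat \<Rightarrow> real) \<Rightarrow> nat \<Rightarrow> nat \<Rightarrow> real" where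
  "pf_res z y K l = (y l / z l - 1) * (\<Prod>k\<in>{..<K} - {l}. (1 - y l / z k) / (1 - y l / y k))"

lemma pf_res_Suc:
  assumes "l < K"
  shows "pf_res z y (Suc K) l = pf_res z y K l * ((1 - y l / z K) / (1 - y l / y K))"
proof -
  have "{..<Suc K} - {l} = insert K ({..<K} - {l})" using assms by auto
  then show ?thesis by (simp add: pf_res_def)
qed

lemma pf_res_last: "pf_res z y (Suc K) K = (y K / z K - 1) * (\<Prod>k<K. (1 - y K / z k) / (1 - y K / y k))"
proof -
  have "{..<Suc K} - {K} = {..<K}" by auto
  then show ?thesis by (simp add: pf_res_def)
qed

text \<open>The induction step for one more zero and pole: a single factor times an existing simple
  pole at \<open>v\<close> splits into simple poles at \<open>v\<close> and
  \<open>y\<close>.\<close>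

lemma moebius_partial_fraction:
  fixes x y z v :: real
  assumes "x \<noteq> y" "v \<noteq> y" "x \<noteq> v" "y \<noteq> 0" "z \<noteq> 0"
  shows "((1 - x / z) / (1 - x / y)) / (x - v) =
     ((1 - v / z) / (1 - v / y)) / (x - v) + (y / z * (y - z) / (y - v)) / (x - y)"
proof -
  have "(1 - x / z) / (1 - x / y) = y / z * ((x - z) / (x - y))"
       "(1 - v / z) / (1 - v / y) = y / z * ((v - z) / (v - y))"
    using assms by (simp_all add: divide_simps) (simp_all add: algebra_simps)
  moreover have "(x - z) / (x - y) / (x - v) = (v - z) / (v - y) / (x - v) + (y - z) / (y - v) / (x - y)"
  proof -
    have ne: "x - y \<noteq> 0" "x - v \<noteq> 0" "v - y \<noteq> 0" "y - v \<noteq> 0" using assms by auto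
    have "(v - z) / (v - y) / (x - v) + (y - z) / (y - v) / (x - y)
        = ((v - z) * (x - y) - (y - z) * (x - v)) / ((v - y) * (x - v) * (x - y))"
      using ne by (simp add: divide_simps) (simp add: algebra_simps)
    also have "(v - z) * (x - y) - (y - z) * (x - v) = (x - z) * (v - y)" by (simp add: algebra_simps)
    finally show ?thesis using ne by simp
  qed
  ultimately show ?thesis
    by (metis (no_types, lifting) times_divide_eq_right distrib_left)
qed

lemma partial_fractions:
  fixes x :: real
  assumes "inj_on y {..<K}" "\<And>k. k < K \<Longrightarrow> y k \<noteq> 0" "\<And>k. k < K \<Longrightarrow> z k \<noteq> 0"
    and "x \<noteq> 0" "\<And>k. k < K \<Longrightarrow> x \<noteq> y k"
  shows "(\<Prod>k<K. (1 - x / z k) / (1 - x / y k)) / x = 1 / x + (\<Sum>l<K. pf_res z y K l / (x - y l))"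
  using assms
proof (induction K arbitrary: x)
  case 0
  then show ?case by simp
next
  case (Suc K)
  let ?T = "\<lambda>x. (1 - x / z K) / (1 - x / y K)"
  let ?c = "y K / z K * (y K - z K)"
  have inj: "inj_on y {..<K}" using Suc.prems(1) by (rule inj_on_subset) auto
  have yK: "y K \<noteq> 0" and zK: "z K \<noteq> 0" and xK: "x \<noteq> y K" using Suc.prems by auto
  have neq: "y k \<noteq> y K" if "k < K" for k
    using Suc.prems(1) that by (auto simp: inj_on_def)
  have IH: "(\<Prod>k<K. (1 - x / z k) / (1 - x / y k)) / x = 1 / x + (\<Sum>l<K. pf_res z y K l / (x - y l))"
    using Suc.prems by (intro Suc.IH inj) auto
  \<comment> \<open>The induction hypothesis is also used at the new pole: it sums what all old
    poles contribute to the residue there.\<close>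
  have IHy: "(\<Prod>k<K. (1 - y K / z k) / (1 - y K / y k)) / y K
      = 1 / y K + (\<Sum>l<K. pf_res z y K l / (y K - y l))"
    using Suc.prems neq by (intro Suc.IH inj) force+
  have "(\<Prod>k<Suc K. (1 - x / z k) / (1 - x / y k)) / x
      = ?T x / (x - 0) + (\<Sum>l<K. pf_res z y K l * (?T x / (x - y l)))"
  proof -
    have "(\<Prod>k<Suc K. (1 - x / z k) / (1 - x / y k)) / x = ((\<Prod>k<K. (1 - x / z k) / (1 - x / y k)) / x) * ?T x"
      by simp
    also have "\<dots> = 1 / x * ?T x + (\<Sum>l<K. pf_res z y K l / (x - y l) * ?T x)"
      unfolding IH by (simp only: distrib_right sum_distrib_right)
    finally show ?thesis by (simp add: mult.commute)
  qed
  also have "?T x / (x - 0) = 1 / x + ?c / y K / (x - y K)"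
    using moebius_partial_fraction[of x "y K" 0 "z K"] xK yK zK Suc.prems by simp
  also have "(\<Sum>l<K. pf_res z y K l * (?T x / (x - y l)))
      = (\<Sum>l<K. pf_res z y K l * (?T (y l) / (x - y l) + ?c / (y K - y l) / (x - y K)))"
    using xK yK zK neq Suc.prems
    by (intro sum.cong refl, subst moebius_partial_fraction) (auto simp: less_Suc_eq)
  also have "\<dots> = (\<Sum>l<K. pf_res z y (Suc K) l / (x - y l)) +
      ?c / (x - y K) * (\<Sum>l<K. pf_res z y K l / (y K - y l))"
    by (simp add: pf_res_Suc sum.distrib sum_distrib_left sum_divide_distrib distrib_left mult_ac)
  finally have expand: "(\<Prod>k<Suc K. (1 - x / z k) / (1 - x / y k)) / x = 1 / x + ?c / y K / (x - y K) +
     ((\<Sum>l<K. pf_res z y (Suc K) l / (x - y l)) + ?c / (x - y K) * (\<Sum>l<K. pf_res z y K l / (y K - y l)))" .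
  have "(\<Prod>k<Suc K. (1 - x / z k) / (1 - x / y k)) / x
      = 1 / x + (\<Sum>l<K. pf_res z y (Suc K) l / (x - y l)) + 
        ?c / (x - y K) * (1 / y K + (\<Sum>l<K. pf_res z y K l / (y K - y l)))"
  proof -
    have "?c / y K / (x - y K) = ?c / (x - y K) * (1 / y K)" by (simp add: mult_ac)
    with expand show ?thesis by (simp only: distrib_left add_ac)
  qed
  also have "?c / (x - y K) * (1 / y K + (\<Sum>l<K. pf_res z y K l / (y K - y l))) = pf_res z y (Suc K) K / (x - y K)"
  proof -
    have "y K / z K * (y K - z K) / (x - y K) * (P / y K) = (y K / z K - 1) * P / (x - y K)" for P
      using yK zK by (simp add: diff_divide_distrib right_diff_distrib left_diff_distrib mult_ac)
    then show ?thesis unfolding IHy[symmetric] pf_res_last .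
  qed
  finally show ?case by simp
qed

section \<open>Convergence of the residues as further zeros and poles are added\<close>

text \<open>The deficits \<open>1/4 * (1/2)^i\<close> add up to 1/2. The extra term
  \<open>(1/2)^Suc n\<close> is the part not yet spent after \<open>n\<close> factors; with it the
  induction closes.\<close>

lemma product_lower_bound:
  fixes c :: "nat \<Rightarrow> real"
  assumes "\<And>i. 1 - 1/4 * (1/2)^i \<le> c i"
  shows "1/2 + (1/2)^Suc n \<le> (\<Prod>i<n. c i)"
proof (induction n)
  case (Suc n)
  define h where "h = (1/2::real)^Suc n"
  have h: "0 < h" "h \<le> 1/2" unfolding h_def by (auto simp: power_le_one)
  have "1/2 + h/2 \<le> (1/2 + h) * (1 - h/2)"
    using h mult_left_mono[of h "1/2" h] by (simp add: algebra_simps)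
  also have "\<dots> \<le> (\<Prod>i<n. c i) * c n"
  proof (intro mult_mono)
    show "1/2 + h \<le> (\<Prod>i<n. c i)" using Suc by (simp add: h_def)
    show "1 - h/2 \<le> c n" using assms[of n] by (simp add: h_def)
    show "0 \<le> 1 - h/2" using h by simp
    then show "0 \<le> (\<Prod>i<n. c i)" using \<open>1/2 + h \<le> _\<close> h by linarith
  qed
  finally show ?case by (simp add: h_def)
qed simp

lemma product_converges:
  fixes c :: "nat \<Rightarrow> real"
  assumes "\<And>i. 1 - 1/4 * (1/2)^i \<le> c i" "\<And>i. c i \<le> 1"
  obtains L where "(\<lambda>n. \<Prod>i<n. c i) \<longlonglongrightarrow> L" "1/2 \<le> L"
    "\<And>n. (\<Prod>i<n. c i) \<le> 1" "\<And>n. 1/2 \<le> (\<Prod>i<n. c i)"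
proof -
  have lb: "1/2 \<le> (\<Prod>i<n. c i)" for n
    using product_lower_bound[of c n, OF assms(1)] zero_le_power[of "1/2::real" "Suc n"] by linarith
  have pos: "0 \<le> c i" for i
  proof -
    have "(1/2::real)^i \<le> 1" by (simp add: power_le_one)
    then show ?thesis using assms(1)[of i] by linarith
  qed
  have ub: "(\<Prod>i<n. c i) \<le> 1" for n by (intro prod_le_1) (use assms pos in auto)
  have "decseq (\<lambda>n. \<Prod>i<n. c i)"
  proof (rule decseq_SucI)
    fix n
    have "0 \<le> (\<Prod>i<n. c i)" using lb[of n] by linarith
    then show "(\<Prod>i<Suc n. c i) \<le> (\<Prod>i<n. c i)"
      using assms(2)[of n] by (simp add: mult_left_le)
  qed
  then obtain L where L: "(\<lambda>n. \<Prod>i<n. c i) \<longlonglongrightarrow> L"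
    using decseq_convergent[of _ "1/2"] lb by blast
  moreover have "1/2 \<le> L" using L lb by (intro LIMSEQ_le_const) auto
  ultimately show thesis using that lb ub by blast
qed

text \<open>Every factor added from index \<open>N\<close> on lies between
  \<open>1 - 1/4 * (1/2)^i\<close> and 1, so in absolute value the residue only shrinks, and by at
  most one half. This yields a majorant uniform in \<open>K\<close> and a lower bound for the
  limit.\<close>

lemma pf_res_limit:
  fixes z y :: "nat \<Rightarrow> real"
  assumes zy: "\<And>k. 0 < z k" "\<And>k. z k \<le> y k" and "l < N"
    and small: "\<And>i. y l / z (N + i) \<le> 1/4 * (1/2)^i"
  obtains R where "(\<lambda>K. pf_res z y K l) \<longlonglongrightarrow> R" "\<bar>pf_res z y N l\<bar> / 2 \<le> \<bar>R\<bar>"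
    "\<And>K. N \<le> K \<Longrightarrow> \<bar>pf_res z y K l\<bar> \<le> \<bar>pf_res z y N l\<bar>"
proof -
  define c where "c i = (1 - y l / z (N + i)) / (1 - y l / y (N + i))" for i
  have yl: "0 < y l" using zy[of l] by linarith
  have c: "1 - 1/4 * (1/2)^i \<le> c i" "c i \<le> 1" for i
  proof -
    let ?u = "y l / z (N + i)" and ?v = "y l / y (N + i)"
    have v: "0 < ?v" using yl zy[of "N + i"] by simp
    have vu: "?v \<le> ?u" using yl zy[of "N + i"] by (simp add: frac_le)
    have "(1/2::real)^i \<le> 1" by (simp add: power_le_one)
    then have u: "?u \<le> 1/4" using small[of i] by linarith
    have "1 - ?u \<le> (1 - ?u) / (1 - ?v)"
    proof (subst pos_le_divide_eq)
      show "0 < 1 - ?v" using u vu by linarith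
      show "(1 - ?u) * (1 - ?v) \<le> 1 - ?u" using u v by (intro mult_left_le) linarith+
    qed
    then show "1 - 1/4 * (1/2)^i \<le> c i" using small[of i] unfolding c_def by linarith
    show "c i \<le> 1" unfolding c_def
    proof (subst pos_divide_le_eq)
      show "0 < 1 - ?v" using u vu by linarith
      show "1 - ?u \<le> 1 * (1 - ?v)" using vu by simp
    qed
  qed
  have eq: "pf_res z y (N + n) l = pf_res z y N l * (\<Prod>i<n. c i)" for n
  proof (induction n)
    case (Suc n)
    then show ?case using pf_res_Suc[of l "N + n" z y] \<open>l < N\<close> by (simp add: c_def)
  qed simp
  obtain L where L: "(\<lambda>n. \<Prod>i<n. c i) \<longlonglongrightarrow> L" "1/2 \<le> L"
    "\<And>n. (\<Prod>i<n. c i) \<le> 1" "\<And>n. 1/2 \<le> (\<Prod>i<n. c i)" using product_converges[of c] c by blast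
  show thesis
  proof (rule that)
    have "(\<lambda>n. pf_res z y (n + N) l) \<longlonglongrightarrow> pf_res z y N l * L"
      using tendsto_mult[OF tendsto_const L(1), of "pf_res z y N l"] eq by (simp add: add.commute)
    then show "(\<lambda>K. pf_res z y K l) \<longlonglongrightarrow> pf_res z y N l * L" by (rule LIMSEQ_offset)
    show "\<bar>pf_res z y N l\<bar> / 2 \<le> \<bar>pf_res z y N l * L\<bar>"
      using L(2) mult_left_mono[of "1/2" L "\<bar>pf_res z y N l\<bar>"] by (simp add: abs_mult)
    fix K assume "N \<le> K"
    then obtain n where K: "K = N + n" using le_Suc_ex by blast
    show "\<bar>pf_res z y K l\<bar> \<le> \<bar>pf_res z y N l\<bar>"
      unfolding K eq abs_mult using L(3,4)[of n]
      by (intro mult_left_le) auto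
  qed
qed

text \<open>As soon as \<open>y l \<ge> 2 * \<bar>x\<bar>\<close>, the distance
  \<open>\<bar>x - y l\<bar>\<close> is at least \<open>y l / 2\<close>. The point \<open>x\<close>
  may itself be a pole; its term is then 0 by the convention for division.\<close>

lemma summable_residue_bound:
  fixes y M :: "nat \<Rightarrow> real"
  assumes M: "summable (\<lambda>l. M l / y l)" "\<And>l. 0 \<le> M l" and y: "\<And>l. 0 < y l" "filterlim y at_top sequentially"
  shows "summable (\<lambda>l. M l / \<bar>x - y l\<bar>)"
proof (rule summable_comparison_test_ev)
  have "eventually (\<lambda>l. y l \<ge> 2 * \<bar>x\<bar>) sequentially"
    using y(2) by (simp add: filterlim_at_top)
  then show "eventually (\<lambda>l. norm (M l / \<bar>x - y l\<bar>) \<le> 2 * (M l / y l)) sequentially"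
  proof eventually_elim
    case (elim l)
    have "y l / 2 \<le> \<bar>x - y l\<bar>" using elim y(1)[of l] by linarith
    then have "M l / \<bar>x - y l\<bar> \<le> M l / (y l / 2)" using M(2)[of l] y(1)[of l] by (intro frac_le) auto
    then show ?case using M(2)[of l] by (simp add: mult.commute)
  qed
  show "summable (\<lambda>l. 2 * (M l / y l))" using M(1) by (rule summable_mult)
qed

text \<open>At \<open>z i\<close> the finite product vanishes once \<open>i < K\<close>, and
  dominated convergence for series carries this to the limit. The right-hand side is the term
  \<open>1 / x\<close> of the pole 0, moved across.\<close>

lemma pf_limit_zero:
  fixes z y M R :: "nat \<Rightarrow> real"
  assumes y: "inj y" "\<And>l. 0 < y l" "filterlim y at_top sequentially"
    and z: "\<And>k. 0 < z k" "\<And>k l. z k \<noteq> y l"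
    and M: "summable (\<lambda>l. M l / y l)" "\<And>K l. l < K \<Longrightarrow> \<bar>pf_res z y K l\<bar> \<le> M l"
    and R: "\<And>l. (\<lambda>K. pf_res z y K l) \<longlonglongrightarrow> R l"
  shows "(\<lambda>l. R l / (z i - y l)) sums (- 1 / z i)" "\<And>l. \<bar>R l\<bar> \<le> M l"
proof -
  have M0: "0 \<le> M l" for l using M(2)[of l "Suc l"] by linarith
  show RM: "\<bar>R l\<bar> \<le> M l" for l
    by (rule tendsto_upperbound[OF tendsto_rabs[OF R]])
       (auto simp: eventually_sequentially intro!: exI[of _ "Suc l"] M(2))
  \<comment> \<open>Padding with zeros turns the finite sums into series over a fixed index set, as
    Tannery's theorem requires.\<close>
  define f where "f l K = (if l < K then pf_res z y K l / (z i - y l) else 0)" for l K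
  have sm: "summable (\<lambda>l. M l / \<bar>z i - y l\<bar>)"
    by (rule summable_residue_bound) (use M M0 y in auto)
  have f_le: "norm (f l K) \<le> M l / \<bar>z i - y l\<bar>" for l K
    using M(2)[of l K] M0[of l] by (auto simp: f_def abs_divide intro!: divide_right_mono)
  have f_lim: "(f l \<longlongrightarrow> R l / (z i - y l)) sequentially" for l
  proof (rule Lim_transform_eventually)
    show "(\<lambda>K. pf_res z y K l / (z i - y l)) \<longlonglongrightarrow> R l / (z i - y l)"
      by (intro tendsto_divide R tendsto_const) (use z(2) in auto)
    show "\<forall>\<^sub>F K in sequentially. pf_res z y K l / (z i - y l) = f l K"
      using eventually_gt_at_top[of l] by eventually_elim (simp add: f_def)
  qed
  have sR: "summable (\<lambda>l. norm (R l / (z i - y l)))"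
    by (rule summable_comparison_test[OF _ sm]) (use RM in \<open>auto simp: abs_divide intro!: divide_right_mono\<close>)
  have "((\<lambda>K. \<Sum>l. f l K) \<longlongrightarrow> (\<Sum>l. R l / (z i - y l))) sequentially"
    using tannerys_theorem[OF f_lim _ sm] f_le by (simp add: always_eventually split_beta)
  moreover have "\<forall>\<^sub>F K in sequentially. (\<Sum>l. f l K) = - 1 / z i"
    using eventually_gt_at_top[of i]
  proof eventually_elim
    case (elim K)
    have "(\<Prod>k<K. (1 - z i / z k) / (1 - z i / y k)) = 0"
      using elim z(1)[of i] by (intro prod_zero) (auto intro!: bexI[of _ i])
    moreover have "(\<Prod>k<K. (1 - z i / z k) / (1 - z i / y k)) / z i
        = 1 / z i + (\<Sum>l<K. pf_res z y K l / (z i - y l))"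
    proof (rule partial_fractions)
      show "inj_on y {..<K}" using y(1) inj_on_subset by blast
    qed (use y(2) z in \<open>auto simp: less_imp_neq[symmetric]\<close>)
    moreover have "(\<Sum>l. f l K) = (\<Sum>l<K. f l K)"
      by (rule suminf_finite) (auto simp: f_def)
    ultimately have "1 / z i + (\<Sum>l<K. pf_res z y K l / (z i - y l)) = 0" by (metis div_0)
    then show ?case using \<open>(\<Sum>l. f l K) = (\<Sum>l<K. f l K)\<close> by (simp add: f_def)
  qed
  ultimately have "(\<Sum>l. R l / (z i - y l)) = - 1 / z i"
    by (metis LIMSEQ_unique tendsto_eventually)
  then show "(\<lambda>l. R l / (z i - y l)) sums (- 1 / z i)"
    using summable_sums[OF summable_norm_cancel[OF sR]] by simp
qed

section \<open>Rational functions with prescribed poles and zeros\<close>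

text \<open>Multiplication by \<open>(A * x + B) / (x - w)\<close> preserves sums of simple poles
  and adds the pole \<open>w\<close>. Numerator 1 builds up the poles; numerator
  \<open>x - v\<close> then adds a zero together with a pole, so that the numerator stays of smaller
  degree.\<close>

lemma partial_fractions_exist:
  fixes Y Z :: "real set"
  assumes "finite Z" "finite Y" "card Z < card Y"
  shows "\<exists>\<alpha>. \<forall>x. x \<notin> Y \<longrightarrow> (\<Prod>v\<in>Z. x - v) / (\<Prod>y\<in>Y. x - y) = (\<Sum>y\<in>Y. \<alpha> y / (x - y))"
proof -
  have step: "\<exists>\<alpha>. \<forall>x. x \<notin> insert w Y \<longrightarrow> (A * x + B) / (x - w) * g x = (\<Sum>y\<in>insert w Y. \<alpha> y / (x - y))"
    if Y: "finite Y" "w \<notin> Y" and g: "\<And>x. x \<notin> Y \<Longrightarrow> g x = (\<Sum>y\<in>Y. \<beta> y / (x - y))"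
    for Y :: "real set" and w A B g \<beta>
  proof -
    define C where "C = (A * w + B) * (\<Sum>y\<in>Y. \<beta> y / (w - y))"
    define \<alpha> where "\<alpha> y = (if y = w then C else (A * y + B) / (y - w) * \<beta> y)" for y
    have "(A * x + B) / (x - w) * g x = (\<Sum>y\<in>insert w Y. \<alpha> y / (x - y))" if x: "x \<notin> insert w Y" for x
    proof -
      have "(A * x + B) / (x - w) * (\<beta> y / (x - y)) = \<alpha> y / (x - y) + (A * w + B) * (\<beta> y / (w - y)) / (x - w)"
        if "y \<in> Y" for y
      proof -
        have ne: "x - w \<noteq> 0" "x - y \<noteq> 0" "y - w \<noteq> 0" "w - y \<noteq> 0" "y \<noteq> w" using x that Y by auto
        have "(A * x + B) / (x - w) / (x - y) = (A * y + B) / (y - w) / (x - y) + (A * w + B) / (w - y) / (x - w)"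
        proof -
          have "(A * y + B) / (y - w) / (x - y) + (A * w + B) / (w - y) / (x - w)
              = ((A * y + B) * (x - w) - (A * w + B) * (x - y)) / ((y - w) * (x - y) * (x - w))"
            using ne by (simp add: divide_simps) (simp add: algebra_simps)
          also have "(A * y + B) * (x - w) - (A * w + B) * (x - y) = (A * x + B) * (y - w)"
            by (simp add: algebra_simps)
          finally show ?thesis using ne by simp
        qed
        then have "(A * x + B) / (x - w) / (x - y) * \<beta> y
            = (A * y + B) / (y - w) / (x - y) * \<beta> y + (A * w + B) / (w - y) / (x - w) * \<beta> y"
          by (simp only: distrib_right)
        then show ?thesis using ne by (simp add: \<alpha>_def)
      qed
      then have "(A * x + B) / (x - w) * g x = (\<Sum>y\<in>Y. \<alpha> y / (x - y)) + (\<Sum>y\<in>Y. (A * w + B) * (\<beta> y / (w - y)) / (x - w))"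
        using x by (simp add: g sum_distrib_left flip: sum.distrib)
      also have "(\<Sum>y\<in>Y. (A * w + B) * (\<beta> y / (w - y)) / (x - w)) = \<alpha> w / (x - w)"
        by (simp add: \<alpha>_def C_def sum_divide_distrib sum_distrib_left)
      finally show ?thesis using Y by simp
    qed
    then show ?thesis by blast
  qed
  have base: "\<exists>\<alpha>. \<forall>x. x \<notin> Y \<longrightarrow> 1 / (\<Prod>y\<in>Y. x - y) = (\<Sum>y\<in>Y. \<alpha> y / (x - y))"
    if "finite Y" "Y \<noteq> {}" for Y :: "real set"
    using that
  proof (induction rule: finite_ne_induct)
    case (singleton w)
    show ?case by (rule exI[of _ "\<lambda>_. 1"]) auto
  next
    case (insert w Y)
    then obtain \<beta> where "\<forall>x. x \<notin> Y \<longrightarrow> 1 / (\<Prod>y\<in>Y. x - y) = (\<Sum>y\<in>Y. \<beta> y / (x - y))" by blast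
    then have "\<exists>\<alpha>. \<forall>x. x \<notin> insert w Y \<longrightarrow> (0 * x + 1) / (x - w) * (1 / (\<Prod>y\<in>Y. x - y)) = (\<Sum>y\<in>insert w Y. \<alpha> y / (x - y))"
      using insert.hyps by (intro step) auto
    moreover have "(0 * x + 1) / (x - w) * (1 / (\<Prod>y\<in>Y. x - y)) = 1 / (\<Prod>y\<in>insert w Y. x - y)" for x
      using insert.hyps by simp
    ultimately show ?case by simp
  qed
  show ?thesis using assms
  proof (induction Z arbitrary: Y rule: finite_induct)
    case empty
    then show ?case using base[of Y] by force
  next
    case (insert v Z)
    then obtain w where w: "w \<in> Y" by fastforce
    have Y: "Y = insert w (Y - {w})" using w by auto
    have e: "(\<Prod>y\<in>Y. x - y) = (x - w) * (\<Prod>y\<in>Y - {w}. x - y)" for x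
      using insert.prems w by (intro prod.remove) auto
    have "card Z < card (Y - {w})" using insert w by simp
    then obtain \<beta> where "\<forall>x. x \<notin> Y - {w} \<longrightarrow> (\<Prod>v\<in>Z. x - v) / (\<Prod>y\<in>Y - {w}. x - y) = (\<Sum>y\<in>Y - {w}. \<beta> y / (x - y))"
      using insert.IH[of "Y - {w}"] insert.prems by auto
    then have "\<exists>\<alpha>. \<forall>x. x \<notin> insert w (Y - {w}) \<longrightarrow>
       (1 * x + - v) / (x - w) * ((\<Prod>v\<in>Z. x - v) / (\<Prod>y\<in>Y - {w}. x - y)) = (\<Sum>y\<in>insert w (Y - {w}). \<alpha> y / (x - y))"
      using insert.prems by (intro step) auto
    then show ?case unfolding Y[symmetric] e using insert.hyps by simp
  qed
qed

text \<open>Residues of the truncation of \<Phi> at \<open>b 0, ..., b K\<close>. The pole 0 comes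
  from the factor \<open>1 / x\<close> and always has residue 1; the zero \<open>a k\<close> is
  paired with the pole \<open>b (Suc k)\<close>.\<close>

definition pole_res :: "(nat \<Rightarrow> real) \<Rightarrow> (nat \<Rightarrow> real) \<Rightarrow> nat \<Rightarrow> nat \<Rightarrow> real" where
  "pole_res a b K j = (case j of 0 \<Rightarrow> 1 | Suc l \<Rightarrow> pf_res a (\<lambda>l. b (Suc l)) K l)"

text \<open>The truncation is a constant times \<open>\<Prod>k<K. x - a k\<close> over
  \<open>\<Prod>i\<le>K. x - b i\<close>. In this form the pole 0 is no longer special, so two
  arbitrary poles \<open>j\<close> and \<open>c\<close> can be singled out later.\<close>

lemma pole_res_symmetric:
  fixes a b :: "nat \<Rightarrow> real"
  assumes b: "b 0 = 0" "strict_mono b" and a: "\<And>k. 0 < a k" and "j \<le> K"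
  shows "pole_res a b K j = (\<Prod>k<K. b (Suc k) / a k) * (\<Prod>k<K. b j - a k) / (\<Prod>i\<in>{..K} - {j}. b j - b i)"
proof -
  have bpos: "0 < b (Suc k)" for k using strict_monoD[OF b(2), of 0 "Suc k"] b(1) by simp
  have bne: "b i \<noteq> b k" if "i \<noteq> k" for i k using strict_mono_eq[OF b(2)] that by blast
  show ?thesis
  proof (cases j)
    case 0
    have "{..K} - {0} = Suc ` {..<K}" 
    proof (rule set_eqI)
      fix i
      show "i \<in> {..K} - {0} \<longleftrightarrow> i \<in> Suc ` {..<K}"
        by (cases i) (auto simp: image_iff)
    qed
    then have "(\<Prod>i\<in>{..K} - {0}. 0 - b i) = (\<Prod>k<K. - b (Suc k))"
      by (simp add: prod.reindex b(1))
    moreover have "(\<Prod>k<K. b (Suc k) / a k) * (\<Prod>k<K. 0 - a k) / (\<Prod>k<K. - b (Suc k)) = 1"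
    proof -
      have "(\<Prod>k<K. b (Suc k) / a k) * (\<Prod>k<K. 0 - a k) / (\<Prod>k<K. - b (Suc k))
        = (\<Prod>k<K. b (Suc k) / a k * (0 - a k) / (- b (Suc k)))"
        by (simp only: prod.distrib prod_dividef)
      also have "\<dots> = (\<Prod>k<K. 1)"
      proof (intro prod.cong refl)
        fix k
        show "b (Suc k) / a k * (0 - a k) / (- b (Suc k)) = 1" using a[of k] bpos[of k] by simp
      qed
      finally show ?thesis by (simp only: prod.neutral_const)
    qed
    ultimately show ?thesis unfolding 0 b(1) pole_res_def by (simp only: nat.case)
  next
    case (Suc l)
    have l: "l < K" using Suc assms by simp
    have "{..K} - {Suc l} = insert 0 (Suc ` ({..<K} - {l}))"
    proof (rule set_eqI)
      fix i
      show "i \<in> {..K} - {Suc l} \<longleftrightarrow> i \<in> insert 0 (Suc ` ({..<K} - {l}))"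
        by (cases i) (auto simp: image_iff)
    qed
    then have den: "(\<Prod>i\<in>{..K} - {j}. b j - b i) = b j * (\<Prod>k\<in>{..<K} - {l}. b j - b (Suc k))"
      using Suc b(1) by (simp add: prod.reindex)
    have split: "(\<Prod>k<K. g k) = g l * (\<Prod>k\<in>{..<K} - {l}. g k)" for g :: "nat \<Rightarrow> real"
      using l by (intro prod.remove) auto
    have "(\<Prod>k<K. b (Suc k) / a k) * (\<Prod>k<K. b j - a k) / (\<Prod>i\<in>{..K} - {j}. b j - b i)
      = (b j / a l * (b j - a l) / b j) * (\<Prod>k\<in>{..<K} - {l}. b (Suc k) / a k * (b j - a k) / (b j - b (Suc k)))"
      unfolding den prod.distrib prod_dividef split[of "\<lambda>k. b (Suc k)"] split[of a] split[of "\<lambda>k. b j - a k"]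
      using Suc by (simp add: mult_ac)
    also have "b j / a l * (b j - a l) / b j = b j / a l - 1"
      using bpos[of l] a[of l] Suc by (simp add: field_simps)
    also have "(\<Prod>k\<in>{..<K} - {l}. b (Suc k) / a k * (b j - a k) / (b j - b (Suc k)))
       = (\<Prod>k\<in>{..<K} - {l}. (1 - b j / a k) / (1 - b j / b (Suc k)))"
    proof (intro prod.cong refl)
      fix k assume "k \<in> {..<K} - {l}"
      then have "b j \<noteq> b (Suc k)" using bne Suc by auto
      then show "b (Suc k) / a k * (b j - a k) / (b j - b (Suc k)) = (1 - b j / a k) / (1 - b j / b (Suc k))"
        using a[of k] bpos[of k] by (simp add: divide_simps) (simp add: algebra_simps)
    qed
    finally show ?thesis using Suc by (simp add: pole_res_def pf_res_def)
  qed
qed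

text \<open>The sums are values of a normalised rational function with poles at the first
  \<open>K\<close> nodes and zeros at all of \<open>b 0, ..., b K\<close> except \<open>b j\<close>
  and \<open>b c\<close>. Its product with the truncated \<Phi> is a constant over
  \<open>(x - b j) * (x - b c)\<close>, whose two residues are opposite; this fixes the ratio of the
  values at \<open>b c\<close> and \<open>b j\<close>.\<close>

lemma cauchy_approximants:
  fixes a b :: "nat \<Rightarrow> real"
  assumes b: "b 0 = 0" "strict_mono b" and a: "\<And>k. 0 < a k" "\<And>k. a k < b (Suc k)" "inj a" "\<And>k i. a k \<noteq> b i"
    and jc: "j \<le> K" "c \<le> K" "j \<noteq> c"
  obtains \<alpha> where "(\<Sum>n<K. \<alpha> n / (b j - a n)) = 1"
    "(\<Sum>n<K. \<alpha> n / (b c - a n)) = - pole_res a b K j / pole_res a b K c"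
    "\<And>i. i \<le> K \<Longrightarrow> i \<noteq> j \<Longrightarrow> i \<noteq> c \<Longrightarrow> (\<Sum>n<K. \<alpha> n / (b i - a n)) = 0"
    "\<And>i. K < i \<Longrightarrow> \<bar>\<Sum>n<K. \<alpha> n / (b i - a n)\<bar> \<le> \<bar>pole_res a b K j\<bar> * \<bar>b j - b c\<bar> * (b i / ((b i - b j) * (b i - b c)))"
proof -
  have bpos: "0 < b (Suc k)" for k using strict_monoD[OF b(2), of 0 "Suc k"] b(1) by simp
  have bne: "b i \<noteq> b k" if "i \<noteq> k" for i k using strict_mono_eq[OF b(2)] that by blast
  define N where "N = {..K} - {j, c}"
  define \<kappa> where "\<kappa> = (\<Prod>k<K. b (Suc k) / a k)"
  have \<kappa>: "1 \<le> \<kappa>" unfolding \<kappa>_def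
    by (intro prod_ge_1) (use a in \<open>auto simp: less_imp_le\<close>)
  define F where "F x = (\<Prod>i\<in>N. x - b i) / (\<Prod>n<K. x - a n)" for x
  have injb: "inj_on b N" using b(2) by (meson inj_on_subset strict_mono_imp_inj_on subset_UNIV)
  have inja: "inj_on a {..<K}" using a(3) inj_on_subset by blast
  have cN: "card (b ` N) < card (a ` {..<K})"
  proof -
    have "card (b ` N) = card N" using injb by (rule card_image)
    also have "card N = Suc K - 2" unfolding N_def using jc by (simp add: card_Diff_subset)
    also have "\<dots> < K" using jc by linarith
    finally show ?thesis using inja by (simp add: card_image)
  qed
  obtain \<beta> where \<beta>: "\<And>x. x \<notin> a ` {..<K} \<Longrightarrow> (\<Prod>v\<in>b ` N. x - v) / (\<Prod>y\<in>a ` {..<K}. x - y) = (\<Sum>y\<in>a ` {..<K}. \<beta> y / (x - y))"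
    using partial_fractions_exist[OF _ _ cN] unfolding N_def by auto
  have Fsum: "F (b i) = (\<Sum>n<K. \<beta> (a n) / (b i - a n))" for i
  proof -
    have "b i \<notin> a ` {..<K}" using a(4) by (metis imageE)
    from \<beta>[OF this] show ?thesis using injb inja by (simp add: F_def prod.reindex sum.reindex)
  qed
  have ane: "(\<Prod>n<K. b i - a n) \<noteq> 0" for i using a(4) by (auto simp: eq_commute[of "b i"])
  have key: "F (b i) * pole_res a b K i = \<kappa> / (b i - b k)" and rne: "pole_res a b K i \<noteq> 0"
    if ik: "i \<noteq> k" "i \<le> K" "k \<le> K" and Nik: "N = {..K} - {i, k}" for i k
  proof -
    have "{..K} - {i} = insert k N" "k \<notin> N" using ik unfolding Nik by auto
    then have "(\<Prod>m\<in>{..K} - {i}. b i - b m) = (b i - b k) * (\<Prod>m\<in>N. b i - b m)"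
      by (simp add: N_def)
    then have r: "pole_res a b K i = \<kappa> * (\<Prod>n<K. b i - a n) / ((b i - b k) * (\<Prod>m\<in>N. b i - b m))"
      using pole_res_symmetric[OF b a(1) ik(2)] by (simp add: \<kappa>_def)
    have nz: "(\<Prod>m\<in>N. b i - b m) \<noteq> 0" using bne[of i] by (auto simp: Nik)
    show "F (b i) * pole_res a b K i = \<kappa> / (b i - b k)"
      unfolding r F_def using nz ane[of i] bne[OF ik(1)] by simp
    show "pole_res a b K i \<noteq> 0" unfolding r using \<kappa> ane[of i] nz bne[OF ik(1)] by simp
  qed
  have kj: "F (b j) * pole_res a b K j = \<kappa> / (b j - b c)" and kc: "F (b c) * pole_res a b K c = \<kappa> / (b c - b j)"
    and rj: "pole_res a b K j \<noteq> 0" and rc: "pole_res a b K c \<noteq> 0"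
    using key[of j c] key[of c j] rne[of j c] rne[of c j] jc by (auto simp: N_def insert_commute)
  have Fj: "F (b j) \<noteq> 0" using kj \<kappa> bne[OF jc(3)] by auto
  define \<alpha> where "\<alpha> n = \<beta> (a n) / F (b j)" for n
  have \<alpha>F: "(\<Sum>n<K. \<alpha> n / (b i - a n)) = F (b i) / F (b j)" for i
    unfolding Fsum[of i] \<alpha>_def by (simp add: sum_divide_distrib mult.commute)
  show thesis
  proof (rule that[of \<alpha>])
    show "(\<Sum>n<K. \<alpha> n / (b j - a n)) = 1" using Fj by (simp add: \<alpha>F)
    have "F (b c) * pole_res a b K c = - (F (b j) * pole_res a b K j)"
      unfolding kj kc by (metis minus_diff_eq minus_divide_right)
    then show "(\<Sum>n<K. \<alpha> n / (b c - a n)) = - pole_res a b K j / pole_res a b K c"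
      unfolding \<alpha>F using Fj rc by (simp add: field_simps)
    show "(\<Sum>n<K. \<alpha> n / (b i - a n)) = 0" if "i \<le> K" "i \<noteq> j" "i \<noteq> c" for i
    proof -
      have "(\<Prod>m\<in>N. b i - b m) = 0" using that by (intro prod_zero) (auto simp: N_def)
      then show ?thesis unfolding \<alpha>F F_def by simp
    qed
    show "\<bar>\<Sum>n<K. \<alpha> n / (b i - a n)\<bar> \<le> \<bar>pole_res a b K j\<bar> * \<bar>b j - b c\<bar> * (b i / ((b i - b j) * (b i - b c)))"
      if "K < i" for i
    proof -
      have gt: "0 < b i - b m" if "m \<le> K" for m using strict_monoD[OF b(2), of m i] that \<open>K < i\<close> by simp
      have bi: "0 < b i" using gt[of 0] b(1) by simp
      have D: "0 < (b i - b j) * (b i - b c)" using gt jc by simp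
      have "{..K} = insert j (insert c N)" "j \<notin> insert c N" "c \<notin> N" using jc by (auto simp: N_def)
      moreover have "finite N" by (simp add: N_def)
      ultimately have "(\<Prod>m\<in>{..K}. b i - b m) = (b i - b j) * ((b i - b c) * (\<Prod>m\<in>N. b i - b m))"
        by simp
      moreover have "(\<Prod>m\<in>{..K}. b i - b m) = b i * (\<Prod>n<K. b i - b (Suc n))"
        using b(1) by (simp add: prod.atMost_shift)
      ultimately have "F (b i) * ((b i - b j) * (b i - b c)) = b i * ((\<Prod>n<K. b i - b (Suc n)) / (\<Prod>n<K. b i - a n))"
        unfolding F_def by (simp add: mult_ac)
      also have "(\<Prod>n<K. b i - b (Suc n)) / (\<Prod>n<K. b i - a n) = (\<Prod>n<K. (b i - b (Suc n)) / (b i - a n))"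
        by (simp add: prod_dividef)
      finally have e: "F (b i) = (b i / ((b i - b j) * (b i - b c))) * (\<Prod>n<K. (b i - b (Suc n)) / (b i - a n))"
        using D by (simp add: field_simps)
      \<comment> \<open>Interlacing: \<open>a n < b (Suc n) < b i\<close>, so zeros and poles cancel
        up to a factor in [0,1]. What remains are the two missing zeros, which leave decay of order
        \<open>1 / b i\<close>.\<close>
      have fac: "0 \<le> (b i - b (Suc n)) / (b i - a n) \<and> (b i - b (Suc n)) / (b i - a n) \<le> 1" if "n < K" for n
        using gt[of "Suc n"] a(2)[of n] that by (simp add: divide_le_eq_1)
      have "0 \<le> (\<Prod>n<K. (b i - b (Suc n)) / (b i - a n))" "(\<Prod>n<K. (b i - b (Suc n)) / (b i - a n)) \<le> 1"
        using fac by (auto intro!: prod_nonneg prod_le_1)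
      then have Fi: "\<bar>F (b i)\<bar> \<le> b i / ((b i - b j) * (b i - b c))"
        unfolding e abs_mult using bi D by (simp only: abs_of_nonneg abs_of_pos divide_pos_pos mult_left_le order_less_imp_le)
      have "1 / F (b j) = pole_res a b K j * (b j - b c) / \<kappa>"
        using kj Fj rj \<kappa> bne[OF jc(3)] by (simp add: field_simps)
      then have "\<bar>1 / F (b j)\<bar> = \<bar>pole_res a b K j\<bar> * \<bar>b j - b c\<bar> / \<kappa>"
        using \<kappa> by (simp add: abs_mult)
      also have "\<dots> \<le> \<bar>pole_res a b K j\<bar> * \<bar>b j - b c\<bar>"
        using divide_left_mono[of 1 \<kappa> "\<bar>pole_res a b K j\<bar> * \<bar>b j - b c\<bar>"] \<kappa> by auto
      finally have "\<bar>1 / F (b j)\<bar> * \<bar>F (b i)\<bar> \<le> (\<bar>pole_res a b K j\<bar> * \<bar>b j - b c\<bar>) * (b i / ((b i - b j) * (b i - b c)))"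
        using Fi by (intro mult_mono) auto
      then show ?thesis unfolding \<alpha>F by (simp add: abs_mult)
    qed
  qed
qed

section \<open>Size of the factors that belong to smaller poles\<close>

text \<open>The quotient equals \<open>y / z\<close> times \<open>(x - z) / (x - y)\<close>. The
  first is at most 2 and, beyond \<open>3 * y\<close>, the second at most 3/2; both are at least
  1.\<close>

lemma early_factor_bounds:
  fixes x y z :: real
  assumes "0 < z" "z < y" "y \<le> 2 * z" "3 * y \<le> x"
  shows "1 \<le> (1 - x / z) / (1 - x / y)" "(1 - x / z) / (1 - x / y) \<le> 3"
proof -
  have e: "(1 - x / z) / (1 - x / y) = y * (x - z) / (z * (x - y))"
    using assms by (simp add: divide_simps) (simp add: algebra_simps)
  have d: "0 < z * (x - y)" using assms by simp
  have "0 \<le> x * (y - z)" using assms by simp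
  then have "z * (x - y) \<le> y * (x - z)" by (simp add: algebra_simps)
  then show "1 \<le> (1 - x / z) / (1 - x / y)" unfolding e using d by simp
  have "y * (x - z) \<le> 2 * z * (x - z)" using assms by (intro mult_right_mono) auto
  also have "\<dots> \<le> 3 * (z * (x - y))"
  proof -
    have "2 * (x - z) \<le> 3 * (x - y)" using assms(1,4) by (simp add: algebra_simps)
    then have "z * (2 * (x - z)) \<le> z * (3 * (x - y))" using assms by (intro mult_left_mono) auto
    then show ?thesis by (simp add: algebra_simps)
  qed
  finally show "(1 - x / z) / (1 - x / y) \<le> 3" unfolding e using d by (simp add: pos_divide_le_eq)
qed

lemma early_product_bounds:
  fixes z y :: "nat \<Rightarrow> real"
  assumes "\<And>k. k < n \<Longrightarrow> 0 < z k" "\<And>k. k < n \<Longrightarrow> z k < y k" "\<And>k. k < n \<Longrightarrow> y k \<le> 2 * z k"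
    "\<And>k. k < n \<Longrightarrow> 3 * y k \<le> x"
  shows "1 \<le> (\<Prod>k<n. (1 - x / z k) / (1 - x / y k))" "(\<Prod>k<n. (1 - x / z k) / (1 - x / y k)) \<le> 3 ^ n"
proof -
  have f: "1 \<le> (1 - x / z k) / (1 - x / y k) \<and> (1 - x / z k) / (1 - x / y k) \<le> 3" if "k < n" for k
    using early_factor_bounds[of "z k" "y k" x] assms that by simp
  show "1 \<le> (\<Prod>k<n. (1 - x / z k) / (1 - x / y k))" by (rule prod_ge_1) (use f in auto)
  have "(\<Prod>k<n. (1 - x / z k) / (1 - x / y k)) \<le> (\<Prod>k<n. 3)"
    by (intro prod_mono conjI) (use f in \<open>force+\<close>)
  then show "(\<Prod>k<n. (1 - x / z k) / (1 - x / y k)) \<le> 3 ^ n" by simp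
qed

text \<open>Serves the two factors of \<Phi> separately: zeros p_k and poles q_k give A(x)/x, zeros
  \<lambda>_k and poles t_k give U. Powers of 100 separate the pairs so well that each earlier
  factor costs at most 3 and the later ones only shrink the residue.\<close>

lemma pf_family:
  fixes z y :: "nat \<Rightarrow> real"
  assumes zy: "\<And>k. 0 < z k" "\<And>k. z k < y k" "\<And>k. y k \<le> 2 * z k"
    and z: "\<And>k. 100 ^ Suc k \<le> z k" and y: "\<And>k. y k \<le> 3 * 100 ^ Suc k" "\<And>k. 2 * 100 ^ Suc k \<le> y k"
  shows "\<exists>R. (\<forall>i. (\<lambda>l. R l / (z i - y l)) sums (- 1 / z i)) \<and> (\<forall>l. \<bar>R l\<bar> \<le> (y l / z l - 1) * 3 ^ l)"
proof -
  have grow: "(100::real) ^ Suc l * 100 \<le> 100 ^ Suc k" if "l < k" for k l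
    using power_increasing[of "Suc (Suc l)" "Suc k" "100::real"] that by (simp add: mult_ac)
  have sep: "3 * y l \<le> y k" "y l < z k" if "l < k" for k l
    using grow[OF that] y(1)[of l] y(2)[of k] z[of k] zero_less_power[of "100::real" "Suc l"] by linarith+
  have mono: "strict_mono y"
  proof (rule strict_monoI)
    fix l k :: nat assume "l < k"
    then show "y l < y k" using sep(2)[of l k] zy(2)[of k] by linarith
  qed
  have res: "\<bar>pf_res z y (Suc l) l\<bar> \<le> (y l / z l - 1) * 3 ^ l" for l
  proof -
    have "\<bar>\<Prod>k<l. (1 - y l / z k) / (1 - y l / y k)\<bar> \<le> 3 ^ l"
      using early_product_bounds[of l z y "y l"] zy sep by (simp add: abs_le_iff)
    moreover have "0 \<le> y l / z l - 1" using zy[of l] by simp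
    ultimately show ?thesis unfolding pf_res_last abs_mult by (simp add: mult_left_mono)
  qed
  have small: "y l / z (Suc l + i) \<le> 1/4 * (1/2)^i" for l i
  proof -
    have "y l / z (Suc l + i) \<le> (3 * 100 ^ Suc l) / 100 ^ Suc (Suc l + i)"
      using y(1)[of l] z[of "Suc l + i"] zy by (intro frac_le) auto
    also have "\<dots> = 3 / 100 * (1/100) ^ i" by (simp add: power_add power_divide)
    also have "\<dots> \<le> 1/4 * (1/2)^i" by (intro mult_mono power_mono) auto
    finally show ?thesis .
  qed
  have "\<exists>R. (\<lambda>K. pf_res z y K l) \<longlonglongrightarrow> R \<and> (\<forall>K>l. \<bar>pf_res z y K l\<bar> \<le> (y l / z l - 1) * 3 ^ l)" for l
  proof -
    obtain R where R: "(\<lambda>K. pf_res z y K l) \<longlonglongrightarrow> R"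
      "\<And>K. Suc l \<le> K \<Longrightarrow> \<bar>pf_res z y K l\<bar> \<le> \<bar>pf_res z y (Suc l) l\<bar>"
      by (rule pf_res_limit[of z y l "Suc l"]) (use zy small in \<open>auto simp: less_imp_le\<close>)
    then show ?thesis using order_trans[OF R(2) res[of l]] by (auto simp: Suc_le_eq)
  qed
  then obtain R where R: "\<And>l. (\<lambda>K. pf_res z y K l) \<longlonglongrightarrow> R l" 
    "\<And>K l. l < K \<Longrightarrow> \<bar>pf_res z y K l\<bar> \<le> (y l / z l - 1) * 3 ^ l" by metis
  have ypos: "0 < y l" for l using zy[of l] by linarith
  have y100: "100 ^ k \<le> y k" for k
  proof -
    have "0 < (100::real) ^ k" by simp
    then show ?thesis using y(2)[of k] unfolding power_Suc by linarith
  qed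
  have ytop: "filterlim y at_top sequentially"
  proof (rule filterlim_at_top_mono[OF filterlim_real_sequentially], intro always_eventually allI)
    fix k
    have "real k \<le> 100 ^ k" using of_nat_less_two_power[of k, where 'a=real] power_mono[of 2 "100::real" k] by linarith
    also have "\<dots> \<le> y k" by (rule y100)
    finally show "real k \<le> y k" .
  qed
  have zy': "z k \<noteq> y l" for k l
  proof (cases "l < k")
    case False
    then have "y k \<le> y l" using mono by (simp add: strict_mono_less_eq)
    then show ?thesis using zy(2)[of k] by linarith
  next
    case True
    then show ?thesis using sep(2)[of l k] by simp
  qed
  have sum: "summable (\<lambda>l. (y l / z l - 1) * 3 ^ l / y l)"
  proof (rule summable_comparison_test)
    show "summable (\<lambda>l. (3/100) ^ l :: real)" by (rule summable_geometric) simp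
    have "norm ((y l / z l - 1) * 3 ^ l / y l) \<le> (3/100) ^ l" for l
    proof -
      have "(y l / z l - 1) \<le> 1" "0 \<le> (y l / z l - 1)" using zy[of l] by (simp_all add: pos_divide_le_eq)
      moreover have "3 ^ l / y l \<le> 3 ^ l / 100 ^ l"
        using y100[of l] by (intro frac_le) auto
      moreover have "0 \<le> 3 ^ l / y l" using ypos[of l] by simp
      ultimately have "(y l / z l - 1) * (3 ^ l / y l) \<le> 1 * (3 ^ l / 100 ^ l)"
        "0 \<le> (y l / z l - 1) * (3 ^ l / y l)"
        by (simp_all only: mult_mono zero_le_one mult_nonneg_nonneg)
      then show ?thesis unfolding power_divide real_norm_def times_divide_eq_right mult_1 by simp
    qed
    then show "\<exists>N. \<forall>n\<ge>N. norm ((y n / z n - 1) * 3 ^ n / y n) \<le> (3/100) ^ n" by blast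
  qed
  have inj: "inj y" using mono by (rule strict_mono_imp_inj_on)
  show ?thesis
  proof (intro exI[of _ R] conjI allI)
    show "(\<lambda>l. R l / (z i - y l)) sums (- 1 / z i)" for i
      by (rule pf_limit_zero(1)[OF inj ypos ytop zy(1) zy' sum R(2) R(1)])
    show "\<bar>R l\<bar> \<le> (y l / z l - 1) * 3 ^ l" for l
      by (rule pf_limit_zero(2)[OF inj ypos ytop zy(1) zy' sum R(2) R(1)])
  qed
qed

section \<open>The concrete poles and frequencies\<close>

text \<open>Index \<open>2 * k + 1\<close> holds q_k, index \<open>2 * k + 2\<close> its right
  neighbour t_k.\<close>

definition pole :: "nat \<Rightarrow> int" where
  "pole n = (if n = 0 then 0 else 2 * 100 ^ (Suc n div 2) + (if even n then 1 else 0))"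

text \<open>Even indices hold \<lambda>_k, which is exactly half of t_k and makes the leading factor
  of the residue of U equal to 1. Odd indices hold p_k: its distance \<open>5 ^ Suc k / 2\<close> to
  q_k is small against the pole but large against the distance 1 from q_k to t_k.\<close>

definition node :: "nat \<Rightarrow> real" where
  "node n = (if even n then 100 ^ Suc (n div 2) + 1/2 else 2 * 100 ^ Suc (n div 2) - 5 ^ Suc (n div 2) / 2)"

lemma pole_simps [simp]:
  "pole 0 = 0" "pole (Suc (2 * k)) = 2 * 100 ^ Suc k" "pole (Suc (Suc (2 * k))) = 2 * 100 ^ Suc k + 1"
  by (simp_all add: pole_def)

lemma node_simps [simp]:
  "node (2 * k) = 100 ^ Suc k + 1/2" "node (Suc (2 * k)) = 2 * 100 ^ Suc k - 5 ^ Suc k / 2"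
  by (simp_all add: node_def)

lemma five_power_le: "(5::real) ^ Suc k \<le> 100 ^ Suc k / 20"
proof -
  have "(5::real) ^ k \<le> 100 ^ k" by (intro power_mono) auto
  then show ?thesis by simp
qed

lemma five_power_ge: "5 \<le> (5::real) ^ Suc k"
  using power_increasing[of 1 "Suc k" "5::real"] by simp

lemma even_odd_cases:
  fixes l :: nat
  obtains k where "l = 2 * k" | k where "l = Suc (2 * k)"
  by (metis oddE evenE Suc_eq_plus1)

lemma pole_Suc_bounds:
  "2 * 100 ^ Suc (l div 2) \<le> real_of_int (pole (Suc l))" "real_of_int (pole (Suc l)) \<le> 2 * 100 ^ Suc (l div 2) + 1"
  by (cases l rule: even_odd_cases; simp)+

lemma node_bounds: "100 ^ Suc (l div 2) \<le> node l" "node l < 2 * 100 ^ Suc (l div 2)"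
proof -
  have p: "1 \<le> (100::real) ^ k" for k by simp
  show "100 ^ Suc (l div 2) \<le> node l"
  proof (cases l rule: even_odd_cases)
    case (2 k)
    have "100 ^ Suc k \<le> 2 * 100 ^ Suc k - (5::real) ^ Suc k / 2"
      using five_power_le[of k] p[of "Suc k"] by linarith
    then show ?thesis unfolding 2 node_simps by simp
  qed simp
  show "node l < 2 * 100 ^ Suc (l div 2)"
  proof (cases l rule: even_odd_cases)
    case (1 k)
    have "(100::real) ^ Suc k + 1/2 < 2 * 100 ^ Suc k" using p[of "Suc k"] by linarith
    then show ?thesis unfolding 1 node_simps by simp
  next
    case (2 k)
    then show ?thesis by simp
  qed
qed

lemma node_less_pole: "node l < real_of_int (pole (Suc l))"
  using node_bounds(2)[of l] pole_Suc_bounds(1)[of l] by linarith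

lemma pole_le_node: "real_of_int (pole (Suc l)) \<le> 2 * node l"
proof (cases l rule: even_odd_cases)
  case (2 k)
  have "1 \<le> (100::real) ^ Suc k" by (rule one_le_power) simp
  then show ?thesis using five_power_le[of k] unfolding 2 node_simps pole_simps
    by (simp only: of_int_add of_int_mult of_int_power of_int_numeral of_int_1) argo
qed simp

lemma node_pos: "0 < node l"
  using node_bounds(1)[of l] zero_less_power[of "100::real" "Suc (l div 2)"] by linarith

lemma pole_strict_mono: "strict_mono pole"
proof (rule strict_mono_Suc_iff[THEN iffD2], rule allI)
  fix n
  show "pole n < pole (Suc n)"
  proof (cases n)
    case (Suc l)
    show ?thesis
    proof (cases l rule: even_odd_cases)
      case (2 k)
      have "(0::int) < 100 ^ k" by simp
      moreover have "pole (Suc n) = 20000 * 100 ^ k" "pole n = 200 * 100 ^ k + 1"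
        using 2 Suc pole_simps(2)[of "Suc k"] by simp_all
      ultimately show ?thesis by linarith
    qed (use Suc in simp)
  qed (simp add: pole_def)
qed

text \<open>Twice a node is an odd integer; for odd indices this rests on the gap being half a power
  of an odd number.\<close>

lemma node_not_Ints: "node n \<notin> \<int>"
proof
  assume "node n \<in> \<int>"
  then obtain m where m: "node n = of_int m" by (auto elim: Ints_cases)
  show False
  proof (cases n rule: even_odd_cases)
    case (1 k)
    then have "of_int (2 * 100 ^ Suc k + 1) = (of_int (2 * m) :: real)" using m by simp
    then have "2 * 100 ^ Suc k + 1 = 2 * m" by (simp only: of_int_eq_iff)
    then show False by presburger
  next
    case (2 k)
    then have "of_int (2 * (2 * 100 ^ Suc k - m)) = (of_int (5 ^ Suc k) :: real)" using m by simp
    then have "2 * (2 * 100 ^ Suc k - m) = 5 ^ Suc k" by (simp only: of_int_eq_iff)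
    moreover have "odd ((5::int) ^ Suc k)" by simp
    ultimately show False by (metis dvd_triv_left)
  qed
qed

lemma node_strict_mono: "strict_mono node"
proof (rule strict_mono_Suc_iff[THEN iffD2], rule allI)
  fix n
  have p: "1 \<le> (100::real) ^ k" for k by simp
  show "node n < node (Suc n)"
  proof (cases n rule: even_odd_cases)
    case (1 k)
    show ?thesis using five_power_le[of k] five_power_ge[of k] unfolding 1 node_simps by argo
  next
    case (2 k)
    then have "node (Suc n) = 100 ^ Suc (Suc k) + 1/2" using node_simps(1)[of "Suc k"] by simp
    moreover have "node n = 2 * 100 ^ Suc k - 5 ^ Suc k / 2" using 2 by simp
    ultimately show ?thesis using five_power_ge[of k] p[of "Suc k"] unfolding power_Suc[of "100::real" "Suc k"] by linarith
  qed
qed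

text \<open>The adjacency of the two poles of a block makes the residues grow like \<open>5 ^ k\<close>.\<close>

lemma block_residue_bounds:
  fixes k :: nat
  defines "N \<equiv> 2 * k + 2" and "y \<equiv> \<lambda>l. real_of_int (pole (Suc l))"
  assumes l: "l = 2 * k \<or> l = Suc (2 * k)"
  shows "5 ^ Suc k / 4 \<le> \<bar>pf_res node y N l\<bar>" "\<bar>pf_res node y N l\<bar> \<le> 2 * 5 ^ Suc k * 9 ^ k"
    and "l < K \<Longrightarrow> K < N \<Longrightarrow> \<bar>pf_res node y K l\<bar> \<le> 2 * 5 ^ Suc k * 9 ^ k"
proof -
  define X where "X = (100::real) ^ Suc k"
  define v where "v = (5::real) ^ Suc k"
  have X: "100 \<le> X" unfolding X_def using power_increasing[of 1 "Suc k" "100::real"] by simp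
  have v: "5 \<le> v" "v \<le> X / 20" using five_power_ge[of k] five_power_le[of k] by (auto simp: X_def v_def)
  have nd: "node (2 * k) = X + 1/2" "node (Suc (2 * k)) = 2 * X - v / 2" by (simp_all add: X_def v_def)
  have yy: "y (2 * k) = 2 * X" "y (Suc (2 * k)) = 2 * X + 1" by (simp_all add: y_def X_def)
  have early: "3 * y j \<le> 2 * X" if "j < 2 * k" for j
  proof -
    have "j div 2 < k" using that by simp
    then have "(100::real) ^ Suc (j div 2) * 100 \<le> 100 ^ Suc k"
      using power_increasing[of "Suc (Suc (j div 2))" "Suc k" "100::real"] by (simp add: mult_ac)
    then have "(100::real) ^ Suc (j div 2) * 100 \<le> X" by (simp add: X_def)
    then show ?thesis using pole_Suc_bounds(2)[of j] X unfolding y_def by linarith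
  qed
  \<comment> \<open>The factors of the earlier blocks, two per block: each block contributes at most
    \<open>3 * 3 = 9\<close>.\<close>
  define P where "P x = (\<Prod>j<2 * k. (1 - x / node j) / (1 - x / y j))" for x
  have P: "1 \<le> P x \<and> P x \<le> 9 ^ k" if "2 * X \<le> x" for x
  proof -
    have "3 * y j \<le> x" if "j < 2 * k" for j using early[OF that] \<open>2 * X \<le> x\<close> by linarith
    then have "1 \<le> P x" "P x \<le> 3 ^ (2 * k)" unfolding P_def
      using early_product_bounds[of "2 * k" node y x] node_pos node_less_pole pole_le_node
      unfolding y_def by blast+
    moreover have "(3::real) ^ (2 * k) = 9 ^ k" by (simp add: power_mult)
    ultimately show ?thesis by simp
  qed
  have vabs: "v / 4 \<le> \<bar>A * B\<bar>" "\<bar>A * B\<bar> \<le> 2 * v * 9 ^ k"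
    if "v / 4 \<le> \<bar>A\<bar>" "\<bar>A\<bar> \<le> 2 * v" "1 \<le> B \<and> B \<le> 9 ^ k" for A B :: real
  proof -
    have "\<bar>A\<bar> * 1 \<le> \<bar>A\<bar> * \<bar>B\<bar>" using that by (intro mult_left_mono) auto
    then show "v / 4 \<le> \<bar>A * B\<bar>" using that by (simp add: abs_mult)
    show "\<bar>A * B\<bar> \<le> 2 * v * 9 ^ k" unfolding abs_mult using that v by (intro mult_mono) auto
  qed
  have case1: "pf_res node y (Suc (2 * k)) (2 * k) = ((X - 1/2) / (X + 1/2)) * P (2 * X)"
    unfolding pf_res_last P_def yy(1) nd(1) using X by (simp add: field_simps)
  have c0: "1/2 \<le> (X - 1/2) / (X + 1/2)" "(X - 1/2) / (X + 1/2) \<le> 1" using X by (auto simp: field_simps)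
  \<comment> \<open>The zero at distance \<open>v / 2\<close> and the pole at distance 1 from
    \<open>2 * X\<close> together leave a factor of about \<open>v / 2\<close>: this is the source
    of the growth.\<close>
  have g1: "(1 - 2 * X / (2 * X - v / 2)) / (1 - 2 * X / (2 * X + 1)) = - (v / 2 * ((2 * X + 1) / (2 * X - v / 2)))"
  proof -
    have "1 - 2 * X / (2 * X - v / 2) = - (v / 2) / (2 * X - v / 2)" "1 - 2 * X / (2 * X + 1) = 1 / (2 * X + 1)"
      using v X by (simp_all add: field_simps)
    then show ?thesis by simp
  qed
  have tp: "1 \<le> (2 * X + 1) / (2 * X - v / 2)" "(2 * X + 1) / (2 * X - v / 2) \<le> 2"
    using v X by (auto simp: pos_le_divide_eq pos_divide_le_eq)
  have A1: "pf_res node y N (2 * k) = ((X - 1/2) / (X + 1/2)) * (- (v / 2 * ((2 * X + 1) / (2 * X - v / 2)))) * P (2 * X)"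
    using pf_res_Suc[of "2 * k" "Suc (2 * k)" node y] unfolding case1 yy nd g1 N_def by simp
  have A1b: "v / 4 \<le> \<bar>((X - 1/2) / (X + 1/2)) * (- (v / 2 * ((2 * X + 1) / (2 * X - v / 2))))\<bar>"
            "\<bar>((X - 1/2) / (X + 1/2)) * (- (v / 2 * ((2 * X + 1) / (2 * X - v / 2))))\<bar> \<le> 2 * v"
  proof -
    have e: "\<bar>((X - 1/2) / (X + 1/2)) * (- (v / 2 * ((2 * X + 1) / (2 * X - v / 2))))\<bar>
        = ((X - 1/2) / (X + 1/2)) * (v / 2 * ((2 * X + 1) / (2 * X - v / 2)))"
    proof -
      have "0 \<le> (X - 1/2) / (X + 1/2)" "0 \<le> v / 2" "0 \<le> (2 * X + 1) / (2 * X - v / 2)"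
        using c0(1) tp(1) v(1) by linarith+
      then show ?thesis unfolding abs_mult abs_minus_cancel by (simp only: abs_of_nonneg)
    qed
    have "1/2 * (v / 2 * 1) \<le> ((X - 1/2) / (X + 1/2)) * (v / 2 * ((2 * X + 1) / (2 * X - v / 2)))"
      using c0(1) tp(1) v(1) by (intro mult_mono) linarith+
    moreover have "((X - 1/2) / (X + 1/2)) * (v / 2 * ((2 * X + 1) / (2 * X - v / 2))) \<le> 1 * (v / 2 * 2)"
      using c0 tp v(1) by (intro mult_mono mult_nonneg_nonneg) linarith+
    ultimately show "v / 4 \<le> \<bar>((X - 1/2) / (X + 1/2)) * (- (v / 2 * ((2 * X + 1) / (2 * X - v / 2))))\<bar>"
            "\<bar>((X - 1/2) / (X + 1/2)) * (- (v / 2 * ((2 * X + 1) / (2 * X - v / 2))))\<bar> \<le> 2 * v"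
      unfolding e using v(1) by linarith+
  qed
  \<comment> \<open>At the upper pole the even node is exactly half of the argument, so the first
    pair of the block gives \<open>2 * X\<close>; the second pair gives \<open>1 + v / 2\<close>
    over the node.\<close>
  have A2: "pf_res node y N (Suc (2 * k)) = ((1 + v / 2) * (2 * X / (2 * X - v / 2))) * P (2 * X + 1)"
  proof -
    have e1: "(1 - (2 * X + 1) / (X + 1/2)) / (1 - (2 * X + 1) / (2 * X)) = 2 * X"
    proof -
      have "1 - (2 * X + 1) / (X + 1/2) = - 1" "1 - (2 * X + 1) / (2 * X) = - (1 / (2 * X))"
        using X by (simp_all add: field_simps)
      then show ?thesis using X by simp
    qed
    have e2: "(2 * X + 1) / (2 * X - v / 2) - 1 = (1 + v / 2) / (2 * X - v / 2)"
      using v X by (simp add: field_simps)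
    show ?thesis using pf_res_last[of node y "Suc (2 * k)"]
      unfolding yy nd N_def P_def prod.lessThan_Suc e1 e2 by (simp add: yy nd e1)
  qed
  have A2b: "v / 4 \<le> \<bar>(1 + v / 2) * (2 * X / (2 * X - v / 2))\<bar>" "\<bar>(1 + v / 2) * (2 * X / (2 * X - v / 2))\<bar> \<le> 2 * v"
  proof -
    have t: "1 \<le> 2 * X / (2 * X - v / 2)" "2 * X / (2 * X - v / 2) \<le> 2"
      using v X by (auto simp: pos_le_divide_eq pos_divide_le_eq)
    have e: "\<bar>(1 + v / 2) * (2 * X / (2 * X - v / 2))\<bar> = (1 + v / 2) * (2 * X / (2 * X - v / 2))"
      unfolding abs_mult using t(1) v(1) by (simp only: abs_of_nonneg)
    have "(1 + v / 2) * 1 \<le> (1 + v / 2) * (2 * X / (2 * X - v / 2))" "(1 + v / 2) * (2 * X / (2 * X - v / 2)) \<le> (1 + v / 2) * 2"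
      using t v(1) by (intro mult_left_mono; simp)+
    then show "v / 4 \<le> \<bar>(1 + v / 2) * (2 * X / (2 * X - v / 2))\<bar>" "\<bar>(1 + v / 2) * (2 * X / (2 * X - v / 2))\<bar> \<le> 2 * v"
      unfolding e using v(1) by argo+
  qed
  have "v / 4 \<le> \<bar>pf_res node y N l\<bar> \<and> \<bar>pf_res node y N l\<bar> \<le> 2 * v * 9 ^ k"
    using l vabs[OF A1b P] vabs[OF A2b P] A1 A2 by auto
  then show "5 ^ Suc k / 4 \<le> \<bar>pf_res node y N l\<bar>" "\<bar>pf_res node y N l\<bar> \<le> 2 * 5 ^ Suc k * 9 ^ k"
    unfolding v_def by auto
  assume "l < K" "K < N"
  \<comment> \<open>The only truncation that contains the pole but not the whole block ends between
    the two neighbours; its residue still lacks the factor \<open>v\<close>.\<close>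
  then have lK: "l = 2 * k" "K = Suc (2 * k)" using l by (auto simp: N_def)
  have "\<bar>pf_res node y K l\<bar> \<le> 1 * 9 ^ k"
    unfolding lK case1 abs_mult using c0 P[of "2 * X"] by (intro mult_mono) linarith+
  also have "\<dots> \<le> 2 * v * 9 ^ k" using v(1) by (intro mult_right_mono) auto
  finally show "\<bar>pf_res node y K l\<bar> \<le> 2 * 5 ^ Suc k * 9 ^ k" by (simp add: v_def)
qed

lemma pole_at_top: "filterlim (\<lambda>l. real_of_int (pole (Suc l))) at_top sequentially"
proof (rule filterlim_at_top_mono[OF filterlim_real_sequentially], intro always_eventually allI)
  fix l
  have "int l \<le> pole l"
  proof (induction l)
    case (Suc l)
    then show ?case using strict_monoD[OF pole_strict_mono, of l "Suc l"] by simp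
  qed simp
  also have "pole l \<le> pole (Suc l)" using strict_monoD[OF pole_strict_mono, of l "Suc l"] by simp
  finally show "real l \<le> real_of_int (pole (Suc l))" by simp
qed

text \<open>Turns decay per block into decay per index: \<open>49/100 = (7/10)^2\<close>, and the
  factor 10/7 pays for the odd indices.\<close>

lemma summable_half_index:
  fixes q :: real
  assumes "0 \<le> q" "q \<le> 49/100"
  shows "summable (\<lambda>l. q ^ (l div 2))"
proof (rule summable_comparison_test)
  show "summable (\<lambda>l. 10/7 * (7/10::real) ^ l)" by (intro summable_mult summable_geometric) simp
  have "norm (q ^ (l div 2)) \<le> 10/7 * (7/10) ^ l" for l
  proof -
    have "q ^ (l div 2) \<le> (49/100) ^ (l div 2)" using assms by (intro power_mono) auto
    also have "\<dots> = (7/10) ^ (2 * (l div 2))" by (simp add: power_mult power2_eq_square)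
    also have "\<dots> \<le> 10/7 * (7/10) ^ l" by (cases l rule: even_odd_cases) simp_all
    finally show ?thesis using assms by simp
  qed
  then show "\<exists>N. \<forall>n\<ge>N. norm (q ^ (n div 2)) \<le> 10/7 * (7/10) ^ n" by blast
qed

lemma residue_bound_summable:
  "summable (\<lambda>l. 2 * 5 ^ Suc (l div 2) * 9 ^ (l div 2) / real_of_int (pole (Suc l)))"
proof (rule summable_comparison_test)
  show "summable (\<lambda>l. (45/100::real) ^ (l div 2))" by (rule summable_half_index) auto
  have "norm (2 * 5 ^ Suc (l div 2) * 9 ^ (l div 2) / real_of_int (pole (Suc l))) \<le> (45/100) ^ (l div 2)" for l
  proof -
    define m where "m = l div 2"
    have pos: "0 < real_of_int (pole (Suc l))" using node_pos[of l] node_less_pole[of l] by linarith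
    have "2 * 5 ^ Suc m * 9 ^ m / real_of_int (pole (Suc l)) \<le> 2 * 5 ^ Suc m * 9 ^ m / (2 * 100 ^ Suc m)"
      using pole_Suc_bounds(1)[of l] by (intro divide_left_mono mult_pos_pos pos) (auto simp: m_def)
    also have "\<dots> = 5 / 100 * (45/100) ^ m"
    proof -
      have "(45::real) ^ m = 5 ^ m * 9 ^ m" "(100::real) ^ m = 5 ^ m * 20 ^ m" by (simp_all flip: power_mult_distrib)
      then show ?thesis by (simp add: power_divide)
    qed
    also have "\<dots> \<le> (45/100) ^ m" by simp
    finally show ?thesis using pos by (simp add: m_def)
  qed
  then show "\<exists>N. \<forall>n\<ge>N. norm (2 * 5 ^ Suc (n div 2) * 9 ^ (n div 2) / real_of_int (pole (Suc n))) \<le> (45/100) ^ (n div 2)"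
    by blast
qed

lemma cauchy_system_residues:
  obtains r :: "nat \<Rightarrow> real" where
    "r 0 = 1" "\<And>n. (\<lambda>K. pole_res node (\<lambda>i. of_int (pole i)) K n) \<longlonglongrightarrow> r n"
    "\<And>l. 5 ^ Suc (l div 2) / 8 \<le> \<bar>r (Suc l)\<bar>"
    "\<And>K l. l < K \<Longrightarrow> \<bar>pole_res node (\<lambda>i. of_int (pole i)) K (Suc l)\<bar> \<le> 2 * 5 ^ Suc (l div 2) * 9 ^ (l div 2)"
    "\<And>l. \<bar>r (Suc l)\<bar> \<le> 2 * 5 ^ Suc (l div 2) * 9 ^ (l div 2)"
    "\<And>n. (\<lambda>i. r i / (node n - of_int (pole i))) sums 0"
proof -
  define y where "y = (\<lambda>l. real_of_int (pole (Suc l)))"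
  define M where "M l = (2 * 5 ^ Suc (l div 2) * 9 ^ (l div 2) :: real)" for l :: nat
  have "\<exists>R. (\<lambda>K. pf_res node y K l) \<longlonglongrightarrow> R \<and> 5 ^ Suc (l div 2) / 8 \<le> \<bar>R\<bar> \<and> (\<forall>K>l. \<bar>pf_res node y K l\<bar> \<le> M l)" for l
  proof -
    define k where "k = l div 2"
    have l: "l = 2 * k \<or> l = Suc (2 * k)" unfolding k_def by linarith
    have small: "y l / node (2 * k + 2 + i) \<le> 1/4 * (1/2)^i" for i
    proof -
      have "(1::real) \<le> 100 ^ Suc k" by (rule one_le_power) simp
      then have yl: "y l \<le> 3 * 100 ^ Suc k" using pole_Suc_bounds(2)[of l] unfolding y_def k_def by linarith
      have "(2 * k + 2 + i) div 2 = Suc k + i div 2" by simp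
      then have nd: "100 ^ Suc (Suc k + i div 2) \<le> node (2 * k + 2 + i)" using node_bounds(1) by metis
      have "y l / node (2 * k + 2 + i) \<le> (3 * 100 ^ Suc k) / 100 ^ Suc (Suc k + i div 2)"
        using yl nd by (intro frac_le) auto
      also have "\<dots> = 3 / 100 * (1 / 100) ^ (i div 2)" by (simp add: power_add power_divide)
      \<comment> \<open>Two consecutive nodes share a power of 100, so the decay is only in
        \<open>i div 2\<close>; weakening 1/100 to \<open>1/4 = (1/2)^2\<close> brings back decay in
        \<open>i\<close>.\<close>
      also have "\<dots> \<le> 3 / 100 * (1 / 4) ^ (i div 2)" by (intro mult_left_mono power_mono) auto
      also have "(1 / 4 :: real) ^ (i div 2) = (1/2) ^ (2 * (i div 2))" by (simp add: power_mult power2_eq_square)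
      also have "3 / 100 * (1/2) ^ (2 * (i div 2)) \<le> 3 / 100 * (2 * (1/2::real) ^ i)"
        by (cases i rule: even_odd_cases) simp_all
      also have "\<dots> \<le> 1/4 * (1/2)^i" by simp
      finally show ?thesis .
    qed
    obtain R where R: "(\<lambda>K. pf_res node y K l) \<longlonglongrightarrow> R" "\<bar>pf_res node y (2 * k + 2) l\<bar> / 2 \<le> \<bar>R\<bar>"
       "\<And>K. 2 * k + 2 \<le> K \<Longrightarrow> \<bar>pf_res node y K l\<bar> \<le> \<bar>pf_res node y (2 * k + 2) l\<bar>"
      by (rule pf_res_limit[of node y l "2 * k + 2"])
        (use node_pos node_less_pole small l in \<open>auto simp: y_def less_imp_le\<close>)
    have b: "5 ^ Suc k / 4 \<le> \<bar>pf_res node y (2 * k + 2) l\<bar>" "\<bar>pf_res node y (2 * k + 2) l\<bar> \<le> 2 * 5 ^ Suc k * 9 ^ k"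
      "\<And>K. l < K \<Longrightarrow> K < 2 * k + 2 \<Longrightarrow> \<bar>pf_res node y K l\<bar> \<le> 2 * 5 ^ Suc k * 9 ^ k"
      using block_residue_bounds[OF l] unfolding y_def by blast+
    have "\<bar>pf_res node y K l\<bar> \<le> M l" if "l < K" for K
      using R(3)[of K] b(2,3) that unfolding M_def k_def[symmetric] by (meson linorder_not_le order_trans)
    moreover have "5 ^ Suc k / 8 \<le> \<bar>R\<bar>" using R(2) b(1) by linarith
    ultimately show ?thesis using R(1) unfolding k_def by blast
  qed
  then obtain R where R: "\<And>l. (\<lambda>K. pf_res node y K l) \<longlonglongrightarrow> R l" "\<And>l. 5 ^ Suc (l div 2) / 8 \<le> \<bar>R l\<bar>"
    "\<And>K l. l < K \<Longrightarrow> \<bar>pf_res node y K l\<bar> \<le> M l" by metis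
  have ypos: "0 < y l" for l using node_pos[of l] node_less_pole[of l] unfolding y_def by linarith
  have yinj: "inj y" using strict_mono_imp_inj_on[OF pole_strict_mono, of UNIV] unfolding y_def inj_def by auto
  have ne: "node k \<noteq> y l" for k l using node_not_Ints[of k] unfolding y_def by (metis Ints_of_int)
  have sM: "summable (\<lambda>l. M l / y l)" using residue_bound_summable by (simp only: M_def y_def)
  note lim = pf_limit_zero[OF yinj ypos pole_at_top[folded y_def] node_pos ne sM R(3) R(1)]
  define r where "r i = (case i of 0 \<Rightarrow> 1 | Suc l \<Rightarrow> R l)" for i
  show thesis
  proof (rule that[of r])
    show "r 0 = 1" by (simp add: r_def)
    show "(\<lambda>K. pole_res node (\<lambda>i. of_int (pole i)) K n) \<longlonglongrightarrow> r n" for n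
      using R(1) by (cases n) (simp_all add: pole_res_def r_def y_def)
    show "5 ^ Suc (l div 2) / 8 \<le> \<bar>r (Suc l)\<bar>" for l using R(2) by (simp add: r_def)
    show "\<bar>pole_res node (\<lambda>i. of_int (pole i)) K (Suc l)\<bar> \<le> 2 * 5 ^ Suc (l div 2) * 9 ^ (l div 2)" if "l < K" for K l
      using R(3)[OF that] by (simp add: pole_res_def y_def M_def)
    show "\<bar>r (Suc l)\<bar> \<le> 2 * 5 ^ Suc (l div 2) * 9 ^ (l div 2)" for l
      using lim(2)[of l] by (simp add: r_def M_def)
    show "(\<lambda>i. r i / (node n - of_int (pole i))) sums 0" for n
    proof -
      have "(\<lambda>l. r (Suc l) / (node n - of_int (pole (Suc l)))) sums (- 1 / node n)"
        using lim(1)[of n] by (simp add: r_def y_def)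
      from sums_Suc[OF this] show ?thesis by (simp add: r_def)
    qed
  qed
qed

lemma node_diff_pole_neq: "node n - of_int (pole i) \<noteq> 0"
  using node_not_Ints[of n] by (metis Ints_of_int eq_iff_diff_eq_0)

section \<open>The interface between the frequencies and the function space\<close>

text \<open>The weight \<open>1 + \<bar>r i\<bar>\<close> in \<open>approx\<close> serves both
  systems at once: with F the rational function given by the sums, combinations of exponentials have
  coefficients F(b_i) at the poles, combinations of biorthogonal functions have \<open>r i\<close>
  times F(b_i). Parity of \<open>n\<close> encodes the partition: even indices are zeros of U, odd
  ones zeros of A.\<close>

locale cauchy_system =
  fixes a :: "nat \<Rightarrow> real" and b :: "nat \<Rightarrow> int" and r f g :: "nat \<Rightarrow> real"
  assumes b_0: "b 0 = 0" and b_inj: "inj b" and a_nonint: "\<And>n. a n \<notin> \<int>" and a_inj: "inj a"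
    and r_nonzero: "\<And>i. r i \<noteq> 0" and r_unbounded: "\<And>C. \<exists>N. \<forall>c\<ge>N. C < \<bar>r c\<bar>"
    and r_summable: "\<And>x. summable (\<lambda>i. \<bar>r i\<bar> / \<bar>x - of_int (b i)\<bar>)"
    and r_sums: "\<And>n. (\<lambda>i. r i / (a n - of_int (b i))) sums 0"
    and approx: "\<And>j c \<epsilon>. j \<noteq> c \<Longrightarrow> 0 < \<epsilon> \<Longrightarrow> \<exists>K \<alpha>. (\<Sum>n<K. \<alpha> n / (a n - of_int (b j))) = 1 \<and>
       \<bar>(\<Sum>n<K. \<alpha> n / (a n - of_int (b c))) + r j / r c\<bar> < \<epsilon> \<and>
       summable (\<lambda>i. if i = j \<or> i = c then 0 else \<bar>\<Sum>n<K. \<alpha> n / (a n - of_int (b i))\<bar> * (1 + \<bar>r i\<bar>)) \<and>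
       (\<Sum>i. if i = j \<or> i = c then 0 else \<bar>\<Sum>n<K. \<alpha> n / (a n - of_int (b i))\<bar> * (1 + \<bar>r i\<bar>)) < \<epsilon>"
    and f_summable: "summable (\<lambda>i. \<bar>f i\<bar>)" and g_summable: "summable (\<lambda>i. \<bar>g i\<bar>)"
    and f_0: "f 0 = 1" and g_0: "g 0 = 1" and fg: "\<And>i. f (Suc i) * g (Suc i) = 0"
    and f_sums: "\<And>n. even n \<Longrightarrow> (\<lambda>i. f i * r i / (a n - of_int (b i))) sums 0"
    and g_sums: "\<And>n. odd n \<Longrightarrow> (\<lambda>i. g i / (a n - of_int (b i))) sums 0"

lemma cauchy_system_exists: "\<exists>r f g. cauchy_system node pole r f g"
proof -
  define b where "b i = real_of_int (pole i)" for i
  define M where "M l = (2 * 5 ^ Suc (l div 2) * 9 ^ (l div 2) :: real)" for l :: nat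
  obtain r where r: "r 0 = 1" "\<And>n. (\<lambda>K. pole_res node b K n) \<longlonglongrightarrow> r n"
    "\<And>l. 5 ^ Suc (l div 2) / 8 \<le> \<bar>r (Suc l)\<bar>"
    "\<And>K l. l < K \<Longrightarrow> \<bar>pole_res node b K (Suc l)\<bar> \<le> M l"
    "\<And>l. \<bar>r (Suc l)\<bar> \<le> M l"
    "\<And>n. (\<lambda>i. r i / (node n - b i)) sums 0"
    using cauchy_system_residues unfolding b_def M_def by blast
  have b0: "b 0 = 0" by (simp add: b_def)
  have bmono: "strict_mono b" using pole_strict_mono by (simp add: b_def strict_mono_def)
  have bpos: "0 < b (Suc l)" for l using strict_monoD[OF bmono, of 0 "Suc l"] b0 by simp
  have btop: "filterlim (\<lambda>l. b (Suc l)) at_top sequentially" using pole_at_top by (simp add: b_def)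
  have M1: "1 \<le> M l" for l
  proof -
    have "1 * 1 \<le> (5::real) ^ Suc (l div 2) * 9 ^ (l div 2)" by (intro mult_mono one_le_power) auto
    then show ?thesis unfolding M_def by linarith
  qed
  have sM: "summable (\<lambda>l. M l / b (Suc l))" using residue_bound_summable by (simp only: M_def b_def)
  have rne: "r i \<noteq> 0" for i
  proof (cases i)
    case (Suc l)
    have "0 < (5::real) ^ Suc (l div 2) / 8" by simp
    then have "0 < \<bar>r i\<bar>" using r(3)[of l] unfolding Suc by linarith
    then show ?thesis by simp
  qed (simp add: r(1))
  have rsum: "summable (\<lambda>i. \<bar>r i\<bar> / \<bar>x - b i\<bar>)" for x
  proof -
    have "summable (\<lambda>l. \<bar>r (Suc l)\<bar> / b (Suc l))"
    proof (rule summable_comparison_test[OF _ sM], intro exI allI impI)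
      fix l show "norm (\<bar>r (Suc l)\<bar> / b (Suc l)) \<le> M l / b (Suc l)"
        using r(5)[of l] bpos[of l] by (simp add: divide_right_mono)
    qed
    then have "summable (\<lambda>l. \<bar>r (Suc l)\<bar> / \<bar>x - b (Suc l)\<bar>)"
      by (rule summable_residue_bound) (use bpos btop in auto)
    then show ?thesis by (simp only: summable_Suc_iff[of "\<lambda>i. \<bar>r i\<bar> / \<bar>x - b i\<bar>"])
  qed
  have rbig: "\<exists>N. \<forall>c\<ge>N. C < \<bar>r c\<bar>" for C
  proof -
    obtain k where k: "8 * \<bar>C\<bar> < 5 ^ k" using real_arch_pow[of 5] by auto
    have "C < \<bar>r c\<bar>" if c: "c \<ge> Suc (2 * k)" for c
    proof -
      obtain l where l: "c = Suc l" "2 * k \<le> l" using c by (cases c) auto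
      have "(5::real) ^ k \<le> 5 ^ Suc (l div 2)" using l by (intro power_increasing) auto
      then show ?thesis using r(3)[of l] k unfolding l(1) by linarith
    qed
    then show ?thesis by blast
  qed
  have approx: "\<exists>K \<alpha>. (\<Sum>n<K. \<alpha> n / (node n - b j)) = 1 \<and>
       \<bar>(\<Sum>n<K. \<alpha> n / (node n - b c)) + r j / r c\<bar> < \<epsilon> \<and>
       summable (\<lambda>i. if i = j \<or> i = c then 0 else \<bar>\<Sum>n<K. \<alpha> n / (node n - b i)\<bar> * (1 + \<bar>r i\<bar>)) \<and>
       (\<Sum>i. if i = j \<or> i = c then 0 else \<bar>\<Sum>n<K. \<alpha> n / (node n - b i)\<bar> * (1 + \<bar>r i\<bar>)) < \<epsilon>"
    if jc: "j \<noteq> c" and "0 < \<epsilon>" for j c \<epsilon>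
  proof -
    define Mj where "Mj = (case j of 0 \<Rightarrow> 1 | Suc l \<Rightarrow> M l)"
    \<comment> \<open>The 8 is 4 times 2: 4 from bounding both differences below by
      \<open>b i / 2\<close>, 2 from \<open>1 + \<bar>r i\<bar> \<le> 2 * M\<close>.\<close>
    define C where "C = 8 * Mj * \<bar>b j - b c\<bar>"
    have Mj: "\<bar>pole_res node b K j\<bar> \<le> Mj" if "j \<le> K" for K
      using r(4) that by (cases j) (auto simp: Mj_def pole_res_def)
    have Mj0: "0 \<le> Mj" using M1 by (auto simp: Mj_def split: nat.splits intro: order_trans[of 0 1])
    have C0: "0 \<le> C" using Mj0 by (simp add: C_def)
    define t where "t l = C * (M l / b (Suc l))" for l
    have st: "summable t" unfolding t_def by (intro summable_mult sM)
    have t0: "0 \<le> t l" for l using C0 M1[of l] bpos[of l] by (simp add: t_def)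
    \<comment> \<open>The approximants vanish at all but two poles of index at most
      \<open>K\<close>, so the whole error is a tail of the fixed convergent series
      \<open>t\<close>.\<close>
    have "(\<lambda>K. \<Sum>l. t (l + K)) \<longlonglongrightarrow> 0" by (rule suminf_exist_split2[OF st])
    then have ev1: "\<forall>\<^sub>F K in sequentially. (\<Sum>l. t (l + K)) < \<epsilon>" using \<open>0 < \<epsilon>\<close> by (rule order_tendstoD)
    have "(\<lambda>K. \<bar>- pole_res node b K j / pole_res node b K c + r j / r c\<bar>) \<longlonglongrightarrow> \<bar>- r j / r c + r j / r c\<bar>"
      by (intro tendsto_intros r(2) rne)
    then have "(\<lambda>K. \<bar>- pole_res node b K j / pole_res node b K c + r j / r c\<bar>) \<longlonglongrightarrow> 0" by simp
    then have ev2: "\<forall>\<^sub>F K in sequentially. \<bar>- pole_res node b K j / pole_res node b K c + r j / r c\<bar> < \<epsilon>"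
      using \<open>0 < \<epsilon>\<close> by (rule order_tendstoD)
    have ev3: "\<forall>\<^sub>F K in sequentially. 2 * b j \<le> b (Suc K) \<and> 2 * b c \<le> b (Suc K)"
      using btop by (simp add: filterlim_at_top eventually_conj_iff)
    have "\<forall>\<^sub>F K in sequentially. j \<le> K \<and> c \<le> K"
      by (intro eventually_conj eventually_ge_at_top)
    then obtain K where K: "(\<Sum>l. t (l + K)) < \<epsilon>" "\<bar>- pole_res node b K j / pole_res node b K c + r j / r c\<bar> < \<epsilon>"
      "2 * b j \<le> b (Suc K)" "2 * b c \<le> b (Suc K)" "j \<le> K" "c \<le> K"
      using eventually_happens[OF eventually_conj[OF ev1 eventually_conj[OF ev2 eventually_conj[OF ev3]]]] by auto
    have injn: "inj node" using node_strict_mono by (rule strict_mono_imp_inj_on)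
    have lt: "node k < b (Suc k)" for k using node_less_pole by (simp add: b_def)
    have ne: "node k \<noteq> b i" for k i using node_diff_pole_neq[of k i] by (simp add: b_def)
    obtain \<beta> where \<beta>: "(\<Sum>n<K. \<beta> n / (b j - node n)) = 1"
      "(\<Sum>n<K. \<beta> n / (b c - node n)) = - pole_res node b K j / pole_res node b K c"
      "\<And>i. i \<le> K \<Longrightarrow> i \<noteq> j \<Longrightarrow> i \<noteq> c \<Longrightarrow> (\<Sum>n<K. \<beta> n / (b i - node n)) = 0"
      "\<And>i. K < i \<Longrightarrow> \<bar>\<Sum>n<K. \<beta> n / (b i - node n)\<bar> \<le> \<bar>pole_res node b K j\<bar> * \<bar>b j - b c\<bar> * (b i / ((b i - b j) * (b i - b c)))"
    proof -
      have "\<exists>\<beta>. (\<Sum>n<K. \<beta> n / (b j - node n)) = 1 \<and>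
        (\<Sum>n<K. \<beta> n / (b c - node n)) = - pole_res node b K j / pole_res node b K c \<and>
        (\<forall>i. i \<le> K \<longrightarrow> i \<noteq> j \<longrightarrow> i \<noteq> c \<longrightarrow> (\<Sum>n<K. \<beta> n / (b i - node n)) = 0) \<and>
        (\<forall>i. K < i \<longrightarrow> \<bar>\<Sum>n<K. \<beta> n / (b i - node n)\<bar> \<le> \<bar>pole_res node b K j\<bar> * \<bar>b j - b c\<bar> * (b i / ((b i - b j) * (b i - b c))))"
        by (rule cauchy_approximants[OF b0 bmono node_pos lt injn ne K(5,6) jc]) blast
      then show ?thesis using that by blast
    qed
    \<comment> \<open>The differences are now taken as node minus pole, hence the change of
      sign.\<close>
    define \<alpha> where "\<alpha> n = - \<beta> n" for n
    have \<alpha>: "(\<Sum>n<K. \<alpha> n / (node n - b i)) = (\<Sum>n<K. \<beta> n / (b i - node n))" for i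
      by (intro sum.cong refl) (metis \<alpha>_def minus_diff_eq minus_divide_divide)
    define h where "h i = (if i = j \<or> i = c then 0 else \<bar>\<Sum>n<K. \<alpha> n / (node n - b i)\<bar> * (1 + \<bar>r i\<bar>))" for i
    have h0: "h i = 0" if "i < Suc K" for i using \<beta>(3)[of i] that by (simp add: h_def \<alpha>)
    have ht: "h (l + Suc K) \<le> t (l + K)" for l
    proof -
      define i where "i = l + Suc K"
      have iS: "i = Suc (l + K)" by (simp add: i_def)
      have bi: "b (Suc K) \<le> b i" using strict_mono_less_eq[OF bmono] by (simp add: i_def)
      have bi0: "0 < b i" unfolding iS by (rule bpos)
      have d: "b i / 2 \<le> b i - b j" "b i / 2 \<le> b i - b c" using K(3,4) bi by linarith+
      have "b i / ((b i - b j) * (b i - b c)) \<le> b i / (b i / 2 * (b i / 2))"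
        using bi0 d by (intro divide_left_mono mult_mono mult_pos_pos) auto
      also have "\<dots> = 4 / b i" using bi0 by simp
      finally have q: "b i / ((b i - b j) * (b i - b c)) \<le> 4 / b i" .
      have "K < i" by (simp add: i_def)
      then have "\<bar>\<Sum>n<K. \<alpha> n / (node n - b i)\<bar> \<le> \<bar>pole_res node b K j\<bar> * \<bar>b j - b c\<bar> * (b i / ((b i - b j) * (b i - b c)))"
        unfolding \<alpha> by (rule \<beta>(4))
      also have "\<dots> \<le> Mj * \<bar>b j - b c\<bar> * (4 / b i)"
        using Mj[OF K(5)] Mj0 q bi0 d by (intro mult_mono mult_nonneg_nonneg divide_nonneg_nonneg) auto
      finally have F: "\<bar>\<Sum>n<K. \<alpha> n / (node n - b i)\<bar> \<le> Mj * \<bar>b j - b c\<bar> * (4 / b i)" .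
      have "1 + \<bar>r i\<bar> \<le> 2 * M (l + K)" using r(5)[of "l + K"] M1[of "l + K"] by (simp add: iS)
      then have "\<bar>\<Sum>n<K. \<alpha> n / (node n - b i)\<bar> * (1 + \<bar>r i\<bar>) \<le> (Mj * \<bar>b j - b c\<bar> * (4 / b i)) * (2 * M (l + K))"
        using F Mj0 bi0 by (intro mult_mono) auto
      also have "\<dots> = t (l + K)" by (simp add: t_def C_def iS)
      finally show ?thesis using t0[of "l + K"] unfolding h_def i_def by simp
    qed
    have hpos: "0 \<le> h i" for i by (simp add: h_def)
    have st': "summable (\<lambda>l. t (l + K))" using st by (simp add: summable_iff_shift)
    have sh': "summable (\<lambda>l. h (l + Suc K))"
      by (rule summable_comparison_test[OF _ st']) (use ht hpos in auto)
    then have sh: "summable h" by (simp only: summable_iff_shift)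
    have "suminf h = (\<Sum>l. h (l + Suc K)) + (\<Sum>i<Suc K. h i)" by (rule suminf_split_initial_segment[OF sh])
    also have "(\<Sum>i<Suc K. h i) = 0" using h0 by (intro sum.neutral) auto
    also have "(\<Sum>l. h (l + Suc K)) + 0 \<le> (\<Sum>l. t (l + K))"
      using suminf_le[OF ht sh' st'] by simp
    finally have "suminf h < \<epsilon>" using K(1) by simp
    then show ?thesis using sh \<beta>(1,2) K(2) unfolding h_def \<alpha>[symmetric] by (intro exI[of _ K] exI[of _ \<alpha>]) simp
  qed
  have p100: "1 \<le> (100::real) ^ Suc k" for k by (rule one_le_power) simp
  have "\<exists>d. (\<forall>i. (\<lambda>l. d l / (node (Suc (2 * i)) - b (Suc (2 * l)))) sums (- 1 / node (Suc (2 * i)))) \<and>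
    (\<forall>l. \<bar>d l\<bar> \<le> (b (Suc (2 * l)) / node (Suc (2 * l)) - 1) * 3 ^ l)"
  proof (rule pf_family[of "\<lambda>k. node (Suc (2 * k))" "\<lambda>k. b (Suc (2 * k))"])
    fix k
    show "0 < node (Suc (2 * k))" by (rule node_pos)
    show "node (Suc (2 * k)) < b (Suc (2 * k))" by (simp add: b_def)
    show "b (Suc (2 * k)) \<le> 2 * node (Suc (2 * k))" "b (Suc (2 * k)) \<le> 3 * 100 ^ Suc k" "2 * 100 ^ Suc k \<le> b (Suc (2 * k))"
      "100 ^ Suc k \<le> node (Suc (2 * k))"
      using five_power_le[of k] p100[of k] by (simp_all add: b_def)
  qed
  then obtain d where d: "\<And>i. (\<lambda>l. d l / (node (Suc (2 * i)) - b (Suc (2 * l)))) sums (- 1 / node (Suc (2 * i)))"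
    "\<And>l. \<bar>d l\<bar> \<le> (b (Suc (2 * l)) / node (Suc (2 * l)) - 1) * 3 ^ l" by blast
  have "\<exists>u. (\<forall>i. (\<lambda>l. u l / (node (2 * i) - b (Suc (Suc (2 * l))))) sums (- 1 / node (2 * i))) \<and>
    (\<forall>l. \<bar>u l\<bar> \<le> (b (Suc (Suc (2 * l))) / node (2 * l) - 1) * 3 ^ l)"
  proof (rule pf_family[of "\<lambda>k. node (2 * k)" "\<lambda>k. b (Suc (Suc (2 * k)))"])
    fix k
    show "0 < node (2 * k)" by (rule node_pos)
    show "node (2 * k) < b (Suc (Suc (2 * k)))" 
      "b (Suc (Suc (2 * k))) \<le> 2 * node (2 * k)" "b (Suc (Suc (2 * k))) \<le> 3 * 100 ^ Suc k" "2 * 100 ^ Suc k \<le> b (Suc (Suc (2 * k)))"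
      "100 ^ Suc k \<le> node (2 * k)"
      using p100[of k] by (simp_all add: b_def)
  qed
  then obtain u where u: "\<And>i. (\<lambda>l. u l / (node (2 * i) - b (Suc (Suc (2 * l))))) sums (- 1 / node (2 * i))"
    "\<And>l. \<bar>u l\<bar> \<le> (b (Suc (Suc (2 * l))) / node (2 * l) - 1) * 3 ^ l" by blast
  \<comment> \<open>For \<open>i = Suc l\<close>, even \<open>l\<close> means a pole q_k and odd
    \<open>l\<close> a pole t_k; apart from 0, \<open>g\<close> lives on the former and
    \<open>f\<close> on the latter.\<close>
  define g where "g i = (case i of 0 \<Rightarrow> 1 | Suc l \<Rightarrow> if even l then d (l div 2) else 0)" for i
  \<comment> \<open>Division by \<open>r i\<close> makes \<open>f i * r i\<close> the residue of U,
    so that \<open>f_sums\<close> is the vanishing of U at its zeros.\<close>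
  define f where "f i = (case i of 0 \<Rightarrow> 1 | Suc l \<Rightarrow> if odd l then u (l div 2) / r i else 0)" for i
  have me: "strict_mono (\<lambda>k::nat. 2 * k)" "strict_mono (\<lambda>k::nat. Suc (2 * k))" by (auto simp: strict_mono_def)
  have nrange_e: "odd l" if "l \<notin> range (\<lambda>k::nat. 2 * k)" for l using that by (auto elim!: evenE)
  have nrange_o: "even l" if "l \<notin> range (\<lambda>k::nat. Suc (2 * k))" for l
    using that by (metis oddE Suc_eq_plus1 rangeI)
  have gsum: "(\<lambda>i. g i / (node n - b i)) sums 0" if "odd n" for n
  proof -
    obtain k where n: "n = Suc (2 * k)" using \<open>odd n\<close> by (auto elim!: oddE)
    have "(\<lambda>l. g (Suc l) / (node n - b (Suc l))) sums (- 1 / node n)"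
    proof (rule iffD1[OF sums_mono_reindex[OF me(1), of "\<lambda>l. g (Suc l) / (node n - b (Suc l))"]])
      show "g (Suc l) / (node n - b (Suc l)) = 0" if "l \<notin> range (\<lambda>k. 2 * k)" for l
        using nrange_e[OF that] by (simp add: g_def)
      show "(\<lambda>l. g (Suc (2 * l)) / (node n - b (Suc (2 * l)))) sums (- 1 / node n)"
        using d(1)[of k] unfolding n by (simp add: g_def del: node_simps)
    qed
    from sums_Suc[OF this] show ?thesis by (simp add: g_def b0)
  qed
  have fsum: "(\<lambda>i. f i * r i / (node n - b i)) sums 0" if "even n" for n
  proof -
    obtain k where n: "n = 2 * k" using \<open>even n\<close> by (auto elim!: evenE)
    have "(\<lambda>l. f (Suc l) * r (Suc l) / (node n - b (Suc l))) sums (- 1 / node n)"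
    proof (rule iffD1[OF sums_mono_reindex[OF me(2), of "\<lambda>l. f (Suc l) * r (Suc l) / (node n - b (Suc l))"]])
      show "f (Suc l) * r (Suc l) / (node n - b (Suc l)) = 0" if "l \<notin> range (\<lambda>k. Suc (2 * k))" for l
        using nrange_o[OF that] by (simp add: f_def)
      show "(\<lambda>l. f (Suc (Suc (2 * l))) * r (Suc (Suc (2 * l))) / (node n - b (Suc (Suc (2 * l))))) sums (- 1 / node n)"
        using u(1)[of k] rne unfolding n by (simp add: f_def del: node_simps)
    qed
    from sums_Suc[OF this] show ?thesis by (simp add: f_def b0 r(1))
  qed
  have sg: "summable (\<lambda>i. \<bar>g i\<bar>)"
  proof -
    have "summable (\<lambda>l. \<bar>d l\<bar>)"
    proof (rule summable_comparison_test)
      show "summable (\<lambda>l. (15/100::real) ^ l)" by (rule summable_geometric) simp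
      have "norm \<bar>d l\<bar> \<le> (15/100) ^ l" for l
      proof -
        have pos: "0 < 2 * (100::real) ^ Suc l - 5 ^ Suc l / 2" using five_power_le[of l] p100[of l] by linarith
        have "b (Suc (2 * l)) / node (Suc (2 * l)) - 1 = (5 ^ Suc l / 2) / (2 * 100 ^ Suc l - 5 ^ Suc l / 2)"
        proof -
          have bn: "b (Suc (2 * l)) = 2 * 100 ^ Suc l" "node (Suc (2 * l)) = 2 * 100 ^ Suc l - 5 ^ Suc l / 2"
            by (simp_all add: b_def)
          have "A / B - 1 = (A - B) / B" if "0 < B" for A B :: real using that by (simp add: diff_divide_distrib)
          from this[OF pos, of "2 * 100 ^ Suc l"] show ?thesis unfolding bn by simp
        qed
        also have "\<dots> \<le> 5 ^ Suc l / 100 ^ Suc l"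
          using five_power_le[of l] p100[of l] pos by (intro frac_le) auto
        also have "\<dots> = (5/100) ^ l * (5/100)" unfolding power_divide by (simp only: power_Suc2 times_divide_times_eq)
        also have "\<dots> \<le> (5/100) ^ l" by (rule mult_left_le) auto
        finally have "(b (Suc (2 * l)) / node (Suc (2 * l)) - 1) * 3 ^ l \<le> (5/100) ^ l * 3 ^ l"
          by (rule mult_right_mono) simp
        also have "\<dots> = (15/100) ^ l" unfolding power_mult_distrib[symmetric] by simp
        finally show ?thesis using d(2)[of l] by simp
      qed
      then show "\<exists>N. \<forall>n\<ge>N. norm \<bar>d n\<bar> \<le> (15/100) ^ n" by blast
    qed
    then have "summable (\<lambda>l. \<bar>g (Suc l)\<bar>)"
      by (intro iffD1[OF summable_mono_reindex[OF me(1), of "\<lambda>l. \<bar>g (Suc l)\<bar>"]]) (use nrange_e in \<open>auto simp: g_def\<close>)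
    then show ?thesis by (simp only: summable_Suc_iff[of "\<lambda>i. \<bar>g i\<bar>"])
  qed
  have sf: "summable (\<lambda>i. \<bar>f i\<bar>)"
  proof -
    have "summable (\<lambda>l. \<bar>u l / r (Suc (Suc (2 * l)))\<bar>)"
    proof (rule summable_comparison_test)
      show "summable (\<lambda>l. 8 * (3/5::real) ^ l)" by (intro summable_mult summable_geometric) simp
      \<comment> \<open>The residues of U grow at most like \<open>3 ^ l\<close>, those of \<Phi> at
        least like \<open>5 ^ l\<close>: the base 5 was chosen to win here.\<close>
      have "norm \<bar>u l / r (Suc (Suc (2 * l)))\<bar> \<le> 8 * (3/5) ^ l" for l
      proof -
        have "b (Suc (Suc (2 * l))) / node (2 * l) - 1 = 1"
        proof -
          have bn: "b (Suc (Suc (2 * l))) = 2 * node (2 * l)" by (simp add: b_def)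
          show ?thesis unfolding bn using node_pos[of "2 * l"] by (simp del: node_simps)
        qed
        then have "\<bar>u l\<bar> \<le> 3 ^ l" using u(2)[of l] by (simp del: node_simps)
        moreover have "5 ^ l / 8 \<le> \<bar>r (Suc (Suc (2 * l)))\<bar>" using r(3)[of "Suc (2 * l)"] by simp
        ultimately have "\<bar>u l\<bar> / \<bar>r (Suc (Suc (2 * l)))\<bar> \<le> 3 ^ l / (5 ^ l / 8)"
          by (intro frac_le) auto
        then show ?thesis by (simp add: power_divide mult.commute)
      qed
      then show "\<exists>N. \<forall>n\<ge>N. norm \<bar>u n / r (Suc (Suc (2 * n)))\<bar> \<le> 8 * (3/5) ^ n" by blast
    qed
    then have "summable (\<lambda>l. \<bar>f (Suc l)\<bar>)"
      by (intro iffD1[OF summable_mono_reindex[OF me(2), of "\<lambda>l. \<bar>f (Suc l)\<bar>"]]) (use nrange_o in \<open>auto simp: f_def\<close>)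
    then show ?thesis by (simp only: summable_Suc_iff[of "\<lambda>i. \<bar>f i\<bar>"])
  qed
  have "cauchy_system node pole r f g"
  proof (unfold_locales, fold b_def)
    show "inj pole" "inj node" using pole_strict_mono node_strict_mono by (auto intro: strict_mono_imp_inj_on)
  qed (use rne rbig rsum r(6) approx sf sg fsum gsum node_not_Ints in \<open>simp_all add: f_def g_def\<close>)
  then show ?thesis by blast
qed

subsection \<open>The space L2 and closed spans\<close>

lemma finite_L2meas: "finite_measure L2meas"
  by (rule finite_measure_lebesgue_on) (metis lmeasurable_box box_real(1))

lemma measure_L2meas: "measure L2meas {-pi<..<pi} = 2 * pi"
  by (simp add: measure_restrict_space)

lemma L2_measurable: "f \<in> L2 \<Longrightarrow> f \<in> borel_measurable L2meas"
  by (simp add: L2_def)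

lemma L2_integrable: "f \<in> L2 \<Longrightarrow> integrable L2meas (\<lambda>t. (cmod (f t))\<^sup>2)"
  by (simp add: L2_def)

lemma bounded_integrable:
  fixes f :: "real \<Rightarrow> 'a::{banach, second_countable_topology}"
  assumes "f \<in> borel_measurable L2meas" "\<And>t. norm (f t) \<le> B"
  shows "integrable L2meas f"
  using finite_measure.integrable_const_bound[OF finite_L2meas _ assms(1)] assms(2) by auto

lemma L2_bounded:
  assumes "f \<in> borel_measurable L2meas" "\<And>t. cmod (f t) \<le> B"
  shows "f \<in> L2"
proof -
  have "integrable L2meas (\<lambda>t. (cmod (f t))\<^sup>2)"
  proof (rule bounded_integrable)
    show "(\<lambda>t. (cmod (f t))\<^sup>2) \<in> borel_measurable L2meas" using assms(1) by measurable
    show "norm ((cmod (f t))\<^sup>2) \<le> B\<^sup>2" for t using assms(2)[of t] by (simp add: power_mono)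
  qed
  then show ?thesis using assms(1) by (simp add: L2_def)
qed

lemma continuous_L2meas: "continuous_on UNIV f \<Longrightarrow> f \<in> borel_measurable L2meas"
  for f :: "real \<Rightarrow> 'a::euclidean_space"
  by (rule continuous_imp_measurable_on_sets_lebesgue) (auto intro: continuous_on_subset)

lemma L2_scale [intro]: assumes "f \<in> L2" shows "(\<lambda>t. c * f t) \<in> L2"
  using assms by (auto simp: L2_def norm_mult power_mult_distrib)

lemma L2_add [intro]: assumes "f \<in> L2" "g \<in> L2" shows "(\<lambda>t. f t + g t) \<in> L2"
proof -
  have [measurable]: "f \<in> borel_measurable L2meas" "g \<in> borel_measurable L2meas" using assms by (auto simp: L2_def)
  have "integrable L2meas (\<lambda>t. (cmod (f t + g t))\<^sup>2)"
  proof (rule Bochner_Integration.integrable_bound)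
    show "integrable L2meas (\<lambda>t. 2 * (cmod (f t))\<^sup>2 + 2 * (cmod (g t))\<^sup>2)"
      using assms by (auto simp: L2_def)
    show "(\<lambda>t. (cmod (f t + g t))\<^sup>2) \<in> borel_measurable L2meas" by measurable
    have "(cmod (f t + g t))\<^sup>2 \<le> 2 * (cmod (f t))\<^sup>2 + 2 * (cmod (g t))\<^sup>2" for t
    proof -
      have "(cmod (f t + g t))\<^sup>2 \<le> (cmod (f t) + cmod (g t))\<^sup>2" by (simp add: norm_triangle_ineq power_mono)
      also have "\<dots> \<le> 2 * (cmod (f t))\<^sup>2 + 2 * (cmod (g t))\<^sup>2"
        using zero_le_power2[of "cmod (f t) - cmod (g t)"] by (simp add: power2_eq_square algebra_simps)
      finally show ?thesis .
    qed
    then show "AE t in L2meas. norm ((cmod (f t + g t))\<^sup>2) \<le> norm (2 * (cmod (f t))\<^sup>2 + 2 * (cmod (g t))\<^sup>2)"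
      by simp
  qed
  then show ?thesis by (simp add: L2_def)
qed

lemma L2_diff [intro]: assumes "f \<in> L2" "g \<in> L2" shows "(\<lambda>t. f t - g t) \<in> L2"
  using L2_add[OF assms(1) L2_scale[OF assms(2), of "-1"]] by simp

lemma L2_zero [simp]: "(\<lambda>t. 0) \<in> L2"
  by (simp add: L2_def)

lemma L2_sum [intro]: "(\<And>n. n \<in> J \<Longrightarrow> F n \<in> L2) \<Longrightarrow> (\<lambda>t. \<Sum>n\<in>J. F n t) \<in> L2"
  by (induction J rule: infinite_finite_induct) auto

lemma l2_inner_integrable:
  assumes "f \<in> L2" "g \<in> L2"
  shows "integrable L2meas (\<lambda>t. f t * cnj (g t))"
proof (rule Bochner_Integration.integrable_bound)
  have [measurable]: "f \<in> borel_measurable L2meas" "g \<in> borel_measurable L2meas" using assms by (auto simp: L2_def)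
  show "integrable L2meas (\<lambda>t. (cmod (f t))\<^sup>2 + (cmod (g t))\<^sup>2)" using assms by (auto simp: L2_def)
  have [measurable]: "(\<lambda>t. cnj (g t)) \<in> borel_measurable L2meas"
    by (rule measurable_compose[OF _ borel_measurable_continuous_onI]) (auto intro: L2_measurable assms continuous_intros)
  show "(\<lambda>t. f t * cnj (g t)) \<in> borel_measurable L2meas" by measurable
  have "cmod (f t) * cmod (g t) \<le> (cmod (f t))\<^sup>2 + (cmod (g t))\<^sup>2" for t
  proof -
    have "0 \<le> (cmod (f t) - cmod (g t))\<^sup>2" "0 \<le> cmod (f t) * cmod (g t)" by simp_all
    then show ?thesis unfolding power2_diff by linarith
  qed
  then show "AE t in L2meas. norm (f t * cnj (g t)) \<le> norm ((cmod (f t))\<^sup>2 + (cmod (g t))\<^sup>2)"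
    by (simp add: norm_mult)
qed

text \<open>Only a seminorm, since functions are not identified almost everywhere; equality in the
  space appears below as a difference of \<open>l2_norm\<close> 0.\<close>

definition l2_norm :: "(real \<Rightarrow> complex) \<Rightarrow> real" where
  "l2_norm f = sqrt (LINT t|L2meas. (cmod (f t))\<^sup>2)"

lemma l2_dist_norm: "l2_dist f g = l2_norm (\<lambda>t. f t - g t)"
  by (simp add: l2_dist_def l2_norm_def)

lemma l2_norm_nonneg [simp]: "0 \<le> l2_norm f"
  by (simp add: l2_norm_def integral_nonneg_AE)

lemma l2_norm_power2: "(l2_norm f)\<^sup>2 = (LINT t|L2meas. (cmod (f t))\<^sup>2)"
  by (simp add: l2_norm_def integral_nonneg_AE)

lemma l2_inner_self: "l2_inner f f = of_real ((l2_norm f)\<^sup>2)"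
proof -
  have "f t * cnj (f t) = complex_of_real ((cmod (f t))\<^sup>2)" for t by (metis complex_norm_square)
  then show ?thesis unfolding l2_inner_def l2_norm_power2 by (simp only: integral_complex_of_real)
qed

lemma l2_inner_add_left: "f \<in> L2 \<Longrightarrow> g \<in> L2 \<Longrightarrow> h \<in> L2 \<Longrightarrow> l2_inner (\<lambda>t. f t + g t) h = l2_inner f h + l2_inner g h"
  unfolding l2_inner_def by (subst Bochner_Integration.integral_add[symmetric]) (auto intro: l2_inner_integrable simp: algebra_simps)

lemma l2_inner_scale_left: "l2_inner (\<lambda>t. c * f t) h = c * l2_inner f h"
  unfolding l2_inner_def by (simp add: mult.assoc)

lemma l2_inner_cnj: "l2_inner f g = cnj (l2_inner g f)"
proof -
  have "cnj (l2_inner g f) = (LINT t|L2meas. cnj (g t * cnj (f t)))" unfolding l2_inner_def by (rule Bochner_Integration.integral_cnj[symmetric])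
  then show ?thesis by (simp add: l2_inner_def mult.commute)
qed

lemma l2_inner_add_right: "f \<in> L2 \<Longrightarrow> g \<in> L2 \<Longrightarrow> h \<in> L2 \<Longrightarrow> l2_inner h (\<lambda>t. f t + g t) = l2_inner h f + l2_inner h g"
  using l2_inner_add_left[of f g h] l2_inner_cnj by (metis complex_cnj_add)

lemma l2_inner_scale_right: "l2_inner h (\<lambda>t. c * f t) = cnj c * l2_inner h f"
  using l2_inner_scale_left[of c f h] l2_inner_cnj by (metis complex_cnj_mult)

lemma l2_inner_diff_left: "f \<in> L2 \<Longrightarrow> g \<in> L2 \<Longrightarrow> h \<in> L2 \<Longrightarrow> l2_inner (\<lambda>t. f t - g t) h = l2_inner f h - l2_inner g h"
  using l2_inner_add_left[of f "\<lambda>t. (-1) * g t" h] l2_inner_scale_left[of "-1" g h] L2_scale[of g "-1"] by simp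

lemma l2_inner_diff_right: "f \<in> L2 \<Longrightarrow> g \<in> L2 \<Longrightarrow> h \<in> L2 \<Longrightarrow> l2_inner h (\<lambda>t. f t - g t) = l2_inner h f - l2_inner h g"
  using l2_inner_diff_left[of f g h] l2_inner_cnj by (metis complex_cnj_diff)

lemma l2_inner_zero [simp]: "l2_inner (\<lambda>t. 0) h = 0" "l2_inner h (\<lambda>t. 0) = 0"
  by (simp_all add: l2_inner_def)

lemma l2_inner_sum_left:
  assumes "\<And>n. n \<in> J \<Longrightarrow> F n \<in> L2" "h \<in> L2"
  shows "l2_inner (\<lambda>t. \<Sum>n\<in>J. c n * F n t) h = (\<Sum>n\<in>J. c n * l2_inner (F n) h)"
  using assms
proof (induction J rule: infinite_finite_induct)
  case (insert x J)
  then show ?case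
    by (simp add: l2_inner_add_left L2_scale L2_sum l2_inner_scale_left)
qed auto

lemma l2_inner_sum_right:
  assumes "\<And>n. n \<in> J \<Longrightarrow> F n \<in> L2" "h \<in> L2"
  shows "l2_inner h (\<lambda>t. \<Sum>n\<in>J. c n * F n t) = (\<Sum>n\<in>J. cnj (c n) * l2_inner h (F n))"
proof -
  have "l2_inner h (\<lambda>t. \<Sum>n\<in>J. c n * F n t) = cnj (\<Sum>n\<in>J. c n * l2_inner (F n) h)"
    using l2_inner_sum_left[OF assms, where c = c] l2_inner_cnj[of h "\<lambda>t. \<Sum>n\<in>J. c n * F n t"] by simp
  also have "\<dots> = (\<Sum>n\<in>J. cnj (c n) * cnj (l2_inner (F n) h))" by simp
  also have "\<dots> = (\<Sum>n\<in>J. cnj (c n) * l2_inner h (F n))"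
    by (intro sum.cong refl) (metis l2_inner_cnj)
  finally show ?thesis .
qed

text \<open>Young's inequality with a free parameter, taken at the quotient of the norms.\<close>

lemma l2_Cauchy_Schwarz:
  assumes "f \<in> L2" "g \<in> L2"
  shows "cmod (l2_inner f g) \<le> l2_norm f * l2_norm g"
proof -
  have young: "2 * cmod (l2_inner f g) \<le> e * (l2_norm f)\<^sup>2 + (l2_norm g)\<^sup>2 / e" if "0 < e" for e
  proof -
    have "cmod (l2_inner f g) \<le> (LINT t|L2meas. norm (f t * cnj (g t)))"
      unfolding l2_inner_def by (rule integral_norm_bound)
    also have "\<dots> \<le> (LINT t|L2meas. e/2 * (cmod (f t))\<^sup>2 + 1/(2*e) * (cmod (g t))\<^sup>2)"
    proof (rule integral_mono)
      show "integrable L2meas (\<lambda>t. norm (f t * cnj (g t)))" using l2_inner_integrable[OF assms] by (rule integrable_norm)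
      show "integrable L2meas (\<lambda>t. e/2 * (cmod (f t))\<^sup>2 + 1/(2*e) * (cmod (g t))\<^sup>2)"
        using assms by (auto simp: L2_def)
      fix t
      have "0 \<le> (e * cmod (f t) - cmod (g t))\<^sup>2 / (2 * e)" using that by simp
      also have "\<dots> = e/2 * (cmod (f t))\<^sup>2 + 1/(2*e) * (cmod (g t))\<^sup>2 - cmod (f t) * cmod (g t)"
        using that by (simp add: power2_eq_square field_simps)
      finally show "norm (f t * cnj (g t)) \<le> e/2 * (cmod (f t))\<^sup>2 + 1/(2*e) * (cmod (g t))\<^sup>2"
        by (simp add: norm_mult)
    qed
    also have "\<dots> = e/2 * (l2_norm f)\<^sup>2 + 1/(2*e) * (l2_norm g)\<^sup>2"
      unfolding l2_norm_power2 using assms by (simp add: L2_def)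
    finally show ?thesis by (simp add: field_simps)
  qed
  show ?thesis
  proof (cases "l2_norm f = 0 \<or> l2_norm g = 0")
    case False
    then have f: "0 < l2_norm f" and g: "0 < l2_norm g" using l2_norm_nonneg[of f] l2_norm_nonneg[of g] by linarith+
    have "2 * cmod (l2_inner f g) \<le> l2_norm g / l2_norm f * (l2_norm f)\<^sup>2 + (l2_norm g)\<^sup>2 / (l2_norm g / l2_norm f)"
      using f g by (intro young) simp
    then show ?thesis using f g by (simp add: power2_eq_square)
  next
    case True
    show ?thesis
    proof (rule ccontr)
      assume "\<not> ?thesis"
      then have c: "0 < cmod (l2_inner f g)" using True by auto
      define A where "A = (l2_norm f)\<^sup>2 + (l2_norm g)\<^sup>2"
      have A: "0 \<le> A" by (simp add: A_def)
      \<comment> \<open>When a norm is 0 there is no optimal parameter. A small \<open>d\<close>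
        (for \<open>l2_norm g = 0\<close>, its reciprocal) already contradicts a nonzero inner
        product.\<close>
      define d where "d = cmod (l2_inner f g) / (A + 1)"
      have d: "0 < d" using c A by (simp add: d_def)
      have dA: "d * A < cmod (l2_inner f g)"
      proof -
        have "d * A < d * (A + 1)" using d by simp
        also have "\<dots> = cmod (l2_inner f g)" using A by (simp add: d_def)
        finally show ?thesis .
      qed
      have "2 * cmod (l2_inner f g) \<le> d * A"
        using True young[OF d] young[of "1/d"] d by (auto simp: A_def mult.commute)
      then show False using dA c by linarith
    qed
  qed
qed

lemma l2_norm_scale: "l2_norm (\<lambda>t. c * f t) = cmod c * l2_norm f"
  by (simp add: l2_norm_def norm_mult power_mult_distrib real_sqrt_mult)

lemma l2_norm_triangle:
  assumes "f \<in> L2" "g \<in> L2"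
  shows "l2_norm (\<lambda>t. f t + g t) \<le> l2_norm f + l2_norm g"
proof (rule power2_le_imp_le)
  let ?s = "\<lambda>t. f t + g t"
  have "complex_of_real ((l2_norm ?s)\<^sup>2) = l2_inner f f + l2_inner g g + (l2_inner f g + l2_inner g f)"
    unfolding l2_inner_self[symmetric] using assms by (simp add: l2_inner_add_left l2_inner_add_right L2_add)
  then have "(l2_norm ?s)\<^sup>2 = Re (l2_inner f f + l2_inner g g + (l2_inner f g + l2_inner g f))"
    by (metis Re_complex_of_real)
  also have "\<dots> = (l2_norm f)\<^sup>2 + (l2_norm g)\<^sup>2 + (Re (l2_inner f g) + Re (l2_inner g f))"
    by (simp add: l2_inner_self)
  also have "\<dots> \<le> (l2_norm f)\<^sup>2 + (l2_norm g)\<^sup>2 + (l2_norm f * l2_norm g + l2_norm g * l2_norm f)"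
    using complex_Re_le_cmod[of "l2_inner f g"] complex_Re_le_cmod[of "l2_inner g f"]
      l2_Cauchy_Schwarz[OF assms] l2_Cauchy_Schwarz[OF assms(2,1)] by linarith
  finally show "(l2_norm ?s)\<^sup>2 \<le> (l2_norm f + l2_norm g)\<^sup>2" by (simp add: power2_eq_square algebra_simps)
qed simp

lemma l2_dist_triangle:
  assumes "f \<in> L2" "g \<in> L2" "h \<in> L2"
  shows "l2_dist f h \<le> l2_dist f g + l2_dist g h"
  unfolding l2_dist_norm using l2_norm_triangle[OF L2_diff[OF assms(1,2)] L2_diff[OF assms(2,3)]] by simp

lemma l2_dist_commute: "l2_dist f g = l2_dist g f"
  by (simp add: l2_dist_def norm_minus_commute)

lemma l2_norm_bounded:
  assumes "f \<in> borel_measurable L2meas" "\<And>t. t \<in> {-pi<..<pi} \<Longrightarrow> cmod (f t) \<le> B" "0 \<le> B"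
  shows "l2_norm f \<le> B * sqrt (2 * pi)"
proof -
  have "(LINT t|L2meas. (cmod (f t))\<^sup>2) \<le> (LINT t|L2meas. B\<^sup>2)"
  proof (rule integral_mono_AE')
    show "integrable L2meas (\<lambda>t. B\<^sup>2)" using finite_L2meas by (simp add: finite_measure.integrable_const)
    show "AE t in L2meas. (cmod (f t))\<^sup>2 \<le> B\<^sup>2" using assms(2) by (intro AE_I2) (auto intro!: power_mono)
  qed auto
  also have "\<dots> = B\<^sup>2 * (2 * pi)" using measure_L2meas by simp
  finally have "l2_norm f \<le> sqrt (B\<^sup>2 * (2 * pi))" unfolding l2_norm_def by simp
  then show ?thesis using assms(3) by (simp add: real_sqrt_mult)
qed

section \<open>Closed spans\<close>

lemma in_closed_span_limit:
  assumes F: "\<And>n. n \<in> I \<Longrightarrow> F n \<in> L2" and f: "f \<in> L2"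
    and approx: "\<And>\<epsilon>. 0 < \<epsilon> \<Longrightarrow> \<exists>g\<in>L2. in_closed_span F I g \<and> l2_dist f g < \<epsilon>"
  shows "in_closed_span F I f"
  unfolding in_closed_span_def
proof (intro allI impI)
  fix \<epsilon> :: real assume "0 < \<epsilon>"
  then obtain g where g: "g \<in> L2" "in_closed_span F I g" "l2_dist f g < \<epsilon>/2" using approx[of "\<epsilon>/2"] by auto
  then obtain J c where J: "finite J" "J \<subseteq> I" "l2_dist g (\<lambda>t. \<Sum>n\<in>J. c n * F n t) < \<epsilon>/2"
    using \<open>0 < \<epsilon>\<close> unfolding in_closed_span_def by (meson half_gt_zero)
  have "(\<lambda>t. \<Sum>n\<in>J. c n * F n t) \<in> L2" using J F by (intro L2_sum L2_scale) auto
  then have "l2_dist f (\<lambda>t. \<Sum>n\<in>J. c n * F n t) < \<epsilon>"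
    using l2_dist_triangle[OF f g(1), of "\<lambda>t. \<Sum>n\<in>J. c n * F n t"] g(3) J(3) by linarith
  then show "\<exists>J c. finite J \<and> J \<subseteq> I \<and> l2_dist f (\<lambda>t. \<Sum>n\<in>J. c n * F n t) < \<epsilon>" using J by blast
qed

lemma in_closed_span_base:
  assumes "n \<in> I"
  shows "in_closed_span F I (F n)"
  unfolding in_closed_span_def
proof (intro allI impI)
  fix \<epsilon> :: real assume "0 < \<epsilon>"
  then show "\<exists>J c. finite J \<and> J \<subseteq> I \<and> l2_dist (F n) (\<lambda>t. \<Sum>n\<in>J. c n * F n t) < \<epsilon>"
    using assms by (intro exI[of _ "{n}"] exI[of _ "\<lambda>_. 1"]) (simp add: l2_dist_def)
qed

lemma in_closed_span_scale:
  assumes "in_closed_span F I f"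
  shows "in_closed_span F I (\<lambda>t. a * f t)"
  unfolding in_closed_span_def
proof (intro allI impI)
  fix \<epsilon> :: real assume e: "0 < \<epsilon>"
  have p: "0 < cmod a + 1" by (simp add: add_nonneg_pos)
  then have "0 < \<epsilon> / (cmod a + 1)" using e by simp
  then obtain J c where J: "finite J" "J \<subseteq> I" "l2_dist f (\<lambda>t. \<Sum>n\<in>J. c n * F n t) < \<epsilon> / (cmod a + 1)"
    using assms unfolding in_closed_span_def by blast
  have "l2_dist (\<lambda>t. a * f t) (\<lambda>t. \<Sum>n\<in>J. (a * c n) * F n t) = cmod a * l2_dist f (\<lambda>t. \<Sum>n\<in>J. c n * F n t)"
    unfolding l2_dist_norm l2_norm_scale[symmetric] by (simp add: sum_distrib_left right_diff_distrib mult.assoc)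
  also have "\<dots> \<le> (cmod a + 1) * l2_dist f (\<lambda>t. \<Sum>n\<in>J. c n * F n t)"
    by (intro mult_right_mono) (auto simp: l2_dist_norm)
  also have "\<dots> < \<epsilon>" using J(3) p by (simp add: pos_less_divide_eq mult.commute)
  finally show "\<exists>J c. finite J \<and> J \<subseteq> I \<and> l2_dist (\<lambda>t. a * f t) (\<lambda>t. \<Sum>n\<in>J. c n * F n t) < \<epsilon>"
    using J(1,2) by (intro exI[of _ J] exI[of _ "\<lambda>n. a * c n"] conjI)
qed

lemma in_closed_span_add:
  assumes F: "\<And>n. n \<in> I \<Longrightarrow> F n \<in> L2" and fg: "f \<in> L2" "g \<in> L2"
    and "in_closed_span F I f" "in_closed_span F I g"
  shows "in_closed_span F I (\<lambda>t. f t + g t)"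
  unfolding in_closed_span_def
proof (intro allI impI)
  fix \<epsilon> :: real assume "0 < \<epsilon>"
  then have e2: "0 < \<epsilon>/2" by simp
  obtain J c where J: "finite J" "J \<subseteq> I" "l2_dist f (\<lambda>t. \<Sum>n\<in>J. c n * F n t) < \<epsilon>/2"
    using assms(4) e2 unfolding in_closed_span_def by blast
  obtain J' c' where J': "finite J'" "J' \<subseteq> I" "l2_dist g (\<lambda>t. \<Sum>n\<in>J'. c' n * F n t) < \<epsilon>/2"
    using assms(5) e2 unfolding in_closed_span_def by blast
  define d where "d n = (if n \<in> J then c n else 0) + (if n \<in> J' then c' n else 0)" for n
  have "(\<Sum>n\<in>J \<union> J'. d n * F n t) = (\<Sum>n\<in>J. c n * F n t) + (\<Sum>n\<in>J'. c' n * F n t)" for t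
  proof -
    have "(\<Sum>n\<in>J \<union> J'. d n * F n t) = (\<Sum>n\<in>J \<union> J'. (if n \<in> J then c n else 0) * F n t) + (\<Sum>n\<in>J \<union> J'. (if n \<in> J' then c' n else 0) * F n t)"
      by (simp add: d_def distrib_right sum.distrib)
    also have "(\<Sum>n\<in>J \<union> J'. (if n \<in> J then c n else 0) * F n t) = (\<Sum>n\<in>J. c n * F n t)"
      using J J' by (intro sum.mono_neutral_cong_right) auto
    also have "(\<Sum>n\<in>J \<union> J'. (if n \<in> J' then c' n else 0) * F n t) = (\<Sum>n\<in>J'. c' n * F n t)"
      using J J' by (intro sum.mono_neutral_cong_right) auto
    finally show ?thesis .
  qed
  then have "l2_dist (\<lambda>t. f t + g t) (\<lambda>t. \<Sum>n\<in>J \<union> J'. d n * F n t)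
     = l2_norm (\<lambda>t. (f t - (\<Sum>n\<in>J. c n * F n t)) + (g t - (\<Sum>n\<in>J'. c' n * F n t)))"
    by (simp add: l2_dist_norm algebra_simps)
  also have "\<dots> \<le> l2_dist f (\<lambda>t. \<Sum>n\<in>J. c n * F n t) + l2_dist g (\<lambda>t. \<Sum>n\<in>J'. c' n * F n t)"
    unfolding l2_dist_norm using J J' F by (intro l2_norm_triangle L2_diff fg L2_sum L2_scale) auto
  also have "\<dots> < \<epsilon>" using J(3) J'(3) by linarith
  finally show "\<exists>J c. finite J \<and> J \<subseteq> I \<and> l2_dist (\<lambda>t. f t + g t) (\<lambda>t. \<Sum>n\<in>J. c n * F n t) < \<epsilon>"
    using J J' by (intro exI[of _ "J \<union> J'"] exI[of _ d]) auto
qed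

lemma in_closed_span_zero: "in_closed_span F I (\<lambda>t. 0)"
  unfolding in_closed_span_def by (intro allI impI exI[of _ "{}"]) (simp add: l2_dist_def)

lemma in_closed_span_sum:
  assumes F: "\<And>n. n \<in> I \<Longrightarrow> F n \<in> L2" and h: "\<And>k. k \<in> S \<Longrightarrow> h k \<in> L2" "\<And>k. k \<in> S \<Longrightarrow> in_closed_span F I (h k)"
  shows "in_closed_span F I (\<lambda>t. \<Sum>k\<in>S. h k t)"
  using h
proof (induction S rule: infinite_finite_induct)
  case (insert x S)
  then have "in_closed_span F I (\<lambda>t. h x t + (\<Sum>k\<in>S. h k t))"
    by (intro in_closed_span_add) (auto intro: F L2_sum)
  then show ?case using insert.hyps by simp
qed (auto simp: in_closed_span_zero)

lemma in_closed_span_trans: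
  assumes F: "\<And>n. n \<in> I \<Longrightarrow> F n \<in> L2" and H: "\<And>k. k \<in> S \<Longrightarrow> H k \<in> L2" "\<And>k. k \<in> S \<Longrightarrow> in_closed_span F I (H k)"
    and f: "f \<in> L2" "in_closed_span H S f"
  shows "in_closed_span F I f"
proof (rule in_closed_span_limit[OF F f(1)])
  fix \<epsilon> :: real assume "0 < \<epsilon>"
  then obtain J c where J: "finite J" "J \<subseteq> S" "l2_dist f (\<lambda>t. \<Sum>n\<in>J. c n * H n t) < \<epsilon>"
    using f(2) unfolding in_closed_span_def by blast
  moreover have "(\<lambda>t. \<Sum>n\<in>J. c n * H n t) \<in> L2" using J H by (intro L2_sum L2_scale) auto
  moreover have "in_closed_span F I (\<lambda>t. \<Sum>n\<in>J. c n * H n t)"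
    using J H by (intro in_closed_span_sum[OF F] in_closed_span_scale) auto
  ultimately show "\<exists>g\<in>L2. in_closed_span F I g \<and> l2_dist f g < \<epsilon>" by blast
qed

text \<open>A combination orthogonal to \<open>h\<close> has distance at least
  \<open>l2_norm h\<close> from \<open>h\<close>, so it cannot approximate \<open>h\<close> any
  better.\<close>

lemma orthogonal_complete_null:
  assumes F: "l2_complete F I" and h: "h \<in> L2" "\<And>n. n \<in> I \<Longrightarrow> l2_inner (F n) h = 0"
  shows "l2_norm h = 0"
proof (rule ccontr)
  assume "l2_norm h \<noteq> 0"
  then have p: "0 < l2_norm h" using l2_norm_nonneg[of h] by linarith
  have FL: "F n \<in> L2" if "n \<in> I" for n using F that by (simp add: l2_complete_def)
  obtain J c where J: "finite J" "J \<subseteq> I" "l2_dist h (\<lambda>t. \<Sum>n\<in>J. c n * F n t) < l2_norm h"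
    using F h(1) p unfolding l2_complete_def in_closed_span_def by blast
  let ?s = "\<lambda>t. \<Sum>n\<in>J. c n * F n t"
  have s: "?s \<in> L2" using J FL by (intro L2_sum L2_scale) auto
  have "l2_inner ?s h = (\<Sum>n\<in>J. c n * l2_inner (F n) h)" using J FL h(1) by (intro l2_inner_sum_left) auto
  also have "\<dots> = 0" using J h(2) by (intro sum.neutral) auto
  finally have "l2_inner (\<lambda>t. h t - ?s t) h = of_real ((l2_norm h)\<^sup>2)"
    using h(1) s by (simp add: l2_inner_diff_left l2_inner_self)
  then have "(l2_norm h)\<^sup>2 = cmod (l2_inner (\<lambda>t. h t - ?s t) h)" by (simp add: norm_power)
  also have "\<dots> \<le> l2_dist h ?s * l2_norm h"
    unfolding l2_dist_norm using h(1) s by (intro l2_Cauchy_Schwarz) auto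
  also have "\<dots> < l2_norm h * l2_norm h" using J(3) p by simp
  finally show False by (simp add: power2_eq_square)
qed

subsection \<open>Exponentials\<close>

definition expo :: "real \<Rightarrow> real \<Rightarrow> complex" where
  "expo x t = exp (\<i> * complex_of_real (x * t))"

lemma norm_expo [simp]: "cmod (expo x t) = 1"
  by (simp add: expo_def)

lemma continuous_expo [continuous_intros]: "continuous_on S (expo x)"
  unfolding expo_def by (intro continuous_intros)

lemma expo_measurable [measurable]: "expo x \<in> borel_measurable L2meas"
  by (rule continuous_L2meas) (rule continuous_expo)

lemma expo_L2 [simp, intro]: "expo x \<in> L2"
  by (rule L2_bounded[of _ 1]) auto

lemma expo_add: "expo (x + y) t = expo x t * expo y t"
  by (simp add: expo_def exp_add[symmetric] algebra_simps)

lemma cnj_expo: "cnj (expo x t) = expo (- x) t"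
  by (simp add: expo_def exp_cnj)

lemma LINT_expo: "(LINT t|L2meas. expo w t) = (if w = 0 then 2 * pi else of_real (2 * sin (pi * w) / w))"
proof (cases "w = 0")
  case True
  then show ?thesis using measure_L2meas by (simp add: expo_def scaleR_conv_of_real)
next
  case False
  have "(expo w has_integral (expo w pi / (\<i> * w) - expo w (- pi) / (\<i> * w))) {-pi..pi}"
  proof (rule fundamental_theorem_of_calculus)
    fix t assume "t \<in> {-pi..pi}"
    have "((\<lambda>z. exp (\<i> * (of_real w * z)) / (\<i> * w)) has_field_derivative exp (\<i> * (of_real w * of_real t))) (at (of_real t))"
      using False by (auto intro!: derivative_eq_intros simp: mult.commute[of _ \<i>])
    then have "((\<lambda>t. exp (\<i> * (of_real w * of_real t)) / (\<i> * w)) has_vector_derivative exp (\<i> * (of_real w * of_real t))) (at t within {-pi..pi})"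
      by (rule has_vector_derivative_real_field)
    then show "((\<lambda>t. expo w t / (\<i> * w)) has_vector_derivative expo w t) (at t within {-pi..pi})"
      by (simp add: expo_def)
  qed auto
  then have "integral {-pi..pi} (expo w) = expo w pi / (\<i> * w) - expo w (- pi) / (\<i> * w)"
    by (rule integral_unique)
  also have "\<dots> = (expo w pi - cnj (expo w pi)) / (\<i> * w)"
    by (simp add: cnj_expo diff_divide_distrib) (simp add: expo_def)
  also have "\<dots> = of_real (2 * sin (pi * w) / w)"
    unfolding complex_diff_cnj using False by (simp add: expo_def Im_exp mult.commute)
  finally have "integral {-pi..pi} (expo w) = of_real (2 * sin (pi * w) / w)" .
  moreover have "(LINT t|L2meas. expo w t) = integral {-pi<..<pi} (expo w)"
    by (rule lebesgue_integral_eq_integral) (auto intro: bounded_integrable[of _ 1])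
  moreover have "integral {-pi<..<pi} (expo w) = integral {-pi..pi} (expo w)"
    using integral_open_interval[of "-pi" pi "expo w"] by (simp add: box_real)
  ultimately show ?thesis using False by simp
qed

lemma l2_inner_expo:
  "l2_inner (expo x) (expo y) = (if x = y then 2 * pi else of_real (2 * sin (pi * (x - y)) / (x - y)))"
proof -
  have "l2_inner (expo x) (expo y) = (LINT t|L2meas. expo (x - y) t)"
    unfolding l2_inner_def cnj_expo by (simp flip: expo_add)
  then show ?thesis by (simp add: LINT_expo)
qed

lemma l2_inner_expo_int:
  "l2_inner (expo (of_int m)) (expo (of_int n)) = (if m = n then 2 * pi else 0)"
proof -
  have "sin (pi * (real_of_int m - real_of_int n)) = 0"
    by (metis Ints_of_int of_int_diff sin_times_pi_eq_0 mult.commute)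
  then show ?thesis by (simp add: l2_inner_expo)
qed

lemma l2_norm_expo [simp]: "l2_norm (expo x) = sqrt (2 * pi)"
proof -
  have "complex_of_real ((l2_norm (expo x))\<^sup>2) = of_real (2 * pi)" using l2_inner_self[of "expo x"] by (simp add: l2_inner_expo)
  then have "(l2_norm (expo x))\<^sup>2 = 2 * pi" by (simp only: of_real_eq_iff)
  then show ?thesis by (metis l2_norm_nonneg real_sqrt_unique)
qed

subsection \<open>Trigonometric polynomials\<close>

definition trig_poly :: "(real \<Rightarrow> complex) \<Rightarrow> bool" where
  "trig_poly h \<longleftrightarrow> (\<exists>(J :: int set) c. finite J \<and> (\<forall>t. h t = (\<Sum>m\<in>J. c m * expo (of_int m) t)))"

lemma trig_poly_add:
  assumes "trig_poly f" "trig_poly g"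
  shows "trig_poly (\<lambda>t. f t + g t)"
proof -
  obtain J c where J: "finite (J :: int set)" "\<And>t. f t = (\<Sum>m\<in>J. c m * expo (of_int m) t)"
    using assms(1) unfolding trig_poly_def by blast
  obtain J' c' where J': "finite (J' :: int set)" "\<And>t. g t = (\<Sum>m\<in>J'. c' m * expo (of_int m) t)"
    using assms(2) unfolding trig_poly_def by blast
  define d where "d n = (if n \<in> J then c n else 0) + (if n \<in> J' then c' n else 0)" for n
  have "f t + g t = (\<Sum>n\<in>J \<union> J'. d n * expo (of_int n) t)" for t
  proof -
    have "(\<Sum>n\<in>J \<union> J'. d n * expo (of_int n) t) = (\<Sum>n\<in>J \<union> J'. (if n \<in> J then c n else 0) * expo (of_int n) t) + (\<Sum>n\<in>J \<union> J'. (if n \<in> J' then c' n else 0) * expo (of_int n) t)"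
      by (simp add: d_def distrib_right sum.distrib)
    also have "(\<Sum>n\<in>J \<union> J'. (if n \<in> J then c n else 0) * expo (of_int n) t) = (\<Sum>n\<in>J. c n * expo (of_int n) t)"
      using J J' by (intro sum.mono_neutral_cong_right) auto
    also have "(\<Sum>n\<in>J \<union> J'. (if n \<in> J' then c' n else 0) * expo (of_int n) t) = (\<Sum>n\<in>J'. c' n * expo (of_int n) t)"
      using J J' by (intro sum.mono_neutral_cong_right) auto
    finally show ?thesis using J J' by simp
  qed
  then show ?thesis unfolding trig_poly_def using J J' by (intro exI[of _ "J \<union> J'"] exI[of _ d]) simp
qed

lemma trig_poly_shift:
  assumes "trig_poly f"
  shows "trig_poly (\<lambda>t. a * expo (of_int k) t * f t)"
proof -
  obtain J c where J: "finite (J :: int set)" "\<And>t. f t = (\<Sum>m\<in>J. c m * expo (of_int m) t)"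
    using assms(1) unfolding trig_poly_def by blast
  have "a * expo (of_int k) t * f t = (\<Sum>m\<in>(\<lambda>m. k + m) ` J. (a * c (m - k)) * expo (of_int m) t)" for t
    by (simp add: J sum.reindex sum_distrib_left expo_add mult_ac)
  then show ?thesis unfolding trig_poly_def using J(1)
    by (intro exI[of _ "(\<lambda>m. k + m) ` J"] exI[of _ "\<lambda>m. a * c (m - k)"]) simp
qed

lemma trig_poly_zero: "trig_poly (\<lambda>t. 0)"
  unfolding trig_poly_def by (intro exI[of _ "{}"]) simp

lemma trig_poly_sum: "(\<And>k. k \<in> S \<Longrightarrow> trig_poly (f k)) \<Longrightarrow> trig_poly (\<lambda>t. \<Sum>k\<in>S. f k t)"
proof (induction S rule: infinite_finite_induct)
  case (insert x S)
  then show ?case using trig_poly_add[of "f x" "\<lambda>t. \<Sum>k\<in>S. f k t"] by simp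
qed (auto simp: trig_poly_zero)

lemma trig_poly_mult:
  assumes "trig_poly f" "trig_poly g"
  shows "trig_poly (\<lambda>t. f t * g t)"
proof -
  obtain J c where J: "finite (J :: int set)" "\<And>t. f t = (\<Sum>m\<in>J. c m * expo (of_int m) t)"
    using assms(1) unfolding trig_poly_def by blast
  have "trig_poly (\<lambda>t. \<Sum>m\<in>J. c m * expo (of_int m) t * g t)"
    by (intro trig_poly_sum trig_poly_shift assms(2))
  then show ?thesis by (simp add: J(2) sum_distrib_right)
qed

lemma trig_poly_expo: "trig_poly (\<lambda>t. a * expo (of_int k) t)"
  unfolding trig_poly_def by (intro exI[of _ "{k}"] exI[of _ "\<lambda>_. a"]) simp

lemma trig_poly_const: "trig_poly (\<lambda>t. a)"
  using trig_poly_expo[of a 0] by (simp add: expo_def)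

lemma expo_one: "expo 1 t = cis t"
  by (simp add: expo_def cis_conv_exp)

lemma trig_poly_cos_sin: "trig_poly (\<lambda>t. of_real (cos t))" "trig_poly (\<lambda>t. of_real (sin t))"
proof -
  have "of_real (cos t) = 1/2 * expo (of_int 1) t + 1/2 * expo (of_int (- 1)) t" for t
    by (simp add: complex_eq_iff expo_one cnj_expo[symmetric])
  then show "trig_poly (\<lambda>t. of_real (cos t))"
    using trig_poly_add[OF trig_poly_expo[of "1/2" 1] trig_poly_expo[of "1/2" "-1"]] by simp
  have "of_real (sin t) = - \<i>/2 * expo (of_int 1) t + \<i>/2 * expo (of_int (- 1)) t" for t
    by (simp add: complex_eq_iff expo_one cnj_expo[symmetric])
  then show "trig_poly (\<lambda>t. of_real (sin t))"
    using trig_poly_add[OF trig_poly_expo[of "-\<i>/2" 1] trig_poly_expo[of "\<i>/2" "-1"]] by simp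
qed

lemma trig_poly_real_polynomial:
  assumes "real_polynomial_function p"
  shows "trig_poly (\<lambda>t. of_real (p (cis t)))"
  using assms
proof (induction rule: real_polynomial_function.induct)
  case (linear f)
  interpret bounded_linear f by fact
  have "f (cis t) = cos t * f 1 + sin t * f \<i>" for t
  proof -
    have "cis t = cos t *\<^sub>R 1 + sin t *\<^sub>R \<i>" by (simp add: complex_eq_iff)
    then show ?thesis by (simp add: add scaleR)
  qed
  then show ?case
    using trig_poly_add[OF trig_poly_mult[OF trig_poly_cos_sin(1) trig_poly_const[of "of_real (f 1)"]]
       trig_poly_mult[OF trig_poly_cos_sin(2) trig_poly_const[of "of_real (f \<i>)"]]] by simp
next
  case (const c)
  then show ?case by (rule trig_poly_const)
next
  case (add f g)
  then show ?case using trig_poly_add by fastforce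
next
  case (mult f g)
  then show ?case using trig_poly_mult by fastforce
qed

text \<open>Stone-Weierstrass on the unit circle: real polynomials evaluated at \<open>cis t\<close>
  are polynomials in \<open>cos t\<close> and \<open>sin t\<close>, hence trigonometric
  polynomials.\<close>

lemma trig_poly_uniform_approx:
  assumes "continuous_on (sphere 0 1) h" "0 < e"
  obtains T where "trig_poly T" "\<And>t. cmod (h (cis t) - T t) < e"
proof -
  obtain g where g: "polynomial_function g" "\<And>x. x \<in> sphere 0 1 \<Longrightarrow> cmod (h x - g x) < e"
    using Stone_Weierstrass_polynomial_function[OF compact_sphere assms] by blast
  have "real_polynomial_function (Re \<circ> g)" "real_polynomial_function (Im \<circ> g)"
    using g(1) bounded_linear_Re bounded_linear_Im unfolding polynomial_function_def by blast+
  then have "trig_poly (\<lambda>t. of_real (Re (g (cis t))) + \<i> * of_real (Im (g (cis t))))"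
    using trig_poly_add[OF trig_poly_real_polynomial trig_poly_mult[OF trig_poly_const[of \<i>] trig_poly_real_polynomial]]
    by fastforce
  then have "trig_poly (\<lambda>t. g (cis t))" by (simp flip: complex_eq)
  moreover have "cmod (h (cis t) - g (cis t)) < e" for t by (rule g(2)) simp
  ultimately show thesis by (rule that)
qed

section \<open>Density of the trigonometric polynomials\<close>

lemma l2_norm_tendsto_zero:
  assumes f: "\<And>k. f k \<in> borel_measurable L2meas" and g: "integrable L2meas (\<lambda>t. (g t)\<^sup>2)"
    and bound: "\<And>k t. t \<in> {-pi<..<pi} \<Longrightarrow> cmod (f k t) \<le> g t"
    and lim: "AE t in L2meas. (\<lambda>k. f k t) \<longlonglongrightarrow> 0"
  shows "(\<lambda>k. l2_norm (f k)) \<longlonglongrightarrow> 0"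
proof -
  have "(\<lambda>k. LINT t|L2meas. (cmod (f k t))\<^sup>2) \<longlonglongrightarrow> (LINT t|L2meas. 0)"
  proof (rule integral_dominated_convergence[where w = "\<lambda>t. (g t)\<^sup>2"])
    show "(\<lambda>t. (cmod (f k t))\<^sup>2) \<in> borel_measurable L2meas" for k using f[of k] by measurable
    show "AE t in L2meas. (\<lambda>k. (cmod (f k t))\<^sup>2) \<longlonglongrightarrow> 0"
      using lim by eventually_elim (auto intro!: tendsto_eq_intros)
    show "AE t in L2meas. norm ((cmod (f k t))\<^sup>2) \<le> (g t)\<^sup>2" for k
      using bound by (intro AE_I2) (simp add: power_mono)
  qed (use g in auto)
  then have "(\<lambda>k. sqrt (LINT t|L2meas. (cmod (f k t))\<^sup>2)) \<longlonglongrightarrow> sqrt 0"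
    by (intro tendsto_real_sqrt) simp
  then show ?thesis by (simp add: l2_norm_def)
qed

lemma truncation_approx:
  assumes "f \<in> L2" "0 < e"
  obtains g B where "g \<in> borel_measurable L2meas" "\<And>t. cmod (g t) \<le> B" "l2_dist f g < e" "0 < B"
proof -
  have [measurable]: "f \<in> borel_measurable L2meas" using assms(1) by (rule L2_measurable)
  define g where "g k t = (if cmod (f t) \<le> real k then f t else 0)" for k :: nat and t
  have g[measurable]: "g k \<in> borel_measurable L2meas" for k unfolding g_def by measurable
  have "(\<lambda>k. l2_norm (\<lambda>t. f t - g k t)) \<longlonglongrightarrow> 0"
  proof (rule l2_norm_tendsto_zero[where g = "\<lambda>t. cmod (f t)"])
    show "(\<lambda>t. f t - g k t) \<in> borel_measurable L2meas" for k by measurable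
    show "integrable L2meas (\<lambda>t. (cmod (f t))\<^sup>2)" using assms(1) by (rule L2_integrable)
    show "cmod (f t - g k t) \<le> cmod (f t)" for k t by (simp add: g_def)
    have "(\<lambda>k. f t - g k t) \<longlonglongrightarrow> 0" for t
    proof (rule tendsto_eventually)
      obtain N :: nat where "cmod (f t) \<le> real N" using real_arch_simple by blast
      then show "\<forall>\<^sub>F k in sequentially. f t - g k t = 0"
        by (intro eventually_sequentiallyI[of N]) (auto simp: g_def)
    qed
    then show "AE t in L2meas. (\<lambda>k. f t - g k t) \<longlonglongrightarrow> 0" by simp
  qed
  then have "\<forall>\<^sub>F k in sequentially. l2_norm (\<lambda>t. f t - g k t) < e" using assms(2) by (rule order_tendstoD)
  then obtain k where k: "l2_dist f (g k) < e" unfolding l2_dist_norm using eventually_happens by force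
  show thesis
  proof (rule that[of "g k" "real k + 1"])
    show "cmod (g k t) \<le> real k + 1" for t by (simp add: g_def)
  qed (use g k in auto)
qed

text \<open>Continuous retraction onto the closed disc of radius \<open>B\<close>. It gives
  continuous approximants the uniform bound that dominated convergence requires and leaves their
  pointwise limit unchanged.\<close>

definition radial_clamp :: "real \<Rightarrow> complex \<Rightarrow> complex" where
  "radial_clamp B z = of_real (B / max B (cmod z)) * z"

lemma radial_clamp:
  assumes "0 < B"
  shows "continuous_on UNIV (radial_clamp B)" "cmod (radial_clamp B z) \<le> B" "cmod z \<le> B \<Longrightarrow> radial_clamp B z = z"
proof -
  have pos: "0 < max B (cmod z)" for z using assms by simp
  show "continuous_on UNIV (radial_clamp B)" unfolding radial_clamp_def
    using pos by (intro continuous_intros) (metis less_irrefl)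
  have "cmod (radial_clamp B z) = B / max B (cmod z) * cmod z"
    unfolding radial_clamp_def norm_mult norm_of_real using pos[of z] assms by simp
  also have "\<dots> \<le> B" using pos[of z] assms by (simp add: pos_divide_le_eq)
  finally show "cmod (radial_clamp B z) \<le> B" .
  show "radial_clamp B z = z" if "cmod z \<le> B" using that assms by (simp add: radial_clamp_def max_absorb1)
qed

text \<open>On the circle \<open>Arg\<close> jumps only at -1; there the cutoff vanishes while
  \<open>c\<close> stays bounded.\<close>

lemma continuous_on_circle_cutoff:
  fixes c :: "real \<Rightarrow> complex"
  assumes c: "continuous_on UNIV c" "\<And>t. cmod (c t) \<le> B"
  shows "continuous_on (sphere 0 1) (\<lambda>z. of_real (min 1 (k * (1 + Re z))) * c (Arg z))"
proof -
  have "isCont (\<lambda>z. of_real (min 1 (k * (1 + Re z))) * c (Arg z)) z" if z: "z \<in> sphere 0 1" "z \<noteq> - 1" for z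
  proof -
    have "z \<notin> \<real>\<^sub>\<le>\<^sub>0"
    proof
      assume "z \<in> \<real>\<^sub>\<le>\<^sub>0"
      then have "Im z = 0" "Re z \<le> 0" by (auto simp: complex_nonpos_Reals_iff)
      then have "z = of_real (Re z)" by (simp add: complex_eq_iff)
      then have "\<bar>Re z\<bar> = 1" using z(1) by (metis dist_0_norm mem_sphere norm_of_real)
      then show False using \<open>Re z \<le> 0\<close> \<open>z = of_real (Re z)\<close> z(2) by (metis abs_of_nonpos minus_equation_iff of_real_1 of_real_minus)
    qed
    then have "isCont Arg z" by (rule continuous_at_Arg)
    moreover have "isCont c (Arg z)" using c(1) by (simp add: continuous_on_eq_continuous_at)
    ultimately have "isCont (\<lambda>z. c (Arg z)) z" by (rule isCont_o2)
    then show ?thesis by (intro continuous_intros linear_continuous_at[OF bounded_linear_Re])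
  qed
  moreover have "isCont (\<lambda>z. of_real (min 1 (k * (1 + Re z))) * c (Arg z)) (- 1)"
  proof -
    have "((\<lambda>z. of_real (min 1 (k * (1 + Re z))) * c (Arg z)) \<longlongrightarrow> 0) (at (- 1))"
    proof (rule Lim_null_comparison)
      show "\<forall>\<^sub>F z in at (- 1). norm (of_real (min 1 (k * (1 + Re z))) * c (Arg z)) \<le> \<bar>min 1 (k * (1 + Re z))\<bar> * B"
        using c(2) by (intro always_eventually) (auto simp: norm_mult intro!: mult_left_mono)
      have "((\<lambda>z. \<bar>min 1 (k * (1 + Re z))\<bar> * B) \<longlongrightarrow> \<bar>min 1 (k * (1 + Re (- 1)))\<bar> * B) (at (- 1))"
        by (intro tendsto_intros)
      then show "((\<lambda>z. \<bar>min 1 (k * (1 + Re z))\<bar> * B) \<longlongrightarrow> 0) (at (- 1))" by simp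
    qed
    then show ?thesis by (simp add: isCont_def)
  qed
  ultimately show ?thesis
    by (metis (no_types, lifting) continuous_at_imp_continuous_on)
qed

text \<open>A continuous function on the interval may differ at the two ends and then does not live
  on the circle. The cutoff \<open>min 1 (n * (1 + cos t))\<close> vanishes at both ends and tends
  to 1 inside. Three approximations cost \<open>e/3\<close> each: truncation, cut-off continuous
  function, trigonometric polynomial.\<close>

theorem trig_system_complete:
  assumes "f \<in> L2"
  shows "in_closed_span (\<lambda>m::int. expo (of_int m)) UNIV f"
  unfolding in_closed_span_def
proof (intro allI impI)
  fix e :: real assume e: "0 < e"
  obtain g B where g: "g \<in> borel_measurable L2meas" "\<And>t. cmod (g t) \<le> B" "l2_dist f g < e/3" "0 < B"
    using truncation_approx[OF assms, of "e/3"] e by auto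
  have gL2: "g \<in> L2" using g by (intro L2_bounded)
  have "g measurable_on {-pi<..<pi}" using g(1) by (subst measurable_on_iff_borel_measurable) auto
  then obtain N c where c: "negligible N" "\<And>n. continuous_on UNIV (c n)"
    "\<And>x. x \<notin> N \<Longrightarrow> (\<lambda>n. c n x) \<longlonglongrightarrow> (if x \<in> {-pi<..<pi} then g x else 0)"
    unfolding measurable_on_def by blast
  define h where "h n t = radial_clamp B (c n t)" for n and t :: real
  have h: "continuous_on UNIV (h n)" "cmod (h n t) \<le> B" for n t
    unfolding h_def using radial_clamp[OF g(4)] c(2)[of n]
    by (auto intro: continuous_on_compose2[of UNIV])
  define q where "q n t = of_real (min 1 (real n * (1 + cos t))) * h n t" for n t
  have q: "continuous_on UNIV (q n)" for n unfolding q_def by (intro continuous_intros h)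
  have qB: "cmod (q n t) \<le> B" for n t
  proof -
    have "0 \<le> 1 + cos t" using cos_ge_minus_one[of t] by linarith
    then have "\<bar>min 1 (real n * (1 + cos t))\<bar> \<le> 1" by simp
    then have "\<bar>min 1 (real n * (1 + cos t))\<bar> * cmod (h n t) \<le> 1 * B" using h(2) g(4) by (intro mult_mono) auto
    then show ?thesis by (simp add: q_def norm_mult)
  qed
  have [measurable]: "q n \<in> borel_measurable L2meas" "g \<in> borel_measurable L2meas" for n
    using q g(1) by (auto intro: continuous_L2meas)
  have "(\<lambda>n. l2_norm (\<lambda>t. g t - q n t)) \<longlonglongrightarrow> 0"
  proof (rule l2_norm_tendsto_zero[where g = "\<lambda>t. 2 * B"])
    show "(\<lambda>t. g t - q k t) \<in> borel_measurable L2meas" for k by measurable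
    show "integrable L2meas (\<lambda>t. (2 * B)\<^sup>2)" using finite_L2meas by (simp add: finite_measure.integrable_const)
    show "cmod (g t - q k t) \<le> 2 * B" for k t using norm_triangle_ineq4[of "g t" "q k t"] g(2)[of t] qB[of k t] by linarith
    have "(\<lambda>k. g t - q k t) \<longlonglongrightarrow> 0" if t: "t \<in> {-pi<..<pi}" "t \<notin> N" for t
    proof -
      have "(\<lambda>n. c n t) \<longlonglongrightarrow> g t" using c(3)[of t] t by simp
      then have "(\<lambda>n. h n t) \<longlonglongrightarrow> radial_clamp B (g t)" unfolding h_def
        using radial_clamp(1)[OF g(4)] by (intro isCont_tendsto_compose[of _ "radial_clamp B"]) (auto simp: continuous_on_eq_continuous_at)
      then have 1: "(\<lambda>n. h n t) \<longlonglongrightarrow> g t" using radial_clamp(3)[OF g(4) g(2)] by simp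
      have "0 < 1 + cos t"
      proof -
        have "cos pi < cos \<bar>t\<bar>" using t(1) by (intro cos_monotone_0_pi) auto
        then show ?thesis by simp
      qed
      then obtain M :: nat where M: "1 < real M * (1 + cos t)" using reals_Archimedean3 by blast
      have "(\<lambda>n. complex_of_real (min 1 (real n * (1 + cos t)))) \<longlonglongrightarrow> of_real 1"
      proof (rule tendsto_eventually, rule eventually_sequentiallyI[of M])
        fix n assume "M \<le> n"
        then have "real M * (1 + cos t) \<le> real n * (1 + cos t)" using \<open>0 < 1 + cos t\<close> by (intro mult_right_mono) auto
        then show "complex_of_real (min 1 (real n * (1 + cos t))) = of_real 1" using M by simp
      qed
      from tendsto_mult[OF this 1] have "(\<lambda>n. q n t) \<longlonglongrightarrow> g t" unfolding q_def by simp
      from tendsto_diff[OF tendsto_const[of "g t"] this] show ?thesis by simp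
    qed
    moreover have "AE t in L2meas. t \<notin> N"
    proof -
      have "N \<in> null_sets lebesgue" using c(1) by (simp add: negligible_iff_null_sets)
      then have "AE t in lebesgue. t \<notin> N" by (rule AE_not_in)
      then show ?thesis by (subst AE_restrict_space_iff) (auto elim: eventually_mono)
    qed
    ultimately show "AE t in L2meas. (\<lambda>k. g t - q k t) \<longlonglongrightarrow> 0"
      by (auto elim!: eventually_mono[OF eventually_conj[OF _ AE_space]] simp: conj_commute)
  qed
  then have "\<forall>\<^sub>F n in sequentially. l2_norm (\<lambda>t. g t - q n t) < e/3" using e by (intro order_tendstoD) auto
  then obtain n where n: "l2_dist g (q n) < e/3" unfolding l2_dist_norm using eventually_happens by force
  have e': "0 < e / (3 * (sqrt (2 * pi) + 1))" using e by (simp add: add_nonneg_pos)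
  obtain T where T: "trig_poly T" "\<And>t. cmod (of_real (min 1 (real n * (1 + Re (cis t)))) * h n (Arg (cis t)) - T t) < e / (3 * (sqrt (2 * pi) + 1))"
    using trig_poly_uniform_approx[OF continuous_on_circle_cutoff[OF h(1)[of n] h(2)[of n], of "real n"] e'] by blast
  obtain J d where J: "finite (J :: int set)" "\<And>t. T t = (\<Sum>m\<in>J. d m * expo (of_int m) t)"
    using T(1) unfolding trig_poly_def by blast
  have TL: "T \<in> L2"
  proof -
    have "(\<lambda>t. \<Sum>m\<in>J. d m * expo (of_int m) t) \<in> L2" by (intro L2_sum L2_scale) auto
    then show ?thesis using J(2) by (metis (no_types, lifting) ext)
  qed
  have qT: "l2_dist (q n) T < e/3"
  proof -
    have "l2_norm (\<lambda>t. q n t - T t) \<le> e / (3 * (sqrt (2 * pi) + 1)) * sqrt (2 * pi)"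
    proof (rule l2_norm_bounded)
      show "(\<lambda>t. q n t - T t) \<in> borel_measurable L2meas" using L2_measurable[OF TL] by measurable
      fix t assume "t \<in> {-pi<..<pi}"
      then have "Arg (cis t) = t" by (intro Arg_cis) auto
      then show "cmod (q n t - T t) \<le> e / (3 * (sqrt (2 * pi) + 1))" using T(2)[of t] by (simp add: q_def)
    qed (use e' in simp)
    also have "\<dots> < e / (3 * (sqrt (2 * pi) + 1)) * (sqrt (2 * pi) + 1)"
      using e' by (intro mult_strict_left_mono) auto
    also have "\<dots> = e/3"
    proof -
      have "sqrt (2 * pi) + 1 \<noteq> 0" by (metis add_nonneg_eq_0_iff pi_ge_zero real_sqrt_ge_zero zero_le_mult_iff zero_le_numeral zero_le_one zero_neq_one)
      moreover have "e / (3 * u) * u = e / 3" if "u \<noteq> 0" for u :: real using that by simp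
      ultimately show ?thesis by blast
    qed
    finally show ?thesis by (simp add: l2_dist_norm)
  qed
  have qL: "q n \<in> L2" using qB by (intro L2_bounded) auto
  have "l2_dist f T < e"
    using l2_dist_triangle[OF assms gL2 TL] l2_dist_triangle[OF gL2 qL TL] g(3) n qT by linarith
  then show "\<exists>J c. finite J \<and> J \<subseteq> (UNIV :: int set) \<and> l2_dist f (\<lambda>t. \<Sum>n\<in>J. c n * expo (of_int n) t) < e"
    using J by (intro exI[of _ J] exI[of _ d]) (simp add: l2_dist_def)
qed

subsection \<open>The exponential system\<close>

lemma in_closed_spanE:
  assumes "in_closed_span F I f" "0 < \<epsilon>"
  obtains J c where "finite J" "J \<subseteq> I" "l2_dist f (\<lambda>t. \<Sum>n\<in>J. c n * F n t) < \<epsilon>"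
  using assms unfolding in_closed_span_def by blast

lemma inverse_Suc_mult_less_one: "0 \<le> u \<Longrightarrow> 1 / (u + 1) * u < 1" for u :: real
  by (simp add: add_nonneg_pos)

text \<open>Pairing with \<open>G m\<close> annihilates every other member and gives 1 on
  \<open>F m\<close>, which keeps \<open>F m\<close> away from their span.\<close>

lemma biorthogonal_minimal:
  assumes F: "\<And>n. F n \<in> L2" and G: "biorthogonal F G"
  shows "l2_minimal F UNIV"
  unfolding l2_minimal_def
proof (intro conjI ballI F)
  fix m
  have GL: "G n \<in> L2" for n using G by (simp add: biorthogonal_def)
  have FG: "l2_inner (F k) (G n) = (if k = n then 1 else 0)" for k n using G by (simp add: biorthogonal_def)
  show "\<not> in_closed_span F (UNIV - {m}) (F m)"
  proof
    assume "in_closed_span F (UNIV - {m}) (F m)"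
    moreover have "0 < 1 / (l2_norm (G m) + 1)" by (simp add: add_nonneg_pos)
    ultimately obtain J c where J: "finite J" "J \<subseteq> UNIV - {m}" "l2_dist (F m) (\<lambda>t. \<Sum>n\<in>J. c n * F n t) < 1 / (l2_norm (G m) + 1)"
      by (rule in_closed_spanE)
    let ?s = "\<lambda>t. \<Sum>n\<in>J. c n * F n t"
    have s: "?s \<in> L2" by (intro L2_sum L2_scale F)
    have "l2_inner ?s (G m) = (\<Sum>n\<in>J. c n * l2_inner (F n) (G m))" by (intro l2_inner_sum_left F GL)
    also have "\<dots> = 0" using J(2) by (intro sum.neutral) (auto simp: FG)
    finally have "l2_inner (\<lambda>t. F m t - ?s t) (G m) = 1" by (simp add: l2_inner_diff_left F s GL FG)
    then have "1 \<le> l2_dist (F m) ?s * l2_norm (G m)"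
      using l2_Cauchy_Schwarz[OF L2_diff[OF F[of m] s] GL[of m]] by (simp add: l2_dist_norm)
    also have "\<dots> \<le> 1 / (l2_norm (G m) + 1) * l2_norm (G m)" using J(3) by (intro mult_right_mono) auto
    also have "\<dots> < 1" by (rule inverse_Suc_mult_less_one) simp
    finally show False by simp
  qed
qed

text \<open>The projection \<open>P\<close> of \<open>u\<close> satisfies
  \<open>l2_inner P P = l2_inner u P\<close>, and Cauchy-Schwarz cancels one factor.\<close>

lemma bessel_projection:
  assumes u: "u \<in> L2" and S: "finite (S :: int set)"
  shows "l2_norm (\<lambda>t. \<Sum>m\<in>S. l2_inner u (expo (of_int m)) / (2 * pi) * expo (of_int m) t) \<le> l2_norm u"
proof -
  define P where "P t = (\<Sum>m\<in>S. l2_inner u (expo (of_int m)) / (2 * pi) * expo (of_int m) t)" for t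
  have P: "P \<in> L2" unfolding P_def by (intro L2_sum L2_scale) auto
  have Pm: "l2_inner P (expo (of_int m)) = l2_inner u (expo (of_int m))" if "m \<in> S" for m
  proof -
    have "l2_inner P (expo (of_int m)) = (\<Sum>k\<in>S. l2_inner u (expo (of_int k)) / (2 * pi) * l2_inner (expo (of_int k)) (expo (of_int m)))"
      unfolding P_def by (intro l2_inner_sum_left) auto
    also have "\<dots> = (\<Sum>k\<in>S. if k = m then l2_inner u (expo (of_int k)) else 0)"
      by (intro sum.cong refl) (auto simp: l2_inner_expo_int)
    finally show ?thesis using that S by simp
  qed
  have "l2_inner P P = l2_inner u P"
  proof -
    have "l2_inner h P = (\<Sum>m\<in>S. cnj (l2_inner u (expo (of_int m)) / (2 * pi)) * l2_inner h (expo (of_int m)))" if "h \<in> L2" for h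
      unfolding P_def by (intro l2_inner_sum_right that) auto
    then show ?thesis using P u Pm by simp
  qed
  then have "(l2_norm P)\<^sup>2 = cmod (l2_inner u P)" by (metis l2_inner_self norm_of_real abs_of_nonneg zero_le_power2)
  also have "\<dots> \<le> l2_norm u * l2_norm P" by (rule l2_Cauchy_Schwarz[OF u P])
  finally have "l2_norm P * l2_norm P \<le> l2_norm u * l2_norm P" by (simp add: power2_eq_square)
  then have "l2_norm P \<le> l2_norm u"
    using l2_norm_nonneg[of P] by (metis l2_norm_nonneg mult_right_le_imp_le order_le_less)
  then show ?thesis by (simp add: P_def[abs_def])
qed

lemma l2_norm_sum_le:
  assumes "\<And>k. k \<in> S \<Longrightarrow> F k \<in> L2"
  shows "l2_norm (\<lambda>t. \<Sum>k\<in>S. F k t) \<le> (\<Sum>k\<in>S. l2_norm (F k))"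
  using assms
proof (induction S rule: infinite_finite_induct)
  case (insert x S)
  then have "l2_norm (\<lambda>t. F x t + (\<Sum>k\<in>S. F k t)) \<le> l2_norm (F x) + l2_norm (\<lambda>t. \<Sum>k\<in>S. F k t)"
    by (intro l2_norm_triangle L2_sum) auto
  then show ?case using insert by simp
qed (simp_all add: l2_norm_def)

lemma sqrt_2pi_le: "sqrt (2 * pi) \<le> 2 * pi"
proof -
  have "1 \<le> 2 * pi" using pi_gt3 by linarith
  then have "sqrt (2 * pi) * 1 \<le> sqrt (2 * pi) * sqrt (2 * pi)" by (intro mult_left_mono) auto
  then show ?thesis by simp
qed

text \<open>A trigonometric polynomial near \<open>D\<close> is stripped of its frequencies in
  \<open>R\<close>. The coefficients removed are those of \<open>D\<close>, which are summably
  small, minus those of the approximation error, which Bessel's inequality controls. No infinite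
  Fourier expansion of \<open>D\<close> is involved.\<close>

lemma approx_off_frequencies:
  fixes R :: "int set"
  assumes D: "D \<in> L2" and C: "\<And>S. finite S \<Longrightarrow> S \<subseteq> R \<Longrightarrow> (\<Sum>m\<in>S. cmod (l2_inner D (expo (of_int m)))) \<le> C"
    and "0 < \<delta>"
  obtains h where "h \<in> L2" "in_closed_span (\<lambda>m. expo (of_int m)) (- R) h" "l2_dist D h \<le> \<delta> + C"
proof -
  obtain J c where J: "finite J" "l2_dist D (\<lambda>t. \<Sum>m\<in>J. c m * expo (of_int m) t) < \<delta>/2"
    using trig_system_complete[OF D] \<open>0 < \<delta>\<close> unfolding in_closed_span_def by (meson half_gt_zero)
  define T where "T t = (\<Sum>m\<in>J. c m * expo (of_int m) t)" for t
  define h where "h t = (\<Sum>m\<in>J - R. c m * expo (of_int m) t)" for t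
  define Q where "Q t = (\<Sum>m\<in>J \<inter> R. c m * expo (of_int m) t)" for t
  have T: "T \<in> L2" and h: "h \<in> L2" and Q: "Q \<in> L2" unfolding T_def h_def Q_def by (intro L2_sum L2_scale; simp)+
  have ThQ: "T t = h t + Q t" for t
    unfolding T_def h_def Q_def using sum.Int_Diff[OF J(1), of "\<lambda>m. c m * expo (of_int m) t" R] by simp
  define u where "u t = D t - T t" for t
  have u: "u \<in> L2" unfolding u_def using D T by blast
  have un: "l2_norm u < \<delta>/2" using J(2) by (simp add: u_def[abs_def] l2_dist_norm T_def)
  have cm: "c m = l2_inner D (expo (of_int m)) / (2 * pi) - l2_inner u (expo (of_int m)) / (2 * pi)" if "m \<in> J" for m
  proof -
    have "l2_inner T (expo (of_int m)) = (\<Sum>k\<in>J. c k * l2_inner (expo (of_int k)) (expo (of_int m)))"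
      unfolding T_def by (intro l2_inner_sum_left) auto
    also have "\<dots> = (\<Sum>k\<in>J. if k = m then c k * (2 * pi) else 0)"
      by (intro sum.cong refl) (auto simp: l2_inner_expo_int)
    finally have "l2_inner T (expo (of_int m)) = c m * (2 * pi)" using that J(1) by simp
    moreover have "l2_inner u (expo (of_int m)) = l2_inner D (expo (of_int m)) - l2_inner T (expo (of_int m))"
      unfolding u_def using D T by (intro l2_inner_diff_left) auto
    ultimately show ?thesis by (simp add: field_simps)
  qed
  define A where "A t = (\<Sum>m\<in>J \<inter> R. l2_inner D (expo (of_int m)) / (2 * pi) * expo (of_int m) t)" for t
  define B where "B t = (\<Sum>m\<in>J \<inter> R. l2_inner u (expo (of_int m)) / (2 * pi) * expo (of_int m) t)" for t
  have AB: "A \<in> L2" "B \<in> L2" unfolding A_def B_def by (intro L2_sum L2_scale; simp)+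
  have QAB: "Q t = A t - B t" for t
    unfolding Q_def A_def B_def by (simp add: cm left_diff_distrib flip: sum_subtractf)
  have Bn: "l2_norm B \<le> l2_norm u" unfolding B_def[abs_def] using J(1) by (intro bessel_projection u) simp
  have An: "l2_norm A \<le> C"
  proof -
    have "l2_norm A \<le> (\<Sum>m\<in>J \<inter> R. l2_norm (\<lambda>t. l2_inner D (expo (of_int m)) / (2 * pi) * expo (of_int m) t))"
      unfolding A_def by (intro l2_norm_sum_le L2_scale) auto
    also have "\<dots> \<le> (\<Sum>m\<in>J \<inter> R. cmod (l2_inner D (expo (of_int m))))"
    proof (intro sum_mono)
      fix m
      have "l2_norm (\<lambda>t. l2_inner D (expo (of_int m)) / (2 * pi) * expo (of_int m) t)
        = cmod (l2_inner D (expo (of_int m))) * (sqrt (2 * pi) / (2 * pi))"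
        unfolding l2_norm_scale by (simp add: norm_divide norm_mult)
      also have "\<dots> \<le> cmod (l2_inner D (expo (of_int m))) * 1"
        using sqrt_2pi_le by (intro mult_left_mono) (auto simp: pos_divide_le_eq)
      finally show "l2_norm (\<lambda>t. l2_inner D (expo (of_int m)) / (2 * pi) * expo (of_int m) t) \<le> cmod (l2_inner D (expo (of_int m)))" by simp
    qed
    also have "\<dots> \<le> C" using J(1) by (intro C) auto
    finally show ?thesis .
  qed
  have "D t - h t = (u t + A t) + (-1) * B t" for t using ThQ[of t] QAB[of t] by (simp add: u_def)
  then have "l2_dist D h = l2_norm (\<lambda>t. (u t + A t) + (-1) * B t)" by (simp only: l2_dist_norm)
  also have "\<dots> \<le> l2_norm (\<lambda>t. u t + A t) + l2_norm (\<lambda>t. (-1) * B t)"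
    using u AB by (intro l2_norm_triangle L2_add L2_scale)
  also have "\<dots> \<le> l2_norm u + l2_norm A + l2_norm B"
    using l2_norm_triangle[OF u AB(1)] l2_norm_scale[of "-1" B] by simp
  also have "\<dots> \<le> \<delta> + C" using un An Bn by linarith
  finally have "l2_dist D h \<le> \<delta> + C" .
  moreover have "in_closed_span (\<lambda>m. expo (of_int m)) (- R) h"
    unfolding h_def by (intro in_closed_span_sum in_closed_span_scale in_closed_span_base) auto
  ultimately show thesis using that h by blast
qed

context cauchy_system
begin

section \<open>Signed exponentials and absolutely convergent series\<close>

definition sg :: "nat \<Rightarrow> real" where "sg i = cos (pi * of_int (b i))"

text \<open>With the sign of parity \<open>b i\<close> absorbed, the inner products with
  \<open>expo (a n)\<close> form a Cauchy matrix up to the row factor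
  \<open>2 * sin (pi * a n)\<close>.\<close>

definition pexp :: "nat \<Rightarrow> real \<Rightarrow> complex" where
  "pexp i t = of_real (sg i) * expo (of_int (b i)) t"

definition series :: "(nat \<Rightarrow> real) \<Rightarrow> real \<Rightarrow> complex" where
  "series y t = (\<Sum>i. of_real (y i) * pexp i t)"

lemma sg_cases: "sg i = 1 \<or> sg i = - 1"
  by (simp add: sg_def cos_npi_int)

lemma sg_square: "sg i * sg i = 1" "\<bar>sg i\<bar> = 1"
  using sg_cases[of i] by auto

lemma norm_pexp [simp]: "cmod (pexp i t) = 1"
  by (simp add: pexp_def norm_mult sg_square)

lemma pexp_L2 [simp, intro]: "pexp i \<in> L2"
  unfolding pexp_def by (intro L2_scale expo_L2)

lemma expo_pexp: "expo (of_int (b i)) t = of_real (sg i) * pexp i t"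
  unfolding pexp_def using sg_square(1)[of i] by (metis mult.assoc mult_1 of_real_1 of_real_mult)

lemma l2_norm_pexp [simp]: "l2_norm (pexp i) = sqrt (2 * pi)"
  unfolding pexp_def l2_norm_scale by (simp add: sg_square)

lemma a_minus_int: "a n - of_int m \<noteq> 0"
  using a_nonint[of n] by (metis Ints_of_int eq_iff_diff_eq_0)

lemma sin_a: "sin (pi * a n) \<noteq> 0"
  using a_nonint[of n] by (metis sin_times_pi_eq_0 mult.commute)

lemma inner_a_int:
  "l2_inner (expo (a n)) (expo (of_int m)) = of_real (2 * sin (pi * a n) * cos (pi * of_int m) / (a n - of_int m))"
proof -
  have "sin (pi * of_int m) = 0" by (metis Ints_of_int sin_times_pi_eq_0 mult.commute)
  then have "sin (pi * (a n - of_int m)) = sin (pi * a n) * cos (pi * of_int m)"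
    by (simp add: right_diff_distrib sin_diff)
  then show ?thesis using a_minus_int[of n m] by (simp add: l2_inner_expo)
qed

lemma inner_a_pexp: "l2_inner (expo (a n)) (pexp i) = of_real (2 * sin (pi * a n) / (a n - of_int (b i)))"
proof -
  have "l2_inner (expo (a n)) (pexp i) = of_real (sg i * (2 * sin (pi * a n) * sg i / (a n - of_int (b i))))"
    unfolding pexp_def l2_inner_scale_right inner_a_int sg_def by simp
  also have "sg i * (2 * sin (pi * a n) * sg i / (a n - of_int (b i))) = 2 * sin (pi * a n) / (a n - of_int (b i)) * (sg i * sg i)"
    by simp
  finally show ?thesis by (simp add: sg_square)
qed

lemma inner_int_pexp: "l2_inner (expo (of_int m)) (pexp i) = (if m = b i then of_real (2 * pi * sg i) else 0)"
  unfolding pexp_def l2_inner_scale_right l2_inner_expo_int by simp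

lemma inner_pexp_pexp: "l2_inner (pexp j) (pexp i) = (if i = j then 2 * pi else 0)"
proof -
  have "l2_inner (pexp j) (pexp i) = of_real (sg j) * l2_inner (expo (of_int (b j))) (pexp i)"
    unfolding pexp_def[of j] by (rule l2_inner_scale_left)
  also have "\<dots> = (if i = j then of_real (sg j * sg j) * (2 * pi) else 0)"
    using b_inj by (auto simp: inner_int_pexp inj_def)
  finally show ?thesis by (simp add: sg_square)
qed

lemma series_summable: "summable (\<lambda>i. \<bar>y i\<bar>) \<Longrightarrow> summable (\<lambda>i. of_real (y i) * pexp i t)"
  by (rule summable_norm_cancel) (simp add: norm_mult)

lemma pexp_measurable [measurable]: "pexp i \<in> borel_measurable L2meas"
  using pexp_L2 by (rule L2_measurable)

lemma series_measurable [measurable]: "series y \<in> borel_measurable L2meas"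
  unfolding series_def[abs_def] by measurable

lemma series_bound: "summable (\<lambda>i. \<bar>y i\<bar>) \<Longrightarrow> cmod (series y t) \<le> (\<Sum>i. \<bar>y i\<bar>)"
  unfolding series_def using summable_norm[of "\<lambda>i. of_real (y i) * pexp i t"] by (simp add: norm_mult)

lemma series_L2: "summable (\<lambda>i. \<bar>y i\<bar>) \<Longrightarrow> series y \<in> L2"
  using series_bound series_measurable by (intro L2_bounded)

lemma series_norm:
  assumes "summable (\<lambda>i. \<bar>y i\<bar>)"
  shows "l2_norm (series y) \<le> (\<Sum>i. \<bar>y i\<bar>) * (2 * pi)"
proof -
  have "l2_norm (series y) \<le> (\<Sum>i. \<bar>y i\<bar>) * sqrt (2 * pi)"
    by (intro l2_norm_bounded series_bound assms series_measurable suminf_nonneg) auto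
  also have "\<dots> \<le> (\<Sum>i. \<bar>y i\<bar>) * (2 * pi)" by (intro mult_left_mono sqrt_2pi_le suminf_nonneg assms) auto
  finally show ?thesis .
qed

lemma series_add:
  assumes "summable (\<lambda>i. \<bar>x i\<bar>)" "summable (\<lambda>i. \<bar>y i\<bar>)"
  shows "series (\<lambda>i. x i + y i) t = series x t + series y t"
  unfolding series_def
  using suminf_add[OF series_summable[OF assms(1), of t] series_summable[OF assms(2), of t]]
  by (simp add: distrib_right)

lemma series_sum:
  assumes "\<And>n. n \<in> S \<Longrightarrow> summable (\<lambda>i. \<bar>y n i\<bar>)"
  shows "(\<Sum>n\<in>S. of_real (\<alpha> n) * series (y n) t) = series (\<lambda>i. \<Sum>n\<in>S. \<alpha> n * y n i) t"
proof -
  have "series (\<lambda>i. \<Sum>n\<in>S. \<alpha> n * y n i) t = (\<Sum>i. \<Sum>n\<in>S. of_real (\<alpha> n) * (of_real (y n i) * pexp i t))"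
    unfolding series_def by (simp add: sum_distrib_right mult.assoc)
  also have "\<dots> = (\<Sum>n\<in>S. \<Sum>i. of_real (\<alpha> n) * (of_real (y n i) * pexp i t))"
    by (intro suminf_sum summable_mult series_summable assms)
  also have "\<dots> = (\<Sum>n\<in>S. of_real (\<alpha> n) * series (y n) t)"
    unfolding series_def by (intro sum.cong refl suminf_mult series_summable assms)
  finally show ?thesis by simp
qed

lemma series_single: "series (\<lambda>i. if i = j then u else 0) t = of_real u * pexp j t"
proof -
  have "(\<lambda>i. of_real (if i = j then u else 0) * pexp i t) sums (of_real u * pexp j t)"
  proof -
    have "of_real (if i = j then u else 0) * pexp i t = (if i = j then of_real u * pexp i t else 0)" for i by simp
    then show ?thesis using sums_single[of j "\<lambda>i. of_real u * pexp i t"] by presburger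
  qed
  then show ?thesis unfolding series_def by (rule sums_unique[symmetric])
qed

lemma series_partial:
  assumes "summable (\<lambda>i. \<bar>y i\<bar>)"
  shows "(\<lambda>n. l2_norm (\<lambda>t. series y t - (\<Sum>i<n. of_real (y i) * pexp i t))) \<longlonglongrightarrow> 0"
proof (rule Lim_null_comparison)
  have "(\<lambda>n. \<Sum>i. \<bar>y (i + n)\<bar>) \<longlonglongrightarrow> 0" by (rule suminf_exist_split2[OF assms])
  then show "(\<lambda>n. (\<Sum>i. \<bar>y (i + n)\<bar>) * (2 * pi)) \<longlonglongrightarrow> 0" by (rule tendsto_mult_left_zero)
  have "norm (l2_norm (\<lambda>t. series y t - (\<Sum>i<n. of_real (y i) * pexp i t))) \<le> (\<Sum>i. \<bar>y (i + n)\<bar>) * (2 * pi)" for n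
  proof -
    have s: "summable (\<lambda>i. \<bar>y (i + n)\<bar>)" using assms by (simp add: summable_iff_shift[of "\<lambda>i. \<bar>y i\<bar>"])
    have "l2_norm (\<lambda>t. series y t - (\<Sum>i<n. of_real (y i) * pexp i t)) \<le> (\<Sum>i. \<bar>y (i + n)\<bar>) * sqrt (2 * pi)"
    proof (rule l2_norm_bounded)
      show "(\<lambda>t. series y t - (\<Sum>i<n. of_real (y i) * pexp i t)) \<in> borel_measurable L2meas" by measurable
      show "0 \<le> (\<Sum>i. \<bar>y (i + n)\<bar>)" using s by (intro suminf_nonneg) auto
      fix t
      have "series y t - (\<Sum>i<n. of_real (y i) * pexp i t) = (\<Sum>i. of_real (y (i + n)) * pexp (i + n) t)"
        unfolding series_def using suminf_split_initial_segment[OF series_summable[OF assms, of t], of n] by simp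
      also have "cmod \<dots> \<le> (\<Sum>i. cmod (of_real (y (i + n)) * pexp (i + n) t))"
        by (rule summable_norm) (use s in \<open>simp add: norm_mult\<close>)
      finally show "cmod (series y t - (\<Sum>i<n. of_real (y i) * pexp i t)) \<le> (\<Sum>i. \<bar>y (i + n)\<bar>)"
        by (simp add: norm_mult)
    qed
    also have "\<dots> \<le> (\<Sum>i. \<bar>y (i + n)\<bar>) * (2 * pi)" by (intro mult_left_mono sqrt_2pi_le suminf_nonneg s) auto
    finally show ?thesis by simp
  qed
  then show "\<forall>\<^sub>F n in sequentially. norm (l2_norm (\<lambda>t. series y t - (\<Sum>i<n. of_real (y i) * pexp i t))) \<le> (\<Sum>i. \<bar>y (i + n)\<bar>) * (2 * pi)"
    by (intro always_eventually) simp
qed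

lemma partial_L2: "(\<lambda>t. \<Sum>i<n. of_real (y i) * pexp i t) \<in> L2"
  by (intro L2_sum L2_scale) auto

lemma inner_series:
  assumes h: "h \<in> L2" and y: "summable (\<lambda>i. \<bar>y i\<bar>)"
  shows "(\<lambda>i. of_real (y i) * l2_inner h (pexp i)) sums l2_inner h (series y)"
  unfolding sums_def
proof (rule LIM_zero_cancel, rule Lim_null_comparison)
  show "(\<lambda>n. l2_norm h * l2_norm (\<lambda>t. series y t - (\<Sum>i<n. of_real (y i) * pexp i t))) \<longlonglongrightarrow> 0"
    by (rule tendsto_mult_right_zero[OF series_partial[OF y]])
  have "norm ((\<Sum>i<n. of_real (y i) * l2_inner h (pexp i)) - l2_inner h (series y))
      \<le> l2_norm h * l2_norm (\<lambda>t. series y t - (\<Sum>i<n. of_real (y i) * pexp i t))" for n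
  proof -
    have "l2_inner h (\<lambda>t. series y t - (\<Sum>i<n. of_real (y i) * pexp i t))
       = l2_inner h (series y) - (\<Sum>i<n. of_real (y i) * l2_inner h (pexp i))"
      using l2_inner_diff_right[OF series_L2[OF y] partial_L2[where y = y and n = n] h]
        l2_inner_sum_right[of "{..<n}" pexp h "\<lambda>i. of_real (y i)"] h by simp
    then show ?thesis
      using l2_Cauchy_Schwarz[OF h L2_diff[OF series_L2[OF y] partial_L2[where y = y and n = n]]]
      by (simp add: norm_minus_commute)
  qed
  then show "\<forall>\<^sub>F n in sequentially. norm ((\<Sum>i<n. of_real (y i) * l2_inner h (pexp i)) - l2_inner h (series y))
      \<le> l2_norm h * l2_norm (\<lambda>t. series y t - (\<Sum>i<n. of_real (y i) * pexp i t))"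
    by (intro always_eventually) simp
qed

lemma inner_pexp_series:
  assumes "summable (\<lambda>i. \<bar>y i\<bar>)"
  shows "l2_inner (pexp j) (series y) = of_real (2 * pi * y j)"
proof -
  have "(\<lambda>i. if i = j then of_real (y i) * (2 * complex_of_real pi) else 0) sums l2_inner (pexp j) (series y)"
  proof -
    have "of_real (y i) * l2_inner (pexp j) (pexp i) = (if i = j then of_real (y i) * (2 * complex_of_real pi) else 0)" for i
      by (simp add: inner_pexp_pexp)
    then show ?thesis using inner_series[OF pexp_L2[of j] assms] by presburger
  qed
  moreover have "(\<lambda>i. if i = j then of_real (y i) * (2 * complex_of_real pi) else 0) sums (of_real (y j) * (2 * complex_of_real pi))"
    using sums_single[of j "\<lambda>i. of_real (y i) * (2 * complex_of_real pi)"] by simp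
  ultimately show ?thesis using sums_unique2 by (fastforce simp: mult.commute)
qed

lemma inner_int_series:
  assumes "summable (\<lambda>i. \<bar>y i\<bar>)" "m \<notin> range b"
  shows "l2_inner (expo (of_int m)) (series y) = 0"
proof -
  have "l2_inner (expo (of_int m)) (pexp i) = 0" for i using assms(2) by (auto simp: inner_int_pexp)
  then have "(\<lambda>i. 0) sums l2_inner (expo (of_int m)) (series y)"
    using inner_series[OF expo_L2[of "of_int m"] assms(1)] by simp
  then show ?thesis by (metis sums_unique2 sums_zero)
qed

lemma inner_a_series:
  assumes "summable (\<lambda>i. \<bar>y i\<bar>)" "(\<lambda>i. y i / (a n - of_int (b i))) sums S"
  shows "l2_inner (expo (a n)) (series y) = of_real (2 * sin (pi * a n) * S)"
proof -
  have "(\<lambda>i. of_real (2 * sin (pi * a n) * (y i / (a n - of_int (b i))))) sums complex_of_real (2 * sin (pi * a n) * S)"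
    by (intro sums_of_real sums_mult assms(2))
  moreover have "complex_of_real (y i) * l2_inner (expo (a n)) (pexp i) = of_real (2 * sin (pi * a n) * (y i / (a n - of_int (b i))))" for i
    by (simp add: inner_a_pexp)
  ultimately show ?thesis using inner_series[OF expo_L2[of "a n"] assms(1)] sums_unique2 by simp
qed

lemma inner_series_series:
  assumes "summable (\<lambda>i. \<bar>x i\<bar>)" "summable (\<lambda>i. \<bar>y i\<bar>)" "(\<lambda>i. x i * y i) sums S"
  shows "l2_inner (series x) (series y) = of_real (2 * pi * S)"
proof -
  have "l2_inner (series x) (pexp i) = of_real (2 * pi * x i)" for i
    using inner_pexp_series[OF assms(1), of i] l2_inner_cnj[of "series x" "pexp i"] by simp
  then have "(\<lambda>i. of_real (2 * pi * (x i * y i))) sums l2_inner (series x) (series y)"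
    using inner_series[OF series_L2[OF assms(1)] assms(2)] by (simp add: mult_ac)
  moreover have "(\<lambda>i. of_real (2 * pi * (x i * y i))) sums complex_of_real (2 * pi * S)"
    by (intro sums_of_real sums_mult assms(3))
  ultimately show ?thesis by (rule sums_unique2)
qed

section \<open>Completeness of the exponentials\<close>

text \<open>The removed integer \<open>b i\<close> becomes the index of the new frequency
  \<open>a i\<close>, so the system stays indexed by all integers.\<close>

definition lam :: "int \<Rightarrow> real" where
  "lam m = (if m \<in> range b then a (inv b m) else of_int m)"

lemma lam_b [simp]: "lam (b i) = a i"
  by (simp add: lam_def b_inj)

lemma lam_other [simp]: "m \<notin> range b \<Longrightarrow> lam m = of_int m"
  by (simp add: lam_def)

definition esys :: "int \<Rightarrow> real \<Rightarrow> complex" where "esys n = expo (lam n)"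

lemma esys_L2 [simp, intro]: "esys n \<in> L2"
  by (simp add: esys_def)

lemma span_expo_a: "in_closed_span esys UNIV (expo (a n))"
  using in_closed_span_base[of "b n" UNIV esys] by (simp add: esys_def)

text \<open>A rational function \<open>F\<close> with \<open>F j = 1\<close>, with
  \<open>F c\<close> close to \<open>- r j / r c\<close> and with small values at the other poles is
  realised as a combination of the new exponentials. Its remaining part lies essentially on
  untouched integers, which belong to the system and can be subtracted.\<close>

lemma span_pexp_pair:
  assumes "j \<noteq> c"
  shows "in_closed_span esys UNIV (\<lambda>t. pexp j t - of_real (r j / r c) * pexp c t)"
proof (rule in_closed_span_limit)
  show "(\<lambda>t. pexp j t - of_real (r j / r c) * pexp c t) \<in> L2" by (intro L2_diff L2_scale) auto
  fix \<epsilon> :: real assume e: "0 < \<epsilon>"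
  \<comment> \<open>The total error is at most \<open>4 * pi * e1 + \<epsilon> / 8\<close>, and
    \<open>4 * pi\<close> is below 16.\<close>
  define e1 where "e1 = \<epsilon> / 32"
  have e1: "0 < e1" using e by (simp add: e1_def)
  obtain K \<alpha> where A: "(\<Sum>n<K. \<alpha> n / (a n - of_int (b j))) = 1 \<and>
       \<bar>(\<Sum>n<K. \<alpha> n / (a n - of_int (b c))) + r j / r c\<bar> < e1 \<and>
       summable (\<lambda>i. if i = j \<or> i = c then 0 else \<bar>\<Sum>n<K. \<alpha> n / (a n - of_int (b i))\<bar> * (1 + \<bar>r i\<bar>)) \<and>
       (\<Sum>i. if i = j \<or> i = c then 0 else \<bar>\<Sum>n<K. \<alpha> n / (a n - of_int (b i))\<bar> * (1 + \<bar>r i\<bar>)) < e1"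
    using approx[OF assms e1] by blast
  define F where "F i = (\<Sum>n<K. \<alpha> n / (a n - of_int (b i)))" for i
  have F: "F j = 1" "\<bar>F c + r j / r c\<bar> < e1"
     "summable (\<lambda>i. if i = j \<or> i = c then 0 else \<bar>F i\<bar> * (1 + \<bar>r i\<bar>))"
     "(\<Sum>i. if i = j \<or> i = c then 0 else \<bar>F i\<bar> * (1 + \<bar>r i\<bar>)) < e1" unfolding F_def using A by blast+
  \<comment> \<open>Dividing by \<open>sin (pi * a n)\<close> removes the row factor of the Cauchy
    matrix.\<close>
  define S where "S t = (\<Sum>n<K. of_real (pi * \<alpha> n / sin (pi * a n)) * expo (a n) t)" for t
  have S: "S \<in> L2" unfolding S_def by (intro L2_sum L2_scale) auto
  have Sp: "l2_inner S (pexp i) = of_real (2 * pi * F i)" for i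
  proof -
    have "l2_inner S (pexp i) = (\<Sum>n<K. of_real (pi * \<alpha> n / sin (pi * a n)) * l2_inner (expo (a n)) (pexp i))"
      unfolding S_def by (intro l2_inner_sum_left) auto
    also have "\<dots> = (\<Sum>n<K. of_real (2 * pi * (\<alpha> n / (a n - of_int (b i)))))"
    proof (intro sum.cong refl)
      fix n
      show "of_real (pi * \<alpha> n / sin (pi * a n)) * l2_inner (expo (a n)) (pexp i) = complex_of_real (2 * pi * (\<alpha> n / (a n - of_int (b i))))"
        unfolding inner_a_pexp of_real_mult[symmetric] using sin_a[of n] by simp
    qed
    finally show ?thesis by (simp add: F_def sum_distrib_left)
  qed
  \<comment> \<open>\<open>D\<close> has no component at the two chosen poles and summably small
    ones at the others, so it is close to the closed span of the untouched integer
    frequencies.\<close>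
  define D where "D t = S t - (pexp j t + of_real (F c) * pexp c t)" for t
  have D: "D \<in> L2" unfolding D_def using S by (intro L2_diff L2_add L2_scale) auto
  have Dp: "l2_inner D (pexp i) = (if i = j \<or> i = c then 0 else of_real (2 * pi * F i))" for i
  proof -
    have "l2_inner D (pexp i) = l2_inner S (pexp i) - (l2_inner (pexp j) (pexp i) + of_real (F c) * l2_inner (pexp c) (pexp i))"
      unfolding D_def using S by (simp add: l2_inner_diff_left l2_inner_add_left l2_inner_scale_left L2_add L2_scale)
    then show ?thesis using assms F(1) by (auto simp: Sp inner_pexp_pexp)
  qed
  have C: "(\<Sum>m\<in>X. cmod (l2_inner D (expo (of_int m)))) \<le> 2 * pi * e1" if X: "finite X" "X \<subseteq> range b" for X
  proof -
    obtain I where I: "X = b ` I" using X(2) by (meson subset_image_iff subset_UNIV)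
    have inj: "inj_on b I" using b_inj inj_on_subset by blast
    have finI: "finite I" using X(1) inj unfolding I by (simp add: finite_image_iff)
    have "cmod (l2_inner D (expo (of_int (b i)))) = 2 * pi * (if i = j \<or> i = c then 0 else \<bar>F i\<bar>)" for i
    proof -
      have "l2_inner D (expo (of_int (b i))) = of_real (sg i) * l2_inner D (pexp i)"
        using l2_inner_scale_right[of D "of_real (sg i)" "pexp i"] by (simp flip: expo_pexp)
      then show ?thesis by (simp add: Dp norm_mult sg_square)
    qed
    then have "(\<Sum>m\<in>X. cmod (l2_inner D (expo (of_int m)))) = 2 * pi * (\<Sum>i\<in>I. if i = j \<or> i = c then 0 else \<bar>F i\<bar>)"
      unfolding I by (simp add: sum.reindex[OF inj] sum_distrib_left)
    also have "(\<Sum>i\<in>I. if i = j \<or> i = c then 0 else \<bar>F i\<bar>) \<le> (\<Sum>i\<in>I. if i = j \<or> i = c then 0 else \<bar>F i\<bar> * (1 + \<bar>r i\<bar>))"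
      by (intro sum_mono) (simp add: distrib_left)
    also have "\<dots> \<le> (\<Sum>i. if i = j \<or> i = c then 0 else \<bar>F i\<bar> * (1 + \<bar>r i\<bar>))"
      using finI F(3) by (intro sum_le_suminf) auto
    also have "\<dots> \<le> e1" using F(4) by simp
    finally show ?thesis by simp
  qed
  obtain h where h: "h \<in> L2" "in_closed_span (\<lambda>m. expo (of_int m)) (- range b) h" "l2_dist D h \<le> \<epsilon> / 8 + 2 * pi * e1"
    by (rule approx_off_frequencies[OF D C, where \<delta> = "\<epsilon> / 8"]) (use e in auto)
  have hs: "in_closed_span esys UNIV h"
  proof (rule in_closed_span_trans[OF _ _ _ h(1) h(2)])
    show "in_closed_span esys UNIV (expo (of_int m))" if "m \<in> - range b" for m
      using in_closed_span_base[of m UNIV esys] that by (simp add: esys_def)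
  qed auto
  have Ss: "in_closed_span esys UNIV S"
    unfolding S_def by (intro in_closed_span_sum in_closed_span_scale span_expo_a L2_scale expo_L2 esys_L2)
  show "\<exists>g\<in>L2. in_closed_span esys UNIV g \<and> l2_dist (\<lambda>t. pexp j t - of_real (r j / r c) * pexp c t) g < \<epsilon>"
  proof (intro bexI[of _ "\<lambda>t. S t + (-1) * h t"] conjI)
    show "(\<lambda>t. S t + (-1) * h t) \<in> L2" by (intro L2_add L2_scale S h)
    show "in_closed_span esys UNIV (\<lambda>t. S t + (-1) * h t)"
      by (intro in_closed_span_add in_closed_span_scale Ss hs S L2_scale h esys_L2)
    let ?u = "\<lambda>t. of_real (- (F c + r j / r c)) * pexp c t" and ?v = "\<lambda>t. (-1) * (D t - h t)"
    have "pexp j t - of_real (r j / r c) * pexp c t - (S t + (-1) * h t) = ?u t + ?v t" for t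
      by (simp add: D_def algebra_simps)
    then have "l2_dist (\<lambda>t. pexp j t - of_real (r j / r c) * pexp c t) (\<lambda>t. S t + (-1) * h t) = l2_norm (\<lambda>t. ?u t + ?v t)"
      by (simp only: l2_dist_norm)
    also have "\<dots> \<le> l2_norm ?u + l2_norm ?v" by (intro l2_norm_triangle L2_scale L2_diff D h) auto
    also have "\<dots> = \<bar>F c + r j / r c\<bar> * sqrt (2 * pi) + l2_dist D h"
      unfolding l2_norm_scale l2_dist_norm norm_of_real by simp
    also have "\<dots> \<le> e1 * (2 * pi) + (\<epsilon> / 8 + 2 * pi * e1)"
      using F(2) h(3) sqrt_2pi_le e1 by (intro add_mono mult_mono) auto
    also have "\<dots> = e1 * (4 * pi) + \<epsilon> / 8" by simp
    also have "\<dots> \<le> e1 * 16 + \<epsilon> / 8" using e1 pi_less_4 by (intro add_right_mono mult_left_mono) auto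
    also have "\<dots> < \<epsilon>" using e by (simp add: e1_def)
    finally show "l2_dist (\<lambda>t. pexp j t - of_real (r j / r c) * pexp c t) (\<lambda>t. S t + (-1) * h t) < \<epsilon>" .
  qed
qed auto

text \<open>The coefficient \<open>r j / r c\<close> of the second exponential tends to 0, because
  the residues grow without bound.\<close>

lemma span_pexp: "in_closed_span esys UNIV (pexp j)"
proof (rule in_closed_span_limit)
  fix \<epsilon> :: real assume e: "0 < \<epsilon>"
  obtain N where N: "\<And>c. c \<ge> N \<Longrightarrow> \<bar>r j\<bar> * (2 * pi) / \<epsilon> < \<bar>r c\<bar>" using r_unbounded by blast
  define c where "c = max N (Suc j)"
  have c: "j \<noteq> c" "\<bar>r j\<bar> * (2 * pi) / \<epsilon> < \<bar>r c\<bar>" using N[of c] by (auto simp: c_def)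
  show "\<exists>g\<in>L2. in_closed_span esys UNIV g \<and> l2_dist (pexp j) g < \<epsilon>"
  proof (intro bexI[of _ "\<lambda>t. pexp j t - of_real (r j / r c) * pexp c t"] conjI span_pexp_pair c)
    show "(\<lambda>t. pexp j t - of_real (r j / r c) * pexp c t) \<in> L2" by (intro L2_diff L2_scale) auto
    have "l2_dist (pexp j) (\<lambda>t. pexp j t - of_real (r j / r c) * pexp c t) = \<bar>r j / r c\<bar> * sqrt (2 * pi)"
      unfolding l2_dist_norm using l2_norm_scale[of "of_real (r j / r c)" "pexp c"] by (simp add: norm_divide)
    also have "\<dots> \<le> \<bar>r j / r c\<bar> * (2 * pi)" by (intro mult_left_mono sqrt_2pi_le) auto
    also have "\<dots> < \<epsilon>" using c(2) e r_nonzero[of c] by (simp add: field_simps)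
    finally show "l2_dist (pexp j) (\<lambda>t. pexp j t - of_real (r j / r c) * pexp c t) < \<epsilon>" .
  qed
qed auto

lemma esys_complete: "l2_complete esys UNIV"
  unfolding l2_complete_def
proof (intro conjI ballI)
  fix h assume h: "h \<in> L2"
  show "in_closed_span esys UNIV h"
  proof (rule in_closed_span_trans[OF _ _ _ h trig_system_complete[OF h]])
    fix m :: int
    show "in_closed_span esys UNIV (expo (of_int m))"
    proof (cases "m \<in> range b")
      case True
      then obtain i where i: "m = b i" by blast
      have "expo (of_int m) = (\<lambda>t. of_real (sg i) * pexp i t)" by (rule ext) (simp add: i expo_pexp)
      then show ?thesis using in_closed_span_scale[OF span_pexp[of i]] by simp
    next
      case False
      then show ?thesis using in_closed_span_base[of m UNIV esys] by (simp add: esys_def)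
    qed
  qed auto
qed auto

section \<open>The biorthogonal system\<close>

definition Phi :: "real \<Rightarrow> real" where "Phi x = (\<Sum>i. r i / (x - of_int (b i)))"

text \<open>At \<open>a n\<close> this is the biorthogonal function up to scaling; at an untouched
  integer it is the correction that makes the integer exponential orthogonal to all
  \<open>expo (a n)\<close>.\<close>

definition W :: "real \<Rightarrow> real \<Rightarrow> complex" where "W x = series (\<lambda>i. r i / (x - of_int (b i)))"

lemma W_summable: "summable (\<lambda>i. \<bar>r i / (x - of_int (b i))\<bar>)"
  using r_summable[of x] by (simp add: abs_divide)

lemma W_L2 [simp, intro]: "W x \<in> L2"
  unfolding W_def by (rule series_L2[OF W_summable])

lemma Phi_a [simp]: "Phi (a n) = 0"
  unfolding Phi_def using r_sums[of n] by (simp add: sums_iff)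

text \<open>The identity \<open>1 / ((x - \<beta>) * (a - \<beta>)) = (1 / (x - \<beta>) - 1 / (a -
  \<beta>)) / (a - x)\<close> reduces the series to values of \<open>Phi\<close> at \<open>x\<close>
  and at \<open>a n\<close>, and the latter is 0.\<close>

lemma inner_a_W:
  assumes "x \<noteq> a n" "\<And>i. x \<noteq> of_int (b i)"
  shows "l2_inner (expo (a n)) (W x) = of_real (2 * sin (pi * a n) * (Phi x / (a n - x)))"
  unfolding W_def
proof (rule inner_a_series[OF W_summable])
  have "(\<lambda>i. r i / (x - of_int (b i))) sums Phi x"
    unfolding Phi_def by (rule summable_sums) (rule summable_rabs_cancel[OF W_summable])
  then have "(\<lambda>i. (r i / (x - of_int (b i)) - r i / (a n - of_int (b i))) / (a n - x)) sums ((Phi x - 0) / (a n - x))"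
    by (intro sums_divide sums_diff r_sums)
  moreover have "(r i / (x - of_int (b i)) - r i / (a n - of_int (b i))) / (a n - x) = r i / (x - of_int (b i)) / (a n - of_int (b i))" for i
  proof -
    have ne: "a n - x \<noteq> 0" "x - of_int (b i) \<noteq> 0" "a n - of_int (b i) \<noteq> 0" using assms a_minus_int by auto
    have "r i / (x - of_int (b i)) - r i / (a n - of_int (b i)) = r i * (a n - x) / ((x - of_int (b i)) * (a n - of_int (b i)))"
      using ne by (simp add: divide_simps) (simp add: algebra_simps)
    then show ?thesis using ne by simp
  qed
  ultimately show "(\<lambda>i. r i / (x - of_int (b i)) / (a n - of_int (b i))) sums (Phi x / (a n - x))" by simp
qed

lemma inner_0_W: "x \<noteq> 0 \<Longrightarrow> l2_inner (pexp 0) (W x) \<noteq> 0"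
  unfolding W_def inner_pexp_series[OF W_summable] using r_nonzero[of 0] by (simp add: b_0)

text \<open>A function of the form \<open>W x\<close> is never null, so completeness of the exponentials rules out
  that it is orthogonal to all of them.\<close>

lemma W_not_orthogonal:
  assumes "x \<noteq> 0"
  shows "\<exists>n. l2_inner (esys n) (W x) \<noteq> 0"
proof (rule ccontr)
  assume "\<not> ?thesis"
  then have "l2_norm (W x) = 0" using orthogonal_complete_null[OF esys_complete W_L2[of x]] by blast
  then have "l2_inner (pexp 0) (W x) = 0" using l2_Cauchy_Schwarz[OF pexp_L2[of 0] W_L2[of x]] by simp
  then show False using inner_0_W[OF assms] by simp
qed

lemma inner_esys_W_a:
  assumes "m \<noteq> b n"
  shows "l2_inner (esys m) (W (a n)) = 0"
proof (cases "m \<in> range b")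
  case True
  then obtain k where k: "m = b k" by blast
  then have "a n \<noteq> a k" using assms a_inj by (auto simp: inj_def)
  moreover have "a n \<noteq> of_int (b i)" for i using a_minus_int[of n "b i"] by simp
  ultimately show ?thesis using inner_a_W[of "a n" k] k by (simp add: esys_def)
next
  case False
  then show ?thesis unfolding esys_def W_def by (simp add: inner_int_series[OF W_summable])
qed

definition gam :: "nat \<Rightarrow> complex" where "gam n = l2_inner (esys (b n)) (W (a n))"

lemma a_nonzero: "a n \<noteq> 0"
  using a_minus_int[of n 0] by simp

text \<open>\<open>W (a n)\<close> is orthogonal to all exponentials but one; if this last pairing
  vanished as well, completeness would be contradicted.\<close>

lemma gam_nonzero: "gam n \<noteq> 0"
  using W_not_orthogonal[OF a_nonzero[of n]] inner_esys_W_a unfolding gam_def by metis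

lemma other_nonzero: "m \<notin> range b \<Longrightarrow> real_of_int m \<noteq> 0"
  using b_0 by (metis of_int_eq_0_iff rangeI)

lemma inner_a_W_other:
  assumes "m \<notin> range b"
  shows "l2_inner (expo (a n)) (W (of_int m)) = of_real (2 * sin (pi * a n) * (Phi (of_int m) / (a n - of_int m)))"
proof (rule inner_a_W)
  show "real_of_int m \<noteq> a n" using a_minus_int[of n m] by simp
  show "real_of_int m \<noteq> of_int (b i)" for i using assms by auto
qed

text \<open>A zero of \<open>Phi\<close> at \<open>m\<close> would make \<open>W m\<close>
  orthogonal to all new exponentials; to the untouched ones it is orthogonal anyway, since its
  frequencies lie in \<open>range b\<close>.\<close>

lemma Phi_nonzero:
  assumes "m \<notin> range b"
  shows "Phi (of_int m) \<noteq> 0"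
proof
  assume 0: "Phi (of_int m) = 0"
  have "l2_inner (esys k) (W (of_int m)) = 0" for k
  proof (cases "k \<in> range b")
    case True
    then show ?thesis using inner_a_W_other[OF assms] 0 by (auto simp: esys_def)
  next
    case False
    then show ?thesis unfolding esys_def W_def by (simp add: inner_int_series[OF W_summable])
  qed
  then show False using W_not_orthogonal[OF other_nonzero[OF assms]] by blast
qed

text \<open>At an untouched \<open>m\<close>, the pairings of \<open>expo (a n)\<close> with the
  integer exponential and with \<open>W m\<close> are both proportional to
  \<open>sin (pi * a n) / (a n - m)\<close>, so a single quotient cancels them for all
  \<open>n\<close>. The conjugate of \<open>gam\<close> appears because the inner product is
  antilinear in its second argument.\<close>

definition dual :: "int \<Rightarrow> real \<Rightarrow> complex" where
  "dual m = (if m \<in> range b then (\<lambda>t. 1 / cnj (gam (inv b m)) * W (a (inv b m)) t)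
     else (\<lambda>t. 1 / (2 * pi) * (expo (of_int m) t - of_real (cos (pi * of_int m) / Phi (of_int m)) * W (of_int m) t)))"

lemma dual_b: "dual (b n) = (\<lambda>t. 1 / cnj (gam n) * W (a n) t)"
  by (simp add: dual_def b_inj)

lemma dual_other: "m \<notin> range b \<Longrightarrow>
    dual m = (\<lambda>t. 1 / (2 * pi) * (expo (of_int m) t - of_real (cos (pi * of_int m) / Phi (of_int m)) * W (of_int m) t))"
  by (simp add: dual_def)

lemma dual_L2 [simp, intro]: "dual m \<in> L2"
proof (cases "m \<in> range b")
  case True
  then obtain n where n: "m = b n" by blast
  show ?thesis unfolding n dual_b by (intro L2_scale W_L2)
next
  case False
  show ?thesis unfolding dual_other[OF False] by (intro L2_scale L2_diff W_L2 expo_L2)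
qed

lemma dual_biorthogonal: "biorthogonal esys dual"
  unfolding biorthogonal_def
proof (intro conjI allI)
  fix k m
  show "l2_inner (esys k) (dual m) = (if k = m then 1 else 0)"
  proof (cases "m \<in> range b")
    case True
    then obtain n where n: "m = b n" by blast
    have "l2_inner (esys k) (dual m) = 1 / gam n * l2_inner (esys k) (W (a n))"
      unfolding n dual_b l2_inner_scale_right by simp
    then show ?thesis using inner_esys_W_a[of k n] gam_nonzero[of n] n by (auto simp: gam_def)
  next
    case False
    let ?q = "cos (pi * of_int m) / Phi (of_int m)"
    have e: "l2_inner (esys k) (dual m) = 1 / (2 * pi) * (l2_inner (esys k) (expo (of_int m)) - of_real ?q * l2_inner (esys k) (W (of_int m)))"
      unfolding dual_other[OF False] l2_inner_scale_right
      unfolding l2_inner_diff_right[OF expo_L2 L2_scale[OF W_L2] esys_L2] l2_inner_scale_right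
        complex_cnj_complex_of_real by simp
    show ?thesis
    proof (cases "k \<in> range b")
      case True
      then obtain n where n: "k = b n" by blast
      have "l2_inner (esys k) (dual m) = 1 / (2 * pi) * complex_of_real (2 * sin (pi * a n) * cos (pi * of_int m) / (a n - of_int m) - ?q * (2 * sin (pi * a n) * (Phi (of_int m) / (a n - of_int m))))"
      proof -
        have "l2_inner (esys k) (expo (of_int m)) = of_real (2 * sin (pi * a n) * cos (pi * of_int m) / (a n - of_int m))"
          "l2_inner (esys k) (W (of_int m)) = of_real (2 * sin (pi * a n) * (Phi (of_int m) / (a n - of_int m)))"
          by (simp_all only: n esys_def lam_b inner_a_int inner_a_W_other[OF False])
        then show ?thesis unfolding e by (simp only: of_real_diff of_real_mult)
      qed
      also have "2 * sin (pi * a n) * cos (pi * of_int m) / (a n - of_int m) - ?q * (2 * sin (pi * a n) * (Phi (of_int m) / (a n - of_int m))) = 0"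
        using Phi_nonzero[OF False] by simp
      finally show ?thesis using True False by auto
    next
      case kF: False
      have "l2_inner (esys k) (W (of_int m)) = 0"
        using kF unfolding esys_def W_def by (simp add: inner_int_series[OF W_summable])
      then show ?thesis unfolding e using kF by (simp add: esys_def l2_inner_expo_int)
    qed
  qed
qed auto

section \<open>Completeness of the biorthogonal system\<close>

lemma dual_span_W_a: "in_closed_span dual UNIV (W (a n))"
proof -
  have "(\<lambda>t. cnj (gam n) * dual (b n) t) = W (a n)" using gam_nonzero[of n] by (simp add: dual_b)
  then show ?thesis using in_closed_span_scale[OF in_closed_span_base[of "b n" UNIV dual], of "cnj (gam n)"] by simp
qed

text \<open>With the same rational function \<open>F\<close> as for the exponentials, the
  combination of the \<open>W (a n)\<close> has coefficients \<open>r i * F i\<close>: exactly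
  \<open>r j\<close> at \<open>j\<close>, nearly \<open>- r j\<close> at \<open>c\<close>, summably
  small elsewhere.\<close>

lemma dual_span_pair:
  assumes "j \<noteq> c"
  shows "in_closed_span dual UNIV (\<lambda>t. pexp j t - pexp c t)"
proof -
  have "in_closed_span dual UNIV (\<lambda>t. of_real (r j) * (pexp j t - pexp c t))"
  proof (rule in_closed_span_limit)
    show "(\<lambda>t. of_real (r j) * (pexp j t - pexp c t)) \<in> L2" by (intro L2_scale L2_diff) auto
    fix \<epsilon> :: real assume e: "0 < \<epsilon>"
    \<comment> \<open>The error of \<open>F c\<close> enters multiplied by \<open>r c\<close>, hence
      the factor \<open>1 + \<bar>r c\<bar>\<close>.\<close>
    define e1 where "e1 = \<epsilon> / (16 * (1 + \<bar>r c\<bar>))"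
    have p: "0 < 1 + \<bar>r c\<bar>" by linarith
    have e1: "0 < e1" using e p by (simp add: e1_def)
    obtain K \<alpha> where A: "(\<Sum>n<K. \<alpha> n / (a n - of_int (b j))) = 1 \<and>
         \<bar>(\<Sum>n<K. \<alpha> n / (a n - of_int (b c))) + r j / r c\<bar> < e1 \<and>
         summable (\<lambda>i. if i = j \<or> i = c then 0 else \<bar>\<Sum>n<K. \<alpha> n / (a n - of_int (b i))\<bar> * (1 + \<bar>r i\<bar>)) \<and>
         (\<Sum>i. if i = j \<or> i = c then 0 else \<bar>\<Sum>n<K. \<alpha> n / (a n - of_int (b i))\<bar> * (1 + \<bar>r i\<bar>)) < e1"
      using approx[OF assms e1] by blast
    define F where "F i = (\<Sum>n<K. \<alpha> n / (a n - of_int (b i)))" for i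
    have F: "F j = 1" "\<bar>F c + r j / r c\<bar> < e1"
       "summable (\<lambda>i. if i = j \<or> i = c then 0 else \<bar>F i\<bar> * (1 + \<bar>r i\<bar>))"
       "(\<Sum>i. if i = j \<or> i = c then 0 else \<bar>F i\<bar> * (1 + \<bar>r i\<bar>)) < e1" unfolding F_def using A by blast+
    define S where "S t = (\<Sum>n<K. of_real (\<alpha> n) * W (a n) t)" for t
    have S: "S \<in> L2" unfolding S_def by (intro L2_sum L2_scale) auto
    define x where "x i = (if i = j \<or> i = c then 0 else r i * F i)" for i
    have xb: "\<bar>x i\<bar> \<le> (if i = j \<or> i = c then 0 else \<bar>F i\<bar> * (1 + \<bar>r i\<bar>))" for i
      by (simp add: x_def abs_mult distrib_left)
    have xs: "summable (\<lambda>i. \<bar>x i\<bar>)"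
      by (rule summable_comparison_test[OF _ F(3)]) (use xb in auto)
    have xn: "(\<Sum>i. \<bar>x i\<bar>) < e1" using suminf_le[OF xb xs F(3)] F(4) by linarith
    have St: "S t = of_real (r j) * pexp j t + of_real (r c * F c) * pexp c t + series x t" for t
    proof -
      have s1: "summable (\<lambda>i. \<bar>if i = k then u else 0 :: real\<bar>)" for k u
        by (rule summable_finite[of "{k}"]) auto
      have "S t = series (\<lambda>i. \<Sum>n<K. \<alpha> n * (r i / (a n - of_int (b i)))) t"
        unfolding S_def W_def by (rule series_sum) (rule W_summable)
      also have "(\<lambda>i. \<Sum>n<K. \<alpha> n * (r i / (a n - of_int (b i)))) = (\<lambda>i. (if i = j then r j else 0) + ((if i = c then r c * F c else 0) + x i))"
      proof
        fix i
        have "(\<Sum>n<K. \<alpha> n * (r i / (a n - of_int (b i)))) = r i * F i"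
          unfolding F_def sum_distrib_left by (intro sum.cong refl) simp
        then show "(\<Sum>n<K. \<alpha> n * (r i / (a n - of_int (b i)))) = (if i = j then r j else 0) + ((if i = c then r c * F c else 0) + x i)"
          using assms F(1) by (auto simp: x_def)
      qed
      also have "series \<dots> t = series (\<lambda>i. if i = j then r j else 0) t + series (\<lambda>i. (if i = c then r c * F c else 0) + x i) t"
        by (rule series_add[OF s1]) (rule summable_comparison_test[OF _ summable_add[OF s1[of c "r c * F c"] xs]], auto)
      also have "series (\<lambda>i. (if i = c then r c * F c else 0) + x i) t = series (\<lambda>i. if i = c then r c * F c else 0) t + series x t"
        by (rule series_add[OF s1 xs])
      finally show ?thesis by (simp add: series_single)
    qed
    have Ss: "in_closed_span dual UNIV S"
      unfolding S_def by (intro in_closed_span_sum in_closed_span_scale dual_span_W_a) auto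
    show "\<exists>g\<in>L2. in_closed_span dual UNIV g \<and> l2_dist (\<lambda>t. of_real (r j) * (pexp j t - pexp c t)) g < \<epsilon>"
    proof (intro bexI[of _ S] conjI S Ss)
      let ?u = "\<lambda>t. of_real (- (r c * (F c + r j / r c))) * pexp c t" and ?v = "\<lambda>t. (-1) * series x t"
      have "of_real (r j) * (pexp j t - pexp c t) - S t = ?u t + ?v t" for t
        using r_nonzero[of c] unfolding St by (simp add: algebra_simps)
      then have "l2_dist (\<lambda>t. of_real (r j) * (pexp j t - pexp c t)) S = l2_norm (\<lambda>t. ?u t + ?v t)"
        by (simp only: l2_dist_norm)
      also have "\<dots> \<le> l2_norm ?u + l2_norm ?v" by (intro l2_norm_triangle L2_scale series_L2 xs) auto
      also have "\<dots> = \<bar>r c\<bar> * \<bar>F c + r j / r c\<bar> * sqrt (2 * pi) + l2_norm (series x)"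
        unfolding l2_norm_scale norm_of_real by (simp add: abs_mult)
      also have "\<dots> \<le> \<bar>r c\<bar> * e1 * (2 * pi) + e1 * (2 * pi)"
      proof (intro add_mono mult_mono)
        show "l2_norm (series x) \<le> e1 * (2 * pi)"
          by (rule order_trans[OF series_norm[OF xs]], rule mult_right_mono) (use xn in auto)
      qed (use F(2) sqrt_2pi_le e1 in auto)
      also have "\<dots> = (e1 * (1 + \<bar>r c\<bar>)) * (2 * pi)" by (simp add: algebra_simps)
      also have "\<dots> \<le> (e1 * (1 + \<bar>r c\<bar>)) * 8" using e1 pi_less_4 by (intro mult_left_mono) auto
      also have "\<dots> = \<epsilon> / 2"
      proof -
        have "\<epsilon> / (16 * u) * u * 8 = \<epsilon> / 2" if "u \<noteq> 0" for u :: real using that by simp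
        then show ?thesis using p unfolding e1_def by (metis less_irrefl)
      qed
      also have "\<dots> < \<epsilon>" using e by simp
      finally show "l2_dist (\<lambda>t. of_real (r j) * (pexp j t - pexp c t)) S < \<epsilon>" .
    qed
  qed auto
  from in_closed_span_scale[OF this, of "1 / of_real (r j)"] show ?thesis using r_nonzero[of j] by simp
qed

text \<open>Here the coefficient of \<open>pexp c\<close> is always 1, so a single distant
  \<open>c\<close> does not help. The mean of \<open>N\<close> orthogonal vectors of norm
  \<open>sqrt (2 * pi)\<close> has norm \<open>sqrt (2 * pi / N)\<close>, and averaging the
  differences over \<open>N\<close> indices approximates \<open>pexp j\<close>.\<close>

lemma dual_span_pexp: "in_closed_span dual UNIV (pexp j)"
proof (rule in_closed_span_limit)
  fix \<epsilon> :: real assume e: "0 < \<epsilon>"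
  obtain N :: nat where N: "2 * pi / \<epsilon>\<^sup>2 < real N" using reals_Archimedean2 by blast
  have "0 < 2 * pi / \<epsilon>\<^sup>2" using e by simp
  then have Npos: "0 < real N" using N by linarith
  define C where "C = {Suc j..j + N}"
  have C: "finite C" "card C = N" "j \<notin> C" by (auto simp: C_def)
  define A where "A t = (\<Sum>c\<in>C. of_real (1 / N) * pexp c t)" for t
  have A: "A \<in> L2" unfolding A_def by (intro L2_sum L2_scale) auto
  have "(l2_norm A)\<^sup>2 = 2 * pi / N"
  proof -
    have "l2_inner A (pexp d) = of_real (2 * pi / N)" if "d \<in> C" for d
    proof -
      have "l2_inner A (pexp d) = (\<Sum>c\<in>C. of_real (1 / N) * l2_inner (pexp c) (pexp d))"
        unfolding A_def by (intro l2_inner_sum_left) auto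
      also have "\<dots> = (\<Sum>c\<in>C. if c = d then of_real (2 * pi / N) else 0)"
        by (intro sum.cong refl) (auto simp: inner_pexp_pexp)
      finally show ?thesis using that C(1) by simp
    qed
    moreover have "l2_inner A A = (\<Sum>c\<in>C. cnj (of_real (1 / N)) * l2_inner A (pexp c))"
      unfolding A_def[abs_def] by (rule l2_inner_sum_right) (use A in \<open>auto simp: A_def[abs_def]\<close>)
    ultimately have "l2_inner A A = (\<Sum>c\<in>C. of_real (1 / N) * of_real (2 * pi / N))" by simp
    also have "\<dots> = of_real (2 * pi / N)" using Npos by (simp add: C(2))
    finally show ?thesis unfolding l2_inner_self by (simp only: of_real_eq_iff)
  qed
  also have "2 * pi / N < \<epsilon>\<^sup>2" using N Npos e by (simp add: field_simps)
  finally have An: "l2_norm A < \<epsilon>" using e by (simp add: power_less_imp_less_base)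
  show "\<exists>g\<in>L2. in_closed_span dual UNIV g \<and> l2_dist (pexp j) g < \<epsilon>"
  proof (intro bexI[of _ "\<lambda>t. \<Sum>c\<in>C. of_real (1 / N) * (pexp j t - pexp c t)"] conjI)
    show "(\<lambda>t. \<Sum>c\<in>C. of_real (1 / N) * (pexp j t - pexp c t)) \<in> L2" by (intro L2_sum L2_scale L2_diff) auto
    show "in_closed_span dual UNIV (\<lambda>t. \<Sum>c\<in>C. of_real (1 / N) * (pexp j t - pexp c t))"
      using C(3) by (intro in_closed_span_sum in_closed_span_scale dual_span_pair L2_scale L2_diff) auto
    have "(\<Sum>c\<in>C. of_real (1 / N) * (pexp j t - pexp c t)) = pexp j t - A t" for t
      using Npos C(2) by (simp add: A_def right_diff_distrib sum_subtractf)
    then show "l2_dist (pexp j) (\<lambda>t. \<Sum>c\<in>C. of_real (1 / N) * (pexp j t - pexp c t)) < \<epsilon>"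
      using An by (simp add: l2_dist_norm)
  qed
qed auto

lemma dual_span_series:
  assumes "summable (\<lambda>i. \<bar>y i\<bar>)"
  shows "in_closed_span dual UNIV (series y)"
proof (rule in_closed_span_limit)
  fix \<epsilon> :: real assume e: "0 < \<epsilon>"
  have "\<forall>\<^sub>F n in sequentially. l2_norm (\<lambda>t. series y t - (\<Sum>i<n. of_real (y i) * pexp i t)) < \<epsilon>"
    by (rule order_tendstoD(2)[OF series_partial[OF assms] e])
  then obtain n where n: "l2_dist (series y) (\<lambda>t. \<Sum>i<n. of_real (y i) * pexp i t) < \<epsilon>"
    unfolding l2_dist_norm using eventually_happens by force
  have "in_closed_span dual UNIV (\<lambda>t. \<Sum>i<n. of_real (y i) * pexp i t)"
    by (intro in_closed_span_sum in_closed_span_scale dual_span_pexp) auto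
  then show "\<exists>g\<in>L2. in_closed_span dual UNIV g \<and> l2_dist (series y) g < \<epsilon>" using n partial_L2 by blast
qed (use series_L2[OF assms] in auto)

lemma dual_complete: "l2_complete dual UNIV"
  unfolding l2_complete_def
proof (intro conjI ballI)
  fix h assume h: "h \<in> L2"
  show "in_closed_span dual UNIV h"
  proof (rule in_closed_span_trans[OF _ _ _ h trig_system_complete[OF h]])
    fix m :: int
    show "in_closed_span dual UNIV (expo (of_int m))"
    proof (cases "m \<in> range b")
      case True
      then obtain i where i: "m = b i" by blast
      have "expo (of_int m) = (\<lambda>t. of_real (sg i) * pexp i t)" by (rule ext) (simp add: i expo_pexp)
      then show ?thesis using in_closed_span_scale[OF dual_span_pexp[of i]] by simp
    next
      case False
      \<comment> \<open>Solved for the integer exponential, the definition of \<open>dual m\<close>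
        leaves a multiple of \<open>W m\<close>, a series already known to lie in the span.\<close>
      have "expo (of_int m) = (\<lambda>t. (2 * pi) * dual m t + of_real (cos (pi * of_int m) / Phi (of_int m)) * W (of_int m) t)"
        by (rule ext) (simp add: dual_other[OF False])
      moreover have "in_closed_span dual UNIV (\<lambda>t. (2 * pi) * dual m t + of_real (cos (pi * of_int m) / Phi (of_int m)) * W (of_int m) t)"
        unfolding W_def
        by (intro in_closed_span_add in_closed_span_scale in_closed_span_base dual_span_series W_summable L2_scale series_L2) auto
      ultimately show ?thesis by simp
    qed
  qed auto
qed auto

section \<open>Arbitrary biorthogonal systems and the incomplete mixed system\<close>

text \<open>The difference is orthogonal to a complete system. Uniqueness up to null functions
  transfers all results from \<open>dual\<close> to every biorthogonal \<open>G\<close>.\<close>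

lemma dual_unique:
  assumes "biorthogonal esys G"
  shows "l2_norm (\<lambda>t. G n t - dual n t) = 0"
proof (rule orthogonal_complete_null[OF esys_complete])
  have GL: "G n \<in> L2" using assms by (simp add: biorthogonal_def)
  then show "(\<lambda>t. G n t - dual n t) \<in> L2" by (intro L2_diff) auto
  fix k
  show "l2_inner (esys k) (\<lambda>t. G n t - dual n t) = 0"
    using assms dual_biorthogonal GL by (subst l2_inner_diff_right) (auto simp: biorthogonal_def)
qed

lemma biorthogonal_complete:
  assumes G: "biorthogonal esys G"
  shows "l2_complete G UNIV"
  unfolding l2_complete_def
proof (intro conjI ballI)
  show GL: "G n \<in> L2" for n using G by (simp add: biorthogonal_def)
  fix h assume h: "h \<in> L2"
  have "in_closed_span dual UNIV h" using dual_complete h by (simp add: l2_complete_def)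
  then show "in_closed_span G UNIV h"
  proof (rule in_closed_span_trans[OF _ _ _ h, rotated 3])
    fix n
    show "in_closed_span G UNIV (dual n)"
    proof (rule in_closed_span_limit)
      fix \<epsilon> :: real assume "0 < \<epsilon>"
      then have "l2_dist (dual n) (G n) < \<epsilon>"
        using dual_unique[OF G, of n] l2_dist_commute[of "dual n" "G n"] by (simp add: l2_dist_norm)
      then show "\<exists>g\<in>L2. in_closed_span G UNIV g \<and> l2_dist (dual n) g < \<epsilon>"
        using GL in_closed_span_base[of n UNIV G] by blast
    qed (use GL in auto)
  qed (use GL in auto)
qed

text \<open>The kept exponentials are orthogonal to \<open>\<psi>\<close> and, by biorthogonality,
  to the chosen members of \<open>G\<close>. An approximation of \<open>\<psi>\<close> by the mixed
  system would therefore give one by those members of \<open>G\<close> alone, which pairing with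
  \<open>\<phi>\<close> excludes.\<close>

lemma not_hereditarily_complete:
  assumes G: "biorthogonal esys G"
  shows "\<not> hereditarily_complete esys G"
proof
  assume hc: "hereditarily_complete esys G"
  \<comment> \<open>Exponentials are kept at the untouched integers and at the frequencies p_k (odd
    indices); the \<lambda>_k (even indices) contribute biorthogonal functions.\<close>
  define N1 where "N1 = - b ` {i. even i}"
  define H where "H n = (if n \<in> N1 then esys n else G n)" for n
  have H: "l2_complete H UNIV" using hc unfolding hereditarily_complete_def H_def[abs_def] by blast
  have GL: "G n \<in> L2" for n using G by (simp add: biorthogonal_def)
  have eG: "l2_inner (esys k) (G n) = (if k = n then 1 else 0)" for k n using G by (simp add: biorthogonal_def)
  define \<psi> \<phi> where "\<psi> = series g" and "\<phi> = series f"
  have \<psi>: "\<psi> \<in> L2" and \<phi>: "\<phi> \<in> L2" unfolding \<psi>_def \<phi>_def by (intro series_L2 f_summable g_summable)+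
  have \<psi>\<phi>: "l2_inner \<psi> \<phi> = of_real (2 * pi)"
  proof -
    have "(\<lambda>i. g i * f i) sums 1"
    proof -
      have "g i * f i = (if i = 0 then 1 else 0)" for i
        using fg f_0 g_0 by (cases i) (simp_all add: mult.commute)
      then show ?thesis using sums_single[of 0 "\<lambda>_. 1::real"] by simp
    qed
    from inner_series_series[OF g_summable f_summable this] show ?thesis by (simp add: \<psi>_def \<phi>_def)
  qed
  have e\<psi>: "l2_inner (esys n) \<psi> = 0" if n: "n \<in> N1" for n
  proof (cases "n \<in> range b")
    case True
    then obtain i where i: "n = b i" "odd i" using n by (auto simp: N1_def)
    then show ?thesis using inner_a_series[OF g_summable g_sums[OF i(2)]] by (simp add: esys_def \<psi>_def)
  next
    case False
    then show ?thesis unfolding esys_def \<psi>_def by (simp add: inner_int_series[OF g_summable])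
  qed
  have G\<phi>: "l2_inner (G n) \<phi> = 0" if n: "n \<notin> N1" for n
  proof -
    obtain i where i: "n = b i" "even i" using n by (auto simp: N1_def)
    have "(\<lambda>k. r k / (a i - of_int (b k)) * f k) sums 0"
      using f_sums[OF i(2)] by (simp add: mult.commute)
    from inner_series_series[OF W_summable f_summable this] have "l2_inner (dual n) \<phi> = 0"
      unfolding i dual_b l2_inner_scale_left \<phi>_def W_def[symmetric] by simp
    moreover have "l2_inner (\<lambda>t. G n t - dual n t) \<phi> = 0"
      using l2_Cauchy_Schwarz[OF L2_diff[OF GL[of n] dual_L2[of n]] \<phi>] dual_unique[OF G, of n] by simp
    ultimately show ?thesis using l2_inner_diff_left[OF GL[of n] dual_L2[of n] \<phi>] by simp
  qed
  have p: "0 < 1 / (l2_norm \<phi> + 1)" by (simp add: add_nonneg_pos)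
  obtain J c where J: "finite J" "l2_dist \<psi> (\<lambda>t. \<Sum>n\<in>J. c n * H n t) < 1 / (l2_norm \<phi> + 1)"
    using H \<psi> p unfolding l2_complete_def in_closed_span_def by blast
  define S1 where "S1 t = (\<Sum>n\<in>J \<inter> N1. c n * esys n t)" for t
  define S2 where "S2 t = (\<Sum>n\<in>J - N1. c n * G n t)" for t
  have S: "S1 \<in> L2" "S2 \<in> L2" unfolding S1_def S2_def using GL by (auto intro!: L2_sum L2_scale)
  have sum: "(\<Sum>n\<in>J. c n * H n t) = S1 t + S2 t" for t
    unfolding S1_def S2_def by (subst sum.Int_Diff[OF J(1), of _ N1]) (auto simp: H_def intro!: arg_cong2[of _ _ _ _ "(+)"] sum.cong)
  \<comment> \<open>Only the biorthogonal part is removed. As \<open>x\<close> is orthogonal to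
    \<open>S1\<close>, subtracting \<open>S1\<close> cannot decrease the norm, so \<open>x\<close>
    is small; yet its pairing with \<open>\<phi>\<close> is still \<open>2 * pi\<close>.\<close>
  define x where "x t = \<psi> t - S2 t" for t
  have x: "x \<in> L2" unfolding x_def using \<psi> S by blast
  have "l2_inner (esys n) x = 0" if n: "n \<in> N1" for n
  proof -
    have "l2_inner (esys n) S2 = (\<Sum>k\<in>J - N1. cnj (c k) * l2_inner (esys n) (G k))"
      unfolding S2_def using GL by (intro l2_inner_sum_right) auto
    also have "\<dots> = 0" using n by (intro sum.neutral) (auto simp: eG)
    finally show ?thesis unfolding x_def using \<psi> S e\<psi>[OF n] by (subst l2_inner_diff_right) auto
  qed
  then have S1x: "l2_inner S1 x = 0"
  proof -
    assume "\<And>n. n \<in> N1 \<Longrightarrow> l2_inner (esys n) x = 0"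
    moreover have "l2_inner S1 x = (\<Sum>n\<in>J \<inter> N1. c n * l2_inner (esys n) x)"
      unfolding S1_def using x by (intro l2_inner_sum_left) auto
    ultimately show ?thesis by (simp add: sum.neutral)
  qed
  define y where "y t = x t - S1 t" for t
  have y: "y \<in> L2" unfolding y_def using x S by blast
  have yn: "l2_norm y < 1 / (l2_norm \<phi> + 1)"
    using J(2) unfolding l2_dist_norm sum by (simp add: y_def[abs_def] x_def algebra_simps)
  have xn: "l2_norm x \<le> l2_norm y"
  proof -
    have "l2_inner y x = of_real ((l2_norm x)\<^sup>2)"
      unfolding y_def using x S S1x by (simp add: l2_inner_diff_left l2_inner_self)
    then have "(l2_norm x)\<^sup>2 \<le> l2_norm y * l2_norm x"
      using l2_Cauchy_Schwarz[OF y x] by (simp add: norm_power)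
    then have "l2_norm x * l2_norm x \<le> l2_norm y * l2_norm x" by (simp add: power2_eq_square)
    then show ?thesis by (metis l2_norm_nonneg mult_right_le_imp_le order_le_less)
  qed
  have "l2_inner S2 \<phi> = (\<Sum>n\<in>J - N1. c n * l2_inner (G n) \<phi>)"
    unfolding S2_def using GL \<phi> by (intro l2_inner_sum_left) auto
  also have "\<dots> = 0" using G\<phi> by (intro sum.neutral) auto
  finally have "l2_inner x \<phi> = of_real (2 * pi)"
    unfolding x_def using \<psi> S \<phi> \<psi>\<phi> by (subst l2_inner_diff_left) auto
  then have "2 * pi \<le> l2_norm x * l2_norm \<phi>" using l2_Cauchy_Schwarz[OF x \<phi>] by simp
  also have "\<dots> \<le> 1 / (l2_norm \<phi> + 1) * l2_norm \<phi>" using xn yn by (intro mult_right_mono) auto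
  also have "\<dots> < 1" by (rule inverse_Suc_mult_less_one) simp
  finally show False using pi_gt3 by linarith
qed

end

theorem theorem1p3:
  shows "\<exists>lam :: int \<Rightarrow> real.
     (let e = (\<lambda>n t. exp (\<i> * complex_of_real (lam n * t))) in
        l2_exact e \<and> (\<exists>G. biorthogonal e G) \<and>
        (\<forall>G. biorthogonal e G \<longrightarrow> l2_complete G UNIV \<and> \<not> hereditarily_complete e G))"
proof -
  obtain r f g :: "nat \<Rightarrow> real" where "cauchy_system node pole r f g"
    using cauchy_system_exists by blast
  then interpret cauchy_system node pole r f g .
  have e: "(\<lambda>n t. exp (\<i> * complex_of_real (lam n * t))) = esys"
    by (intro ext) (simp add: esys_def expo_def)
  have "l2_exact esys"
    unfolding l2_exact_def using esys_complete biorthogonal_minimal[OF esys_L2 dual_biorthogonal] by blast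
  then show ?thesis
    unfolding Let_def using e dual_biorthogonal biorthogonal_complete not_hereditarily_complete
    by (intro exI[of _ lam]) auto
qed

end
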